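(* Let $n\ge1$ and $\mathscr{N}_n=\{(A,B)\in M_n(\mathbb{C})\times M_n(\mathbb{C}) : AB+BA=0,\ A\text{ nilpotent}\}$. Then the irreducible components of $\mathscr{N}_n$ are exactly the varieties $\mathscr{N}_\lambda$, one for each partition $\lambda$ of $n$, and $\dim\mathscr{N}_\lambda=n^2$ for every partition $\lambda$ of $n$.
   Context: $G=GL_n(\mathbb{C})$ acts on $\mathscr{N}_n$ by simultaneous conjugation. For a partition $\lambda$ of $n$, $J_\lambda(0)$ denotes the nilpotent Jordan normal form with Jordan blocks of sizes $\lambda_1,\lambda_2,\dots$, and $\mathscr{N}_\lambda$ is the Zariski closure in $\mathscr{N}_n$ of the union of the $G$-orbits of all pairs $(J_\lambda(0),B)\in\mathscr{N}_n$. *)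

theory Defs
  imports "Jordan_Normal_Form.Jordan_Normal_Form" "HOL-Library.Extended_Nat"
begin

inductive_set polyfuns :: "('x \<Rightarrow> complex) set \<Rightarrow> ('x \<Rightarrow> complex) set"
  for Cs :: "('x \<Rightarrow> complex) set" where
  pf_const: "(\<lambda>x. c) \<in> polyfuns Cs"
| pf_coord: "f \<in> Cs \<Longrightarrow> f \<in> polyfuns Cs"
| pf_add: "f \<in> polyfuns Cs \<Longrightarrow> g \<in> polyfuns Cs \<Longrightarrow> (\<lambda>x. f x + g x) \<in> polyfuns Cs"
| pf_mult: "f \<in> polyfuns Cs \<Longrightarrow> g \<in> polyfuns Cs \<Longrightarrow> (\<lambda>x. f x * g x) \<in> polyfuns Cs"

definition zclosed :: "'x set \<Rightarrow> ('x \<Rightarrow> complex) set \<Rightarrow> 'x set \<Rightarrow> bool" where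
  "zclosed X Cs S \<longleftrightarrow> (\<exists>F \<subseteq> polyfuns Cs. S = {x \<in> X. \<forall>f \<in> F. f x = 0})"

definition zclosure :: "'x set \<Rightarrow> ('x \<Rightarrow> complex) set \<Rightarrow> 'x set \<Rightarrow> 'x set" where
  "zclosure X Cs S = X \<inter> \<Inter> {T. zclosed X Cs T \<and> S \<subseteq> T}"

definition zirreducible :: "'x set \<Rightarrow> ('x \<Rightarrow> complex) set \<Rightarrow> 'x set \<Rightarrow> bool" where
  "zirreducible X Cs Z \<longleftrightarrow> Z \<noteq> {} \<and>
     (\<forall>C1 C2. zclosed X Cs C1 \<longrightarrow> zclosed X Cs C2 \<longrightarrow> Z \<subseteq> C1 \<union> C2 \<longrightarrow> Z \<subseteq> C1 \<or> Z \<subseteq> C2)"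

definition zcomponents :: "'x set \<Rightarrow> ('x \<Rightarrow> complex) set \<Rightarrow> 'x set \<Rightarrow> 'x set set" where
  "zcomponents X Cs Y = {Z. Z \<subseteq> Y \<and> zclosed X Cs Z \<and> zirreducible X Cs Z \<and>
      (\<forall>W. W \<subseteq> Y \<and> zclosed X Cs W \<and> zirreducible X Cs W \<and> Z \<subseteq> W \<longrightarrow> W = Z)}"

definition zdim :: "'x set \<Rightarrow> ('x \<Rightarrow> complex) set \<Rightarrow> 'x set \<Rightarrow> enat" where
  "zdim X Cs Y = Sup {enat k | k. \<exists>Z :: nat \<Rightarrow> 'x set.
      (\<forall>i \<le> k. Z i \<subseteq> Y \<and> zclosed X Cs (Z i) \<and> zirreducible X Cs (Z i)) \<and>
      (\<forall>i < k. Z i \<subset> Z (Suc i))}"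

definition pairs_space :: "nat \<Rightarrow> (complex mat \<times> complex mat) set" where
  "pairs_space n = carrier_mat n n \<times> carrier_mat n n"

definition pair_coords :: "nat \<Rightarrow> (complex mat \<times> complex mat \<Rightarrow> complex) set" where
  "pair_coords n = {(\<lambda>(A,B). A $$ (i,j)) | i j. i < n \<and> j < n} \<union>
                   {(\<lambda>(A,B). B $$ (i,j)) | i j. i < n \<and> j < n}"

definition nilpotent_mat :: "complex mat \<Rightarrow> bool" where
  "nilpotent_mat A \<longleftrightarrow> (\<exists>k. A ^\<^sub>m k = 0\<^sub>m (dim_row A) (dim_col A))"

definition NN :: "nat \<Rightarrow> (complex mat \<times> complex mat) set" where
  "NN n = {(A,B) \<in> pairs_space n. A * B + B * A = 0\<^sub>m n n \<and> nilpotent_mat A}"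

definition is_partition :: "nat \<Rightarrow> nat list \<Rightarrow> bool" where
  "is_partition n lam \<longleftrightarrow> sorted_wrt (\<ge>) lam \<and> (\<forall>x \<in> set lam. 0 < x) \<and> sum_list lam = n"

definition Jnil :: "nat list \<Rightarrow> complex mat" where
  "Jnil lam = jordan_matrix (map (\<lambda>k. (k, 0)) lam)"

definition orbits_J :: "nat \<Rightarrow> nat list \<Rightarrow> (complex mat \<times> complex mat) set" where
  "orbits_J n lam = {(P * Jnil lam * Q, P * B * Q) | P Q B.
      P \<in> carrier_mat n n \<and> Q \<in> carrier_mat n n \<and> P * Q = 1\<^sub>m n \<and> (Jnil lam, B) \<in> NN n}"

definition NN_lam :: "nat \<Rightarrow> nat list \<Rightarrow> (complex mat \<times> complex mat) set" where
  "NN_lam n lam = zclosure (pairs_space n) (pair_coords n) (orbits_J n lam)"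

end

theory Submission
  imports Defs "Jordan_Normal_Form.Jordan_Normal_Form_Existence"
    "Jordan_Normal_Form.Jordan_Normal_Form_Uniqueness" "HOL-Library.Function_Algebras"
begin

text \<open>
  Fix \<open>J = Jnil lam\<close>. The alternating diagonal sign matrix \<open>S\<close> satisfies \<open>S J = - J S\<close>, so \<open>B\<close> anticommutes
  with \<open>J\<close> iff \<open>S B\<close> lies in the centralizer \<open>C\<close> of \<open>J\<close>. Let \<open>\<pi>\<close> be a linear projection of the
  \<open>n \<times> n\<close> matrices onto \<open>C\<close>. A generic invertible \<open>P\<close> can be moved by right multiplication with an
  element of \<open>C\<close> into the slice \<open>\<pi> R = 1\<close>; hence \<open>X \<mapsto> (R J R\<^sup>-\<^sup>1, R S \<pi>(X) R\<^sup>-\<^sup>1)\<close> with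
  \<open>R = 1 + X - \<pi> X\<close> is a rational map from the \<open>n\<^sup>2\<close>-dimensional affine space that is dominant onto
  \<open>NN_lam n lam\<close>, and it has a rational left inverse. So \<open>NN_lam n lam\<close> is irreducible; a flag of
  coordinate subspaces gives a chain of length \<open>n\<^sup>2\<close>; and a chain of length \<open>k\<close> gives \<open>k\<close> algebraically
  independent functions, whence \<open>k \<le> n\<^sup>2\<close> by counting monomials. Since all dimensions agree, no
  \<open>NN_lam n lam\<close> is properly contained in another; they are distinct because \<open>dim ker A\<^sup>k\<close> is
  semicontinuous and these numbers determine the Jordan type.
\<close>

text \<open>Conjugating \<open>(J, B)\<close> by \<open>P\<close> is redundant: for invertible
  \<open>Z\<close> in \<open>C\<close>, the matrices \<open>P Z\<close> and \<open>Z^-1 B Z\<close>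
  give the same pair as \<open>P\<close> and \<open>B\<close>. The slice removes exactly this. The
  kernel of \<open>\<pi>\<close> carries \<open>R - 1\<close> and \<open>C\<close> carries
  \<open>S B\<close>, so one matrix \<open>X\<close> holds both, and n^2 comes out without knowing
  the dimension of \<open>C\<close>. No basis of \<open>C\<close> is needed either:
  \<open>\<pi> = 1 - G ad J\<close> for a generalized inverse \<open>G\<close> of
  \<open>ad J\<close>. Dimension is defined by chains, so dominance gives only the upper bound. For
  the lower bound the closures of the images of the coordinate flag must stay distinct; this is why
  the inverse has to be rational in the pair itself. Moving \<open>P\<close> into the slice and
  recovering \<open>R\<close> from \<open>R J R^-1\<close> are both linear systems, arranged to
  become the identity at \<open>P = 1\<close> and at \<open>A = J\<close> respectively. Cramer's
  rule makes the solutions polynomial up to a determinant that is nonzero at that base point. Every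
  genericity claim is then reduced to polynomials in one variable on a line through a good point,
  where only finitely many values are bad.\<close>

lemma pf_sum: "finite I \<Longrightarrow> (\<And>i. i \<in> I \<Longrightarrow> f i \<in> polyfuns Cs) \<Longrightarrow> (\<lambda>x. \<Sum>i\<in>I. f i x) \<in> polyfuns Cs"
  by (induction I rule: finite_induct) (auto intro: polyfuns.intros)

lemma pf_prod: "finite I \<Longrightarrow> (\<And>i. i \<in> I \<Longrightarrow> f i \<in> polyfuns Cs) \<Longrightarrow> (\<lambda>x. \<Prod>i\<in>I. f i x) \<in> polyfuns Cs"
  by (induction I rule: finite_induct) (auto intro: polyfuns.intros)

lemma pf_power: "f \<in> polyfuns Cs \<Longrightarrow> (\<lambda>x. f x ^ k) \<in> polyfuns Cs"
  by (induction k) (auto intro: polyfuns.intros)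

lemma pf_diff: "f \<in> polyfuns Cs \<Longrightarrow> g \<in> polyfuns Cs \<Longrightarrow> (\<lambda>x. f x - g x) \<in> polyfuns Cs"
  using pf_add[of f Cs "\<lambda>x. (-1) * g x"] pf_mult[OF pf_const[of "-1"], of g Cs] by simp

lemma polyfuns_id_poly: "f \<in> polyfuns {\<lambda>t. t} \<Longrightarrow> \<exists>p. \<forall>t. f t = poly p t"
proof (induction rule: polyfuns.induct)
  case (pf_const c)
  show ?case by (rule exI[of _ "[:c:]"]) simp
next
  case (pf_coord f)
  then show ?case by (intro exI[of _ "[:0,1:]"]) simp
next
  case (pf_add f g)
  then show ?case by (metis poly_add)
next
  case (pf_mult f g)
  then show ?case by (metis poly_mult)
qed

lemma polyfuns_id_finite_zeros:
  assumes "f \<in> polyfuns {\<lambda>t. t}" "f t0 \<noteq> 0"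
  shows "finite {t. f t = 0}"
proof -
  obtain p where p: "\<And>t. f t = poly p t" using polyfuns_id_poly[OF assms(1)] by blast
  then have "p \<noteq> 0" using assms(2) by auto
  then show ?thesis using poly_roots_finite[of p] p by simp
qed

lemma polyfuns_compose:
  assumes "f \<in> polyfuns Cs" "\<And>g. g \<in> Cs \<Longrightarrow> (\<lambda>y. g (\<phi> y)) \<in> polyfuns Ds"
  shows "(\<lambda>y. f (\<phi> y)) \<in> polyfuns Ds"
  using assms(1) by induction (auto intro: polyfuns.intros assms(2))

section \<open>Zariski closed and irreducible sets\<close>

lemma zclosed_zclosure: "zclosed X Cs (zclosure X Cs S)"
proof -
  \<comment> \<open>\<open>F\<close> pools the equations of all closed sets that contain
    \<open>S\<close>; its zero set is therefore their intersection.\<close>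
  define F where "F = {f \<in> polyfuns Cs. \<exists>T F'. F' \<subseteq> polyfuns Cs \<and> T = {x \<in> X. \<forall>f \<in> F'. f x = 0} \<and> S \<subseteq> T \<and> f \<in> F'}"
  have "zclosure X Cs S = {x \<in> X. \<forall>f \<in> F. f x = 0}"
    unfolding zclosure_def zclosed_def F_def by blast
  moreover have "F \<subseteq> polyfuns Cs" unfolding F_def by blast
  ultimately show ?thesis unfolding zclosed_def by blast
qed

lemma subset_zclosure: "S \<subseteq> X \<Longrightarrow> S \<subseteq> zclosure X Cs S"
  unfolding zclosure_def by blast

lemma zclosure_minimal: "zclosed X Cs T \<Longrightarrow> S \<subseteq> T \<Longrightarrow> zclosure X Cs S \<subseteq> T"
  unfolding zclosure_def by blast

lemma zclosed_vanishing: "f \<in> polyfuns Cs \<Longrightarrow> zclosed X Cs {x \<in> X. f x = 0}"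
  unfolding zclosed_def by (rule exI[of _ "{f}"]) auto

lemma zclosure_vanish:
  assumes "S \<subseteq> X" "f \<in> polyfuns Cs" "\<And>x. x \<in> S \<Longrightarrow> f x = 0" "x \<in> zclosure X Cs S"
  shows "f x = 0"
  using zclosure_minimal[OF zclosed_vanishing[OF assms(2)], of S X] assms by blast

lemma zclosure_mono: "S \<subseteq> T \<Longrightarrow> zclosure X Cs S \<subseteq> zclosure X Cs T"
  unfolding zclosure_def by blast

lemma zclosed_subset: "zclosed X Cs T \<Longrightarrow> T \<subseteq> X"
  unfolding zclosed_def by blast

text \<open>Closed sets containing \<open>S\<close> are cut out by functions that vanish on
  \<open>S\<close>, so density can be tested one polynomial function at a time.\<close>

lemma subset_zclosureI:
  assumes "T \<subseteq> X" "\<And>f x. f \<in> polyfuns Cs \<Longrightarrow> (\<And>y. y \<in> S \<Longrightarrow> f y = 0) \<Longrightarrow> x \<in> T \<Longrightarrow> f x = 0"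
  shows "T \<subseteq> zclosure X Cs S"
proof
  fix x assume x: "x \<in> T"
  show "x \<in> zclosure X Cs S" unfolding zclosure_def
  proof (intro IntI InterI)
    show "x \<in> X" using x assms(1) by blast
    fix U assume "U \<in> {U. zclosed X Cs U \<and> S \<subseteq> U}"
    then obtain F where F: "F \<subseteq> polyfuns Cs" "U = {x \<in> X. \<forall>f\<in>F. f x = 0}" "S \<subseteq> U"
      unfolding zclosed_def by blast
    have "f x = 0" if "f \<in> F" for f
      using assms(2)[of f x] that F x by blast
    then show "x \<in> U" using F x assms(1) by blast
  qed
qed

text \<open>It is enough that any two nonempty basic open subsets of \<open>S\<close> meet.
  Irreducibility can thus be checked on parametrized points, without describing their
  closure.\<close>

lemma zirreducible_zclosureI:
  assumes "S \<noteq> {}" "S \<subseteq> X"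
    and "\<And>f g x y. f \<in> polyfuns Cs \<Longrightarrow> g \<in> polyfuns Cs \<Longrightarrow> x \<in> S \<Longrightarrow> y \<in> S \<Longrightarrow> f x \<noteq> 0 \<Longrightarrow> g y \<noteq> 0
           \<Longrightarrow> \<exists>z\<in>S. f z \<noteq> 0 \<and> g z \<noteq> 0"
  shows "zirreducible X Cs (zclosure X Cs S)"
  unfolding zirreducible_def
proof (intro conjI allI impI)
  show "zclosure X Cs S \<noteq> {}" using subset_zclosure[OF assms(2), of Cs] assms(1) by blast
  fix C1 C2 assume C: "zclosed X Cs C1" "zclosed X Cs C2" "zclosure X Cs S \<subseteq> C1 \<union> C2"
  have SC: "S \<subseteq> C1 \<union> C2" using C(3) subset_zclosure[OF assms(2), of Cs] by blast
  obtain F1 F2 where F: "F1 \<subseteq> polyfuns Cs" "C1 = {x \<in> X. \<forall>f \<in> F1. f x = 0}"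
    "F2 \<subseteq> polyfuns Cs" "C2 = {x \<in> X. \<forall>f \<in> F2. f x = 0}"
    using C unfolding zclosed_def by blast
  have "S \<subseteq> C1 \<or> S \<subseteq> C2"
  proof (rule ccontr)
    assume "\<not> ?thesis"
    then obtain x y where xy: "x \<in> S" "x \<notin> C1" "y \<in> S" "y \<notin> C2" by blast
    then obtain f g where fg: "f \<in> F1" "f x \<noteq> 0" "g \<in> F2" "g y \<noteq> 0" using F assms(2) by blast
    then obtain z where "z \<in> S" "f z \<noteq> 0" "g z \<noteq> 0"
      using assms(3)[of f g x y] xy F by blast
    then show False using SC fg F by blast
  qed
  then show "zclosure X Cs S \<subseteq> C1 \<or> zclosure X Cs S \<subseteq> C2"
    using zclosure_minimal C by metis
qed

lemma zirreducible_mult_zero: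
  assumes "zirreducible X Cs Z" "Z \<subseteq> X" "f \<in> polyfuns Cs" "g \<in> polyfuns Cs"
    and "\<And>x. x \<in> Z \<Longrightarrow> f x * g x = 0"
  shows "(\<forall>x\<in>Z. f x = 0) \<or> (\<forall>x\<in>Z. g x = 0)"
proof -
  have "Z \<subseteq> {x \<in> X. f x = 0} \<union> {x \<in> X. g x = 0}" using assms(2,5) by auto
  then have "Z \<subseteq> {x \<in> X. f x = 0} \<or> Z \<subseteq> {x \<in> X. g x = 0}"
    using assms(1) zclosed_vanishing[OF assms(3)] zclosed_vanishing[OF assms(4)]
    unfolding zirreducible_def by metis
  then show ?thesis by blast
qed

lemma zirreducible_Union:
  assumes "finite I" "zirreducible X Cs Z" "\<And>i. i \<in> I \<Longrightarrow> zclosed X Cs (C i)" "Z \<subseteq> (\<Union>i\<in>I. C i)"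
  shows "\<exists>i\<in>I. Z \<subseteq> C i"
proof -
  have un: "zclosed X Cs (A \<union> B)" if AB: "zclosed X Cs A" "zclosed X Cs B" for A B
  proof -
    obtain F1 F2 where F: "F1 \<subseteq> polyfuns Cs" "A = {x \<in> X. \<forall>f \<in> F1. f x = 0}"
    "F2 \<subseteq> polyfuns Cs" "B = {x \<in> X. \<forall>f \<in> F2. f x = 0}"
      using AB unfolding zclosed_def by blast
    \<comment> \<open>Products of one equation of \<open>A\<close> with one equation of
      \<open>B\<close> cut out the union, because a product of complex numbers vanishes only if a
      factor does.\<close>
    have "A \<union> B = {x \<in> X. \<forall>h \<in> {\<lambda>x. f x * g x | f g. f \<in> F1 \<and> g \<in> F2}. h x = 0}"
    proof (intro equalityI subsetI)
      fix x assume "x \<in> A \<union> B"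
      then show "x \<in> {x \<in> X. \<forall>h \<in> {\<lambda>x. f x * g x | f g. f \<in> F1 \<and> g \<in> F2}. h x = 0}" 
        using F by auto
    next
      fix x assume x: "x \<in> {x \<in> X. \<forall>h \<in> {\<lambda>x. f x * g x | f g. f \<in> F1 \<and> g \<in> F2}. h x = 0}"
      have "f x * g x = 0" if "f \<in> F1" "g \<in> F2" for f g
        using x that by force
      then show "x \<in> A \<union> B" using x F by (simp) blast
    qed
    moreover have "{\<lambda>x. f x * g x | f g. f \<in> F1 \<and> g \<in> F2} \<subseteq> polyfuns Cs"
      using F by (auto intro!: pf_mult)
    ultimately show ?thesis unfolding zclosed_def by blast
  qed
  have emp: "zclosed X Cs {}" unfolding zclosed_def
    by (rule exI[of _ "{\<lambda>x. 1}"]) (auto intro: pf_const)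
  have clU: "zclosed X Cs (\<Union>i\<in>I'. C i)" if "finite I'" "\<And>i. i \<in> I' \<Longrightarrow> zclosed X Cs (C i)" for I'
    using that by (induction I' rule: finite_induct) (auto intro: emp un)
  show ?thesis using assms(1,3,4)
  proof (induction I rule: finite_induct)
    case empty
    then show ?case using assms(2) unfolding zirreducible_def by auto
  next
    case (insert i I)
    have "Z \<subseteq> C i \<or> Z \<subseteq> (\<Union>i\<in>I. C i)"
      using assms(2) insert.prems clU[OF insert.hyps(1)] unfolding zirreducible_def
      by (metis UN_insert insertCI)
    then show ?case using insert by auto
  qed
qed

section \<open>Algebraic independence and chains of irreducible closed sets\<close>

text \<open>A polynomial is a coefficient family on a box of exponents. Bounding each exponent by
  \<open>T\<close>, instead of the total degree, gives exactly (T+1)^k monomials and lets one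
  variable be split off (\<open>sum_PiE_Suc\<close>); as \<open>T\<close> is arbitrary, every
  polynomial is covered.\<close>

definition alg_indep :: "nat \<Rightarrow> (nat \<Rightarrow> 'x \<Rightarrow> complex) \<Rightarrow> 'x set \<Rightarrow> bool" where
  "alg_indep k f S \<longleftrightarrow> (\<forall>T c. (\<forall>x\<in>S. (\<Sum>a \<in> {..<k} \<rightarrow>\<^sub>E {..T}. c a * (\<Prod>i<k. f i x ^ a i)) = 0)
      \<longrightarrow> (\<forall>a \<in> {..<k} \<rightarrow>\<^sub>E {..T::nat}. c a = 0))"

lemma sum_PiE_Suc:
  fixes F :: "(nat \<Rightarrow> nat) \<Rightarrow> complex"
  shows "(\<Sum>a \<in> {..<Suc k} \<rightarrow>\<^sub>E {..T::nat}. F a) = (\<Sum>j\<le>T. \<Sum>a \<in> {..<k} \<rightarrow>\<^sub>E {..T}. F (a(k := j)))"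
proof -
  have inj: "inj_on (\<lambda>(j, a). a(k := j)) ({..T} \<times> ({..<k} \<rightarrow>\<^sub>E {..T}))"
    using inj_combinator[of k "{..<k}" "\<lambda>_. {..T}"] by simp
  have "{..<Suc k} \<rightarrow>\<^sub>E {..T} = (\<lambda>(j, a). a(k := j)) ` ({..T} \<times> ({..<k} \<rightarrow>\<^sub>E {..T}))"
    unfolding lessThan_Suc by (rule PiE_insert_eq)
  then have "(\<Sum>a \<in> {..<Suc k} \<rightarrow>\<^sub>E {..T}. F a) = (\<Sum>(j,a)\<in>{..T} \<times> ({..<k} \<rightarrow>\<^sub>E {..T}). F (a(k := j)))"
    using sum.reindex[OF inj, of F] by (simp add: o_def case_prod_unfold)
  then show ?thesis by (simp add: sum.cartesian_product)
qed

text \<open>Dividing a relation by the highest power of \<open>f k\<close> and restricting it to \<open>Z\<close> leaves a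
  nontrivial relation among the first \<open>k\<close> functions.\<close>

lemma alg_indep_Suc:
  assumes ind: "alg_indep k f Z" and W: "zirreducible X Cs W" "W \<subseteq> X" and ZW: "Z \<subseteq> W"
    and f: "\<And>i. i \<le> k \<Longrightarrow> f i \<in> polyfuns Cs"
    and fZ: "\<And>x. x \<in> Z \<Longrightarrow> f k x = 0" and w: "w \<in> W" "f k w \<noteq> 0"
  shows "alg_indep (Suc k) f W"
  unfolding alg_indep_def
proof (intro allI impI, rule ccontr)
  fix T c
  assume rel: "\<forall>x\<in>W. (\<Sum>a \<in> {..<Suc k} \<rightarrow>\<^sub>E {..T}. c a * (\<Prod>i<Suc k. f i x ^ a i)) = 0"
    and "\<not> (\<forall>a \<in> {..<Suc k} \<rightarrow>\<^sub>E {..T}. c a = 0)"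
  then obtain b where b: "b \<in> {..<Suc k} \<rightarrow>\<^sub>E {..T}" "c b \<noteq> 0" by blast
  define B where "B = {..<k} \<rightarrow>\<^sub>E {..T}"
  have finB: "finite B" unfolding B_def by (intro finite_PiE) auto
  \<comment> \<open>\<open>P j\<close> is the coefficient of \<open>f k ^ j\<close> when the
    relation is read as a polynomial in \<open>f k\<close>.\<close>
  define P where "P j x = (\<Sum>a\<in>B. c (a(k := j)) * (\<Prod>i<k. f i x ^ a i))" for j x
  have P: "P j \<in> polyfuns Cs" for j
    unfolding P_def by (intro pf_sum finB pf_mult pf_const pf_prod pf_power f) auto
  have rel': "(\<Sum>j\<le>T. P j x * f k x ^ j) = 0" if "x \<in> W" for x
  proof -
    have "(\<Prod>i<Suc k. f i x ^ (a(k := j)) i) = (\<Prod>i<k. f i x ^ a i) * f k x ^ j" for a j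
      by simp
    then show ?thesis using rel that
      unfolding P_def sum_PiE_Suc by (simp add: sum_distrib_right mult.assoc B_def)
  qed
  define Q where "Q j \<longleftrightarrow> j \<le> T \<and> (\<exists>a\<in>B. c (a(k := j)) \<noteq> 0)" for j
  have "Q (b k)"
  proof -
    obtain j a where "b = a(k := j)" "j \<le> T" "a \<in> B"
      using b(1) unfolding lessThan_Suc PiE_insert_eq B_def by auto
    then show ?thesis using b(2) unfolding Q_def by auto
  qed
  define j0 where "j0 = (LEAST j. Q j)"
  have j0: "Q j0" and least: "\<And>j. j < j0 \<Longrightarrow> \<not> Q j"
    unfolding j0_def using LeastI[of Q, OF \<open>Q (b k)\<close>] not_less_Least by auto
  have Pz: "P j x = 0" if "j < j0" for j x
    using least[OF that] j0 that unfolding P_def Q_def by (intro sum.neutral) auto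
  define R where "R x = (\<Sum>j=j0..T. P j x * f k x ^ (j - j0))" for x
  have Rp: "R \<in> polyfuns Cs" unfolding R_def by (intro pf_sum pf_mult P pf_power f) auto
  have "f k x ^ j0 * R x = 0" if "x \<in> W" for x
  proof -
    have "f k x ^ j0 * R x = (\<Sum>j=j0..T. P j x * f k x ^ j)"
      unfolding R_def sum_distrib_left
    proof (rule sum.cong)
      fix j assume "j \<in> {j0..T}"
      then have "f k x ^ j = f k x ^ j0 * f k x ^ (j - j0)" by (simp flip: power_add)
      then show "f k x ^ j0 * (P j x * f k x ^ (j - j0)) = P j x * f k x ^ j" by simp
    qed simp
    also have "\<dots> = (\<Sum>j\<le>T. P j x * f k x ^ j)"
      by (rule sum.mono_neutral_left) (auto simp: Pz)
    finally show ?thesis using rel'[OF that] by simp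
  qed
  \<comment> \<open>Irreducibility of \<open>W\<close> allows the power of \<open>f k\<close> to be
    cancelled: it does not vanish at \<open>w\<close>, so the cofactor \<open>R\<close> vanishes on
    all of \<open>W\<close>.\<close>
  then have "(\<forall>x\<in>W. f k x ^ j0 = 0) \<or> (\<forall>x\<in>W. R x = 0)"
    by (intro zirreducible_mult_zero[OF W(1,2) _ Rp] pf_power f) auto
  then have R0: "\<forall>x\<in>W. R x = 0" using w by auto
  have "P j0 x = 0" if "x \<in> Z" for x
  proof -
    have "R x = P j0 x + (\<Sum>j=Suc j0..T. P j x * f k x ^ (j - j0))"
      unfolding R_def using j0 by (subst sum.atLeast_Suc_atMost) (auto simp: Q_def)
    also have "(\<Sum>j=Suc j0..T. P j x * f k x ^ (j - j0)) = 0"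
      using fZ[OF that] by (intro sum.neutral) (auto simp: power_0_left)
    finally show ?thesis using R0 ZW that by auto
  qed
  then have "\<forall>a\<in>B. c (a(k := j0)) = 0"
    using ind[unfolded alg_indep_def, rule_format, where T = T and c = "\<lambda>a. c (a(k := j0))"]
    unfolding P_def B_def by blast
  then show False using j0 unfolding Q_def by blast
qed

lemma alg_indep_cong: "(\<And>i. i < k \<Longrightarrow> f i = g i) \<Longrightarrow> alg_indep k f S = alg_indep k g S"
  unfolding alg_indep_def by simp

text \<open>Each strict inclusion contributes one function: an equation of the smaller set that does
  not vanish identically on the larger one.\<close>

lemma chain_alg_indep:
  assumes "\<And>i. i \<le> k \<Longrightarrow> zclosed X Cs (Z i) \<and> zirreducible X Cs (Z i)"
    and "\<And>i. i < k \<Longrightarrow> Z i \<subset> Z (Suc i)"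
  shows "\<exists>f. (\<forall>i<k. f i \<in> polyfuns Cs) \<and> alg_indep k f (Z k)"
  using assms
proof (induction k)
  case 0
  \<comment> \<open>For \<open>k = 0\<close> the only monomial is the constant 1, so independence
    just says that the set is nonempty.\<close>
  then obtain x where "x \<in> Z 0" unfolding zirreducible_def by blast
  then show ?case unfolding alg_indep_def by auto
next
  case (Suc k)
  then obtain f where f: "\<forall>i<k. f i \<in> polyfuns Cs" "alg_indep k f (Z k)" by auto
  have sub: "Z k \<subset> Z (Suc k)" and cl: "zclosed X Cs (Z k)" using Suc.prems by auto
  then obtain w where w: "w \<in> Z (Suc k)" "w \<notin> Z k" by blast
  have X: "Z (Suc k) \<subseteq> X" using zclosed_subset Suc.prems(1) by blast
  obtain F where F: "F \<subseteq> polyfuns Cs" "Z k = {x \<in> X. \<forall>f \<in> F. f x = 0}"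
    using cl unfolding zclosed_def by blast
  then obtain g where g: "g \<in> F" "g w \<noteq> 0" using w X by blast
  define h where "h = f(k := g)"
  have "alg_indep k h (Z k)" using f(2) alg_indep_cong[of k h f] unfolding h_def by auto
  then have "alg_indep (Suc k) h (Z (Suc k))"
    by (rule alg_indep_Suc[where X = X and Cs = Cs and w = w])
      (use Suc.prems X sub f g F w in \<open>auto simp: h_def\<close>)
  moreover have "\<forall>i<Suc k. h i \<in> polyfuns Cs" using f g F unfolding h_def by auto
  ultimately show ?case by blast
qed

section \<open>Counting monomials\<close>

text \<open>A homogeneous linear system with unknowns indexed by \<open>I\<close> and equations
  indexed by \<open>J\<close>. Gaussian elimination removes one equation together with one pivot
  unknown, which preserves the surplus of unknowns.\<close>

lemma nontrivial_solution:
  fixes c :: "'a \<Rightarrow> 'b \<Rightarrow> complex"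
  assumes "finite I" "finite J" "card J < card I"
  shows "\<exists>v. (\<exists>i\<in>I. v i \<noteq> 0) \<and> (\<forall>j\<in>J. (\<Sum>i\<in>I. v i * c i j) = 0)"
  using assms(2,1,3)
proof (induction J arbitrary: I c rule: finite_induct)
  case empty
  then have "I \<noteq> {}" by auto
  then show ?case by (intro exI[of _ "\<lambda>_. 1"]) auto
next
  case (insert j J)
  show ?case
  proof (cases "\<forall>i\<in>I. c i j = 0")
    case True
    from insert.IH[of I c] insert.prems insert.hyps obtain v
      where "\<exists>i\<in>I. v i \<noteq> 0" "\<forall>j\<in>J. (\<Sum>i\<in>I. v i * c i j) = 0" by auto
    with True show ?thesis by (intro exI[of _ v]) auto
  next
    case False
    then obtain i0 where i0: "i0 \<in> I" "c i0 j \<noteq> 0" by blast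
    define I' where "I' = I - {i0}"
    have I: "I = insert i0 I'" "i0 \<notin> I'" "finite I'" unfolding I'_def using i0 insert.prems by auto
    define c' where "c' i l = c i l - c i j / c i0 j * c i0 l" for i l
    have "card J < card I'" using insert.prems insert.hyps I by auto
    then obtain v where v: "\<exists>i\<in>I'. v i \<noteq> 0" "\<forall>l\<in>J. (\<Sum>i\<in>I'. v i * c' i l) = 0"
      using insert.IH[of I' c'] I by auto
    define s where "s = (\<Sum>i\<in>I'. v i * c i j)"
    \<comment> \<open>The pivot unknown \<open>i0\<close> gets the value that equation
      \<open>j\<close> forces on it.\<close>
    define w where "w = v(i0 := - s / c i0 j)"
    have wsum: "(\<Sum>i\<in>I. w i * c i l) = (\<Sum>i\<in>I'. v i * c i l) - s / c i0 j * c i0 l" for l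
    proof -
      have "(\<Sum>i\<in>I'. w i * c i l) = (\<Sum>i\<in>I'. v i * c i l)"
        by (rule sum.cong) (use I in \<open>auto simp: w_def\<close>)
      then show ?thesis using I by (simp add: w_def)
    qed
    have "(\<Sum>i\<in>I. w i * c i j) = 0" using wsum[of j] i0 s_def by simp
    moreover have "(\<Sum>i\<in>I. w i * c i l) = 0" if "l \<in> J" for l
    proof -
      have "(\<Sum>i\<in>I'. v i * c' i l) = (\<Sum>i\<in>I'. v i * c i l) - s / c i0 j * c i0 l"
        unfolding c'_def s_def
        by (simp add: algebra_simps sum_subtractf sum_distrib_left sum_distrib_right sum_divide_distrib)
      then show ?thesis using v that wsum by simp
    qed
    moreover have "\<exists>i\<in>I. w i \<noteq> 0" using v I unfolding w_def by auto
    ultimately show ?thesis by (intro exI[of _ w]) auto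
  qed
qed

text \<open>Affine \<open>N\<close>-space is modelled on infinite sequences of which polynomial
  functions see only the first \<open>N\<close> entries; coordinate subspaces then need no change of
  type.\<close>

definition ncoords :: "nat \<Rightarrow> ((nat \<Rightarrow> complex) \<Rightarrow> complex) set" where
  "ncoords N = {(\<lambda>x. x p) | p. p < N}"

text \<open>The bound \<open>d\<close> applies to each exponent separately: bounds add under
  products, and there are at most (d+1)^N monomials.\<close>

definition monomials :: "nat \<Rightarrow> nat \<Rightarrow> ((nat \<Rightarrow> complex) \<Rightarrow> complex) set" where
  "monomials N d = (\<lambda>a x. \<Prod>i<N. x i ^ a i) ` ({..<N} \<rightarrow>\<^sub>E {..d})"

lemma finite_monomials: "finite (monomials N d)"
  unfolding monomials_def by (intro finite_imageI finite_PiE) auto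

lemma card_monomials: "card (monomials N d) \<le> (d + 1) ^ N"
proof -
  have "card (monomials N d) \<le> card ({..<N} \<rightarrow>\<^sub>E {..d})"
    unfolding monomials_def by (intro card_image_le finite_PiE) auto
  then show ?thesis by (simp add: card_PiE)
qed

text \<open>The linear span, built one term at a time so that proofs go by induction;
  \<open>lspan_finite\<close> recovers coefficients when \<open>S\<close> is finite.\<close>

inductive_set lspan :: "('y \<Rightarrow> complex) set \<Rightarrow> ('y \<Rightarrow> complex) set" for S where
  lspan_0: "(\<lambda>x. 0) \<in> lspan S"
| lspan_add: "f \<in> lspan S \<Longrightarrow> b \<in> S \<Longrightarrow> (\<lambda>x. f x + c * b x) \<in> lspan S"

lemma lspan_plus: "f \<in> lspan S \<Longrightarrow> g \<in> lspan S \<Longrightarrow> (\<lambda>x. f x + g x) \<in> lspan S"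
proof (induction rule: lspan.induct)
  case lspan_0
  then show ?case by simp
next
  case (lspan_add f b c)
  then show ?case using lspan.lspan_add[of "\<lambda>x. f x + g x" S b c] by (simp add: algebra_simps)
qed

lemma lspan_scale: "f \<in> lspan S \<Longrightarrow> (\<lambda>x. c * f x) \<in> lspan S"
proof (induction rule: lspan.induct)
  case lspan_0
  then show ?case using lspan.lspan_0 by simp
next
  case (lspan_add f b d)
  then show ?case using lspan.lspan_add[of "\<lambda>x. c * f x" S b "c * d"] by (simp add: algebra_simps)
qed

lemma lspan_base: "b \<in> S \<Longrightarrow> b \<in> lspan S"
  using lspan_add[OF lspan_0, of b S 1] by simp

lemma lspan_mono: "f \<in> lspan S \<Longrightarrow> S \<subseteq> S' \<Longrightarrow> f \<in> lspan S'"
  by (induction rule: lspan.induct) (auto intro: lspan.intros)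

lemma lspan_mult:
  assumes "f \<in> lspan S" "g \<in> lspan S'" "\<And>a b. a \<in> S \<Longrightarrow> b \<in> S' \<Longrightarrow> (\<lambda>x. a x * b x) \<in> U"
  shows "(\<lambda>x. f x * g x) \<in> lspan U"
  using assms(1)
proof induction
  case lspan_0
  then show ?case using lspan.lspan_0 by simp
next
  case (lspan_add f b c)
  have "(\<lambda>x. b x * g x) \<in> lspan U" using assms(2)
  proof induction
    case lspan_0
    then show ?case using lspan.lspan_0 by simp
  next
    case (lspan_add g d c)
    then show ?case using lspan.lspan_add[OF lspan_add.IH assms(3)[OF \<open>b \<in> S\<close>], of d c]
      by (simp add: algebra_simps)
  qed
  then have "(\<lambda>x. f x * g x + c * (b x * g x)) \<in> lspan U"
    by (intro lspan_plus lspan_add.IH lspan_scale)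
  then show ?case by (simp add: algebra_simps)
qed

lemma lspan_finite: "f \<in> lspan S \<Longrightarrow> finite S \<Longrightarrow> \<exists>c. \<forall>x. f x = (\<Sum>b\<in>S. c b * b x)"
proof (induction rule: lspan.induct)
  case lspan_0
  then show ?case by (intro exI[of _ "\<lambda>_. 0"]) simp
next
  case (lspan_add f b d)
  then obtain c where c: "\<forall>x. f x = (\<Sum>b\<in>S. c b * b x)" by blast
  have "(\<Sum>b'\<in>S. (c(b := c b + d)) b' * b' x) = (\<Sum>b\<in>S. c b * b x) + d * b x" for x
    using lspan_add.prems lspan_add.hyps
    by (simp add: sum.remove[of S b] algebra_simps)
  then show ?case using c by (intro exI[of _ "c(b := c b + d)"]) auto
qed

lemma monomials_mono: "d \<le> d' \<Longrightarrow> monomials N d \<subseteq> monomials N d'"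
  unfolding monomials_def by (intro image_mono PiE_mono) auto

lemma monomials_mult:
  assumes "a \<in> monomials N d" "b \<in> monomials N d'"
  shows "(\<lambda>x. a x * b x) \<in> monomials N (d + d')"
proof -
  obtain u v where uv: "u \<in> {..<N} \<rightarrow>\<^sub>E {..d}" "v \<in> {..<N} \<rightarrow>\<^sub>E {..d'}"
    "a = (\<lambda>x. \<Prod>i<N. x i ^ u i)" "b = (\<lambda>x. \<Prod>i<N. x i ^ v i)"
    using assms unfolding monomials_def by blast
  define w where "w = (\<lambda>i\<in>{..<N}. u i + v i)"
  have "w \<in> {..<N} \<rightarrow>\<^sub>E {..d + d'}"
    unfolding w_def using uv(1,2) by (auto simp: PiE_iff add_mono)
  moreover have "(\<lambda>x. a x * b x) = (\<lambda>x. \<Prod>i<N. x i ^ w i)"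
    unfolding uv w_def by (auto simp: power_add prod.distrib)
  ultimately show ?thesis unfolding monomials_def by blast
qed

lemma lspan_monomials_mult:
  "f \<in> lspan (monomials N d) \<Longrightarrow> g \<in> lspan (monomials N d') \<Longrightarrow> (\<lambda>x. f x * g x) \<in> lspan (monomials N (d + d'))"
  by (rule lspan_mult) (auto intro: monomials_mult)

lemma const_lspan_monomials: "(\<lambda>x. c) \<in> lspan (monomials N d)"
proof -
  have "(\<lambda>x. \<Prod>i<N. x i ^ (\<lambda>i\<in>{..<N}. 0) i) \<in> monomials N d"
    unfolding monomials_def by (intro imageI) (auto simp: PiE_iff extensional_def)
  then have "(\<lambda>x. 1) \<in> monomials N d" by simp
  from lspan_scale[OF lspan_base[OF this], of c] show ?thesis by simp
qed

lemma polyfuns_lspan_monomials: "f \<in> polyfuns (ncoords N) \<Longrightarrow> \<exists>d. f \<in> lspan (monomials N d)"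
proof (induction rule: polyfuns.induct)
  case (pf_const c)
  show ?case using const_lspan_monomials by blast
next
  case (pf_coord f)
  then obtain p where p: "p < N" "f = (\<lambda>x. x p)" unfolding ncoords_def by blast
  have "(\<lambda>x. \<Prod>i<N. x i ^ (\<lambda>i\<in>{..<N}. if i = p then 1 else 0) i) \<in> monomials N 1"
    unfolding monomials_def by (intro imageI) (auto simp: PiE_iff extensional_def)
  moreover have "(\<lambda>x. \<Prod>i<N. x i ^ (\<lambda>i\<in>{..<N}. if i = p then 1 else 0) i) = f"
    unfolding p using p(1) by (auto simp: if_distrib[of "\<lambda>k. _ ^ k"] prod.delta cong: if_cong)
  ultimately show ?case by (metis lspan_base)
next
  case (pf_add f g)
  then obtain d d' where "f \<in> lspan (monomials N d)" "g \<in> lspan (monomials N d')" by blast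
  then have "f \<in> lspan (monomials N (d + d'))" "g \<in> lspan (monomials N (d + d'))"
    using lspan_mono monomials_mono by (metis le_add1, metis le_add2)
  then show ?case by (metis lspan_plus)
next
  case (pf_mult f g)
  then show ?case using lspan_monomials_mult by blast
qed

lemma lspan_monomials_power:
  "f \<in> lspan (monomials N d) \<Longrightarrow> (\<lambda>x. f x ^ k) \<in> lspan (monomials N (k * d))"
proof (induction k)
  case 0
  show ?case using const_lspan_monomials[of 1] by simp
next
  case (Suc k)
  then show ?case using lspan_monomials_mult[OF Suc.prems Suc.IH] by (simp add: mult.commute)
qed

lemma lspan_monomials_prod:
  assumes "\<And>i. i < k \<Longrightarrow> f i \<in> lspan (monomials N d)"
  shows "(\<lambda>x. \<Prod>i<k. f i x) \<in> lspan (monomials N (k * d))"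
  using assms
proof (induction k)
  case 0
  show ?case using const_lspan_monomials[of 1] by simp
next
  case (Suc k)
  then show ?case using lspan_monomials_mult[of "\<lambda>x. \<Prod>i<k. f i x" N "k * d" "f k" d]
    by (simp add: add.commute)
qed

section \<open>Rational parametrizations\<close>

lemma polyfuns_line:
  assumes "f \<in> polyfuns (ncoords N)"
  shows "(\<lambda>t. f (\<lambda>k. x k + t * (y k - x k))) \<in> polyfuns {\<lambda>t. t}"
proof (rule polyfuns_compose[OF assms])
  fix g assume "g \<in> ncoords N"
  then obtain p where "g = (\<lambda>x. x p)" unfolding ncoords_def by blast
  then show "(\<lambda>t. g (\<lambda>k. x k + t * (y k - x k))) \<in> polyfuns {\<lambda>t. t}"
    using pf_add[OF pf_const pf_mult[OF pf_coord[OF singletonI] pf_const]] by simp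
qed

lemma common_nonzero:
  assumes "finite {t::complex. f t = 0}" "finite {t. g t = 0}"
  shows "\<exists>t. f t \<noteq> (0::complex) \<and> g t \<noteq> (0::complex)"
proof -
  have "{t. f t = 0} \<union> {t. g t = 0} \<noteq> UNIV"
    using assms infinite_UNIV_char_0 by (metis finite_Un)
  then show ?thesis by blast
qed

text \<open>Irreducibility of the coordinate subspaces. On the line through \<open>x\<close> and
  \<open>y\<close> both functions are one-variable polynomials, nonzero at \<open>t = 0\<close> and
  \<open>t = 1\<close> respectively, so finitely many values of \<open>t\<close> are
  excluded.\<close>

lemma ncoords_nonvanishing:
  assumes "f \<in> polyfuns (ncoords N)" "g \<in> polyfuns (ncoords N)" "f x \<noteq> 0" "g y \<noteq> 0"
    and "\<And>p. p \<ge> i \<Longrightarrow> x p = 0" "\<And>p. p \<ge> i \<Longrightarrow> y p = 0"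
  shows "\<exists>z. (\<forall>p\<ge>i. z p = 0) \<and> f z \<noteq> 0 \<and> g z \<noteq> 0"
proof -
  define l where "l t k = x k + t * (y k - x k)" for t k
  have pf: "(\<lambda>t. f (l t)) \<in> polyfuns {\<lambda>t. t}" "(\<lambda>t. g (l t)) \<in> polyfuns {\<lambda>t. t}"
    unfolding l_def using polyfuns_line assms(1,2) by auto
  have l01: "l 0 = x" "l 1 = y" unfolding l_def by auto
  have "finite {t. f (l t) = 0}" "finite {t. g (l t) = 0}"
    using polyfuns_id_finite_zeros[OF pf(1), of 0] polyfuns_id_finite_zeros[OF pf(2), of 1]
      l01 assms(3,4) by auto
  then obtain t where "f (l t) \<noteq> 0" "g (l t) \<noteq> 0" using common_nonzero[of "\<lambda>t. f (l t)" "\<lambda>t. g (l t)"] by blast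
  then show ?thesis using assms(5,6) by (intro exI[of _ "l t"]) (auto simp: l_def)
qed

text \<open>Clearing denominators: if the coordinates of \<open>\<phi>\<close> have denominator
  \<open>q\<close>, a polynomial in them has a power of \<open>q\<close> as denominator.\<close>

lemma rational_pullback:
  assumes "f \<in> polyfuns Cs" "q \<in> polyfuns Ds"
    and "\<And>f. f \<in> Cs \<Longrightarrow> \<exists>g\<in>polyfuns Ds. \<forall>x. q x \<noteq> 0 \<longrightarrow> q x * f (\<phi> x) = g x"
  shows "\<exists>e. \<exists>g\<in>polyfuns Ds. \<forall>x. q x \<noteq> 0 \<longrightarrow> q x ^ e * f (\<phi> x) = g x"
  using assms(1)
proof induction
  case (pf_const c)
  show ?case by (intro exI[of _ 0] bexI[of _ "\<lambda>x. c"]) (auto intro: polyfuns.intros)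
next
  case (pf_coord f)
  from assms(3)[OF this] show ?case by (intro exI[of _ 1]) auto
next
  case (pf_add f g)
  then obtain d u e v where *: "u \<in> polyfuns Ds" "\<And>x. q x \<noteq> 0 \<Longrightarrow> q x ^ d * f (\<phi> x) = u x"
      "v \<in> polyfuns Ds" "\<And>x. q x \<noteq> 0 \<Longrightarrow> q x ^ e * g (\<phi> x) = v x" by metis
  show ?case
    by (intro exI[of _ "d + e"] bexI[of _ "\<lambda>x. q x ^ e * u x + q x ^ d * v x"]
        polyfuns.pf_add[OF polyfuns.pf_mult[OF pf_power[OF assms(2)] *(1)] polyfuns.pf_mult[OF pf_power[OF assms(2)] *(3)]])
      (auto simp: power_add algebra_simps *(2,4)[symmetric])
next
  case (pf_mult f g)
  then obtain d u e v where *: "u \<in> polyfuns Ds" "\<And>x. q x \<noteq> 0 \<Longrightarrow> q x ^ d * f (\<phi> x) = u x"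
      "v \<in> polyfuns Ds" "\<And>x. q x \<noteq> 0 \<Longrightarrow> q x ^ e * g (\<phi> x) = v x" by metis
  show ?case
    by (intro exI[of _ "d + e"] bexI[of _ "\<lambda>x. u x * v x"])
      (auto simp: power_add algebra_simps *(2,4)[symmetric] intro!: polyfuns.pf_mult pf_power assms(2) *(1,3))
qed

lemma zirreducible_rational_image:
  assumes q: "q \<in> polyfuns (ncoords N)"
    and rat: "\<And>f. f \<in> Cs \<Longrightarrow> \<exists>g\<in>polyfuns (ncoords N). \<forall>x. q x \<noteq> 0 \<longrightarrow> q x * f (\<phi> x) = g x"
    and X: "\<And>x. q x \<noteq> 0 \<Longrightarrow> \<phi> x \<in> X" and q0: "q (\<lambda>_. 0) \<noteq> 0"
  shows "zirreducible X Cs (zclosure X Cs (\<phi> ` {x. (\<forall>p\<ge>i. x p = 0) \<and> q x \<noteq> 0}))"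
proof (rule zirreducible_zclosureI)
  show "\<phi> ` {x. (\<forall>p\<ge>i. x p = 0) \<and> q x \<noteq> 0} \<noteq> {}" using q0 by auto
  show "\<phi> ` {x. (\<forall>p\<ge>i. x p = 0) \<and> q x \<noteq> 0} \<subseteq> X" using X by auto
  fix f g a b
  assume fg: "f \<in> polyfuns Cs" "g \<in> polyfuns Cs" "f a \<noteq> 0" "g b \<noteq> 0"
    and "a \<in> \<phi> ` {x. (\<forall>p\<ge>i. x p = 0) \<and> q x \<noteq> 0}" "b \<in> \<phi> ` {x. (\<forall>p\<ge>i. x p = 0) \<and> q x \<noteq> 0}"
  then obtain x y where xy: "a = \<phi> x" "b = \<phi> y" "\<forall>p\<ge>i. x p = 0" "\<forall>p\<ge>i. y p = 0" "q x \<noteq> 0" "q y \<noteq> 0"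
    by blast
  obtain d u where u: "u \<in> polyfuns (ncoords N)" "\<And>x. q x \<noteq> 0 \<Longrightarrow> q x ^ d * f (\<phi> x) = u x"
    using rational_pullback[where \<phi> = \<phi>, OF fg(1) q rat] by blast
  obtain e v where v: "v \<in> polyfuns (ncoords N)" "\<And>x. q x \<noteq> 0 \<Longrightarrow> q x ^ e * g (\<phi> x) = v x"
    using rational_pullback[where \<phi> = \<phi>, OF fg(2) q rat] by blast
  \<comment> \<open>The extra factor \<open>q\<close> keeps \<open>z\<close> inside the domain of
    the rational map.\<close>
  have "\<exists>z. (\<forall>p\<ge>i. z p = 0) \<and> q z * u z \<noteq> 0 \<and> q z * v z \<noteq> 0"
    by (rule ncoords_nonvanishing[where x = x and y = y])
      (use xy fg q u(1) v(1) in \<open>auto simp: u(2)[symmetric] v(2)[symmetric] intro!: pf_mult\<close>)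
  then obtain z where "\<forall>p\<ge>i. z p = 0" "q z \<noteq> 0" "u z \<noteq> 0" "v z \<noteq> 0" by auto
  then show "\<exists>z\<in>\<phi> ` {x. (\<forall>p\<ge>i. x p = 0) \<and> q x \<noteq> 0}. f z \<noteq> 0 \<and> g z \<noteq> 0"
    using u(2)[of z] v(2)[of z] by auto
qed

lemma uniform_exponent:
  assumes "\<And>i. i < (k::nat) \<Longrightarrow> \<exists>e. P i e" "\<And>i e e'. P i e \<Longrightarrow> e \<le> e' \<Longrightarrow> P i e'"
  shows "\<exists>e::nat. \<forall>i<k. P i e"
  using assms(1)
proof (induction k)
  case (Suc k)
  then obtain e e' where "\<forall>i<k. P i e" "P k e'" by (metis lessI less_Suc_eq)
  then have "\<forall>i<Suc k. P i (max e e')" using assms(2) by (metis less_Suc_eq max.cobounded1 max.cobounded2)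
  then show ?case by blast
qed auto

text \<open>Pigeonhole for monomials. Over a common denominator, the (T+1)^k monomials in the
  \<open>f i\<close> become polynomials in \<open>N\<close> variables of degree linear in
  \<open>T\<close>, which span a space of dimension of order T^N. If \<open>k > N\<close>, a large
  \<open>T\<close> forces a linear relation.\<close>

lemma alg_indep_rational_image_le:
  assumes q: "q \<in> polyfuns (ncoords N)"
    and rat: "\<And>f. f \<in> Cs \<Longrightarrow> \<exists>g\<in>polyfuns (ncoords N). \<forall>x. q x \<noteq> 0 \<longrightarrow> q x * f (\<phi> x) = g x"
    and f: "\<And>i. i < k \<Longrightarrow> f i \<in> polyfuns Cs"
    and ind: "alg_indep k f (\<phi> ` {x. q x \<noteq> 0})"
  shows "k \<le> N"
proof (rule ccontr)
  assume "\<not> k \<le> N"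
  have "\<exists>E. \<forall>i<k. \<exists>g\<in>polyfuns (ncoords N). \<forall>x. q x \<noteq> 0 \<longrightarrow> q x ^ E * f i (\<phi> x) = g x"
  proof (rule uniform_exponent)
    fix i assume "i < k"
    show "\<exists>e. \<exists>g\<in>polyfuns (ncoords N). \<forall>x. q x \<noteq> 0 \<longrightarrow> q x ^ e * f i (\<phi> x) = g x"
      by (rule rational_pullback[OF f[OF \<open>i < k\<close>] q rat])
  next
    fix i e e' :: nat
    assume "\<exists>g\<in>polyfuns (ncoords N). \<forall>x. q x \<noteq> 0 \<longrightarrow> q x ^ e * f i (\<phi> x) = g x" and le: "e \<le> e'"
    then obtain g where g: "g \<in> polyfuns (ncoords N)" "\<And>x. q x \<noteq> 0 \<Longrightarrow> q x ^ e * f i (\<phi> x) = g x" by blast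
    have "q x ^ e' = q x ^ (e' - e) * q x ^ e" for x using le by (simp flip: power_add)
    then show "\<exists>g\<in>polyfuns (ncoords N). \<forall>x. q x \<noteq> 0 \<longrightarrow> q x ^ e' * f i (\<phi> x) = g x"
      by (intro bexI[of _ "\<lambda>x. q x ^ (e' - e) * g x"])
        (auto simp: g(2)[symmetric] intro!: pf_mult pf_power q g(1))
  qed
  then obtain E g where g: "\<And>i. i < k \<Longrightarrow> g i \<in> polyfuns (ncoords N)"
    "\<And>i x. i < k \<Longrightarrow> q x \<noteq> 0 \<Longrightarrow> q x ^ E * f i (\<phi> x) = g i x" by metis
  define h where "h x = q x ^ E" for x
  have hp: "h \<in> polyfuns (ncoords N)" unfolding h_def by (intro pf_power q)
  have "\<exists>D. \<forall>i<k. g i \<in> lspan (monomials N D)"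
    by (rule uniform_exponent) (auto intro: polyfuns_lspan_monomials g(1) lspan_mono[OF _ monomials_mono])
  then obtain D1 where D1: "\<And>i. i < k \<Longrightarrow> g i \<in> lspan (monomials N D1)" by blast
  obtain D2 where D2: "h \<in> lspan (monomials N D2)" using polyfuns_lspan_monomials[OF hp] by blast
  define D where "D = D1 + D2"
  have D: "i < k \<Longrightarrow> g i \<in> lspan (monomials N D)" "h \<in> lspan (monomials N D)" for i
    unfolding D_def using lspan_mono[OF D1 monomials_mono] lspan_mono[OF D2 monomials_mono] by auto
  \<comment> \<open>Chosen so that (k T D + 1)^N, which is at most ((k D + 1)(T + 1))^N = T (T +
    1)^N, stays below (T + 1)^(N + 1).\<close>
  define T where "T = (k * D + 1) ^ N"
  define B where "B = {..<k} \<rightarrow>\<^sub>E {..T}"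
  have finB: "finite B" unfolding B_def by (intro finite_PiE) auto
  define M where "M = monomials N (k * (T * D))"
  have finM: "finite M" unfolding M_def by (rule finite_monomials)
  have "card M \<le> (k * (T * D) + 1) ^ N" unfolding M_def by (rule card_monomials)
  also have "\<dots> \<le> ((k * D + 1) * (T + 1)) ^ N" by (rule power_mono) (auto simp: algebra_simps)
  also have "\<dots> = T * (T + 1) ^ N" unfolding power_mult_distrib T_def by simp
  also have "\<dots> < (T + 1) ^ Suc N" by simp
  also have "\<dots> \<le> (T + 1) ^ k" using \<open>\<not> k \<le> N\<close> by (intro power_increasing) auto
  also have "\<dots> = card B" unfolding B_def by (simp add: card_PiE)
  finally have less: "card M < card B" .
  \<comment> \<open>Homogenization: padding each factor with \<open>h ^ (T - a i)\<close> gives all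
    products the same denominator \<open>h ^ (T * k)\<close>, so a relation among them can be
    divided by it.\<close>
  define F where "F a x = (\<Prod>i<k. g i x ^ a i * h x ^ (T - a i))" for a x
  have "F a \<in> lspan M" if "a \<in> B" for a
    unfolding F_def M_def
  proof (rule lspan_monomials_prod)
    fix i assume i: "i < k"
    then have "a i \<le> T" using that unfolding B_def by auto
    then have "a i * D + (T - a i) * D = T * D" by (simp flip: add_mult_distrib)
    then show "(\<lambda>x. g i x ^ a i * h x ^ (T - a i)) \<in> lspan (monomials N (T * D))"
      using lspan_monomials_mult[OF lspan_monomials_power[OF D(1)[OF i], of "a i"] lspan_monomials_power[OF D(2), of "T - a i"]]
      by simp
  qed
  then have "\<forall>a\<in>B. \<exists>c. \<forall>x. F a x = (\<Sum>b\<in>M. c b * b x)" using lspan_finite finM by blast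
  then obtain c where c: "\<And>a x. a \<in> B \<Longrightarrow> F a x = (\<Sum>b\<in>M. c a b * b x)" by metis
  obtain v where v: "\<exists>a\<in>B. v a \<noteq> 0" "\<forall>b\<in>M. (\<Sum>a\<in>B. v a * c a b) = 0"
    using nontrivial_solution[OF finB finM less, of c] by blast
  have sum0: "(\<Sum>a\<in>B. v a * F a x) = 0" for x
  proof -
    have "(\<Sum>a\<in>B. v a * F a x) = (\<Sum>a\<in>B. \<Sum>b\<in>M. v a * c a b * b x)"
      by (rule sum.cong) (auto simp: c sum_distrib_left mult.assoc)
    also have "\<dots> = (\<Sum>b\<in>M. (\<Sum>a\<in>B. v a * c a b) * b x)"
      by (subst sum.swap) (simp add: sum_distrib_right)
    finally show ?thesis using v by simp
  qed
  have "(\<Sum>a\<in>B. v a * (\<Prod>i<k. f i (\<phi> x) ^ a i)) = 0" if "q x \<noteq> 0" for x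
  proof -
    have Fx: "F a x = h x ^ (T * k) * (\<Prod>i<k. f i (\<phi> x) ^ a i)" if "a \<in> B" for a
    proof -
      have "g i x ^ a i * h x ^ (T - a i) = h x ^ T * f i (\<phi> x) ^ a i" if "i < k" for i
      proof -
        have "a i \<le> T" using \<open>a \<in> B\<close> \<open>i < k\<close> unfolding B_def by auto
        then have "h x ^ T = h x ^ a i * h x ^ (T - a i)" by (simp flip: power_add)
        moreover have "g i x = h x * f i (\<phi> x)" unfolding h_def using g(2)[OF \<open>i < k\<close> \<open>q x \<noteq> 0\<close>] by simp
        ultimately show ?thesis by (simp add: power_mult_distrib)
      qed
      then have "F a x = (\<Prod>i<k. h x ^ T * f i (\<phi> x) ^ a i)" unfolding F_def by (intro prod.cong) auto
      then show ?thesis by (simp add: prod.distrib power_mult)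
    qed
    have "h x ^ (T * k) * (\<Sum>a\<in>B. v a * (\<Prod>i<k. f i (\<phi> x) ^ a i)) = (\<Sum>a\<in>B. v a * F a x)"
      unfolding sum_distrib_left by (rule sum.cong) (auto simp: Fx)
    moreover have "h x \<noteq> 0" unfolding h_def using that by simp
    ultimately show ?thesis using sum0 by simp
  qed
  then have "\<forall>a\<in>B. v a = 0"
    using ind[unfolded alg_indep_def, rule_format, where T = T and c = v] unfolding B_def by blast
  then show False using v by blast
qed

section \<open>Matrices of polynomial functions\<close>

definition polymat :: "('y \<Rightarrow> complex) set \<Rightarrow> nat \<Rightarrow> nat \<Rightarrow> ('y \<Rightarrow> complex mat) \<Rightarrow> bool" where
  "polymat Cs m n M \<longleftrightarrow> (\<forall>y. M y \<in> carrier_mat m n) \<and>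
     (\<forall>i<m. \<forall>j<n. (\<lambda>y. M y $$ (i,j)) \<in> polyfuns Cs)"

lemma polymat_carrier: "polymat Cs m n M \<Longrightarrow> M y \<in> carrier_mat m n"
  unfolding polymat_def by blast

lemma polymat_entry: "polymat Cs m n M \<Longrightarrow> i < m \<Longrightarrow> j < n \<Longrightarrow> (\<lambda>y. M y $$ (i,j)) \<in> polyfuns Cs"
  unfolding polymat_def by blast

lemma polymat_const: "M \<in> carrier_mat m n \<Longrightarrow> polymat Cs m n (\<lambda>_. M)"
  unfolding polymat_def by (auto intro: pf_const)

lemma polymat_mat:
  assumes "\<And>i j. i < m \<Longrightarrow> j < n \<Longrightarrow> (\<lambda>y. f y i j) \<in> polyfuns Cs"
  shows "polymat Cs m n (\<lambda>y. mat m n (\<lambda>(i,j). f y i j))"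
  unfolding polymat_def using assms by auto

lemma polymat_add:
  assumes "polymat Cs m n A" "polymat Cs m n B"
  shows "polymat Cs m n (\<lambda>y. A y + B y)"
  unfolding polymat_def
proof (intro conjI allI impI)
  fix y show "A y + B y \<in> carrier_mat m n" using polymat_carrier[OF assms(2), of y] by simp
next
  fix i j assume ij: "i < m" "j < n"
  have "(A y + B y) $$ (i,j) = A y $$ (i,j) + B y $$ (i,j)" for y
    using polymat_carrier[OF assms(2), of y] ij by auto
  then show "(\<lambda>y. (A y + B y) $$ (i,j)) \<in> polyfuns Cs"
    using pf_add[OF polymat_entry[OF assms(1) ij] polymat_entry[OF assms(2) ij]] by simp
qed

lemma polymat_minus:
  assumes "polymat Cs m n A" "polymat Cs m n B"
  shows "polymat Cs m n (\<lambda>y. A y - B y)"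
  unfolding polymat_def
proof (intro conjI allI impI)
  fix y show "A y - B y \<in> carrier_mat m n" using assms polymat_carrier by (metis minus_carrier_mat)
next
  fix i j assume ij: "i < m" "j < n"
  have "(A y - B y) $$ (i,j) = A y $$ (i,j) - B y $$ (i,j)" for y
    using polymat_carrier[OF assms(2), of y] ij by auto
  then show "(\<lambda>y. (A y - B y) $$ (i,j)) \<in> polyfuns Cs"
    using pf_diff[OF polymat_entry[OF assms(1) ij] polymat_entry[OF assms(2) ij]] by simp
qed

lemma polymat_smult:
  assumes "f \<in> polyfuns Cs" "polymat Cs m n A"
  shows "polymat Cs m n (\<lambda>y. f y \<cdot>\<^sub>m A y)"
  unfolding polymat_def
proof (intro conjI allI impI)
  fix y show "f y \<cdot>\<^sub>m A y \<in> carrier_mat m n" using polymat_carrier[OF assms(2), of y] by simp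
next
  fix i j assume ij: "i < m" "j < n"
  have "(f y \<cdot>\<^sub>m A y) $$ (i,j) = f y * A y $$ (i,j)" for y
    using polymat_carrier[OF assms(2), of y] ij by auto
  then show "(\<lambda>y. (f y \<cdot>\<^sub>m A y) $$ (i,j)) \<in> polyfuns Cs"
    using pf_mult[OF assms(1) polymat_entry[OF assms(2) ij]] by simp
qed

lemma mult_mat_index:
  assumes "A \<in> carrier_mat m l" "B \<in> carrier_mat l n" "i < m" "j < n"
  shows "(A * B) $$ (i,j) = (\<Sum>k<l. A $$ (i,k) * B $$ (k,j))"
  using assms by (simp add: scalar_prod_def atLeast0LessThan)

lemma polymat_mult:
  assumes "polymat Cs m l A" "polymat Cs l n B"
  shows "polymat Cs m n (\<lambda>y. A y * B y)"
  unfolding polymat_def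
proof (intro conjI allI impI)
  fix y show "A y * B y \<in> carrier_mat m n" using assms polymat_carrier by (metis mult_carrier_mat)
next
  fix i j assume ij: "i < m" "j < n"
  have "(A y * B y) $$ (i,j) = (\<Sum>k<l. A y $$ (i,k) * B y $$ (k,j))" for y
    by (rule mult_mat_index) (use assms polymat_carrier ij in auto)
  then show "(\<lambda>y. (A y * B y) $$ (i,j)) \<in> polyfuns Cs"
    using ij assms by (auto intro!: pf_sum pf_mult polymat_entry)
qed

lemma polymat_power:
  assumes "polymat Cs n n A"
  shows "polymat Cs n n (\<lambda>y. A y ^\<^sub>m k)"
proof (induction k)
  case 0
  have "dim_row (A y) = n" for y using polymat_carrier[OF assms, of y] by auto
  then show ?case by (simp add: polymat_const)
next
  case (Suc k)
  then show ?case using polymat_mult[OF Suc assms] by simp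
qed

lemma polymat_det:
  assumes "polymat Cs n n A"
  shows "(\<lambda>y. det (A y)) \<in> polyfuns Cs"
proof -
  have "det (A y) = (\<Sum>p\<in>{p. p permutes {0..<n}}. signof p * (\<Prod>i\<in>{0..<n}. A y $$ (i, p i)))" for y
    using det_def'[OF polymat_carrier[OF assms]] by simp
  moreover have "p i < n" if "p permutes {0..<n}" "i < n" for p i
    using permutes_in_image[OF that(1), of i] that(2) by auto
  ultimately show ?thesis
    by (auto intro!: pf_sum pf_mult pf_const pf_prod polymat_entry[OF assms] finite_permutations)
qed

lemma polymat_adj:
  assumes "polymat Cs n n A"
  shows "polymat Cs n n (\<lambda>y. adj_mat (A y))"
proof -
  have c: "A y \<in> carrier_mat n n" for y using polymat_carrier[OF assms] .
  have "adj_mat (A y) = mat n n (\<lambda>(i,j). cofactor (A y) j i)" for y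
    using c[of y] unfolding adj_mat_def by auto
  moreover have "polymat Cs n n (\<lambda>y. mat n n (\<lambda>(i,j). cofactor (A y) j i))"
  proof (rule polymat_mat)
    fix i j assume ij: "i < n" "j < n"
    have "polymat Cs (n - 1) (n - 1) (\<lambda>y. mat_delete (A y) j i)"
      unfolding polymat_def
    proof (intro conjI allI impI)
      show "mat_delete (A y) j i \<in> carrier_mat (n - 1) (n - 1)" for y
        using c[of y] by (rule mat_delete_carrier)
      fix k l assume kl: "k < n - 1" "l < n - 1"
      have "mat_delete (A y) j i $$ (k,l) = A y $$ (if k < j then k else Suc k, if l < i then l else Suc l)" for y
        using c[of y] kl unfolding mat_delete_def by auto
      then show "(\<lambda>y. mat_delete (A y) j i $$ (k,l)) \<in> polyfuns Cs"
        using kl by (auto intro!: polymat_entry[OF assms])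
    qed
    then show "(\<lambda>y. cofactor (A y) j i) \<in> polyfuns Cs"
      unfolding cofactor_def by (intro pf_mult pf_const polymat_det)
  qed
  ultimately show ?thesis by simp
qed

section \<open>Generalized inverses\<close>

text \<open>A linear map has a linear right inverse on its range, and \<open>G\<close> is the matrix
  of one. Then \<open>1 - G * M\<close> projects onto the kernel of \<open>M\<close>; this serves
  both for the projection onto the centralizer and for the semicontinuity of kernel
  dimensions.\<close>

lemma generalized_inverse:
  fixes M :: "complex mat"
  assumes M: "M \<in> carrier_mat N N"
  shows "\<exists>G\<in>carrier_mat N N. M * G * M = M"
proof -
  let ?s = "\<lambda>(c::complex) (f::nat \<Rightarrow> complex) i. c * f i"
  interpret vs: vector_space ?s
    by unfold_locales (auto simp: fun_eq_iff algebra_simps)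
  interpret vp: vector_space_pair ?s ?s ..
  \<comment> \<open>The map of \<open>M\<close> on all sequences: entries from \<open>N\<close> on
    are ignored in the argument and zero in the value.\<close>
  define F where "F f i = (if i < N then \<Sum>j<N. M $$ (i,j) * f j else 0)" for f i
  have "Vector_Spaces.linear ?s ?s F"
    unfolding F_def
    by unfold_locales (auto simp: fun_eq_iff algebra_simps sum.distrib sum_distrib_left)
  from vp.linear_exists_right_inverse_on[OF this vs.subspace_UNIV]
  obtain g where g: "Vector_Spaces.linear ?s ?s g" "\<And>f. F (g (F f)) = F f" by auto
  interpret g: Vector_Spaces.linear ?s ?s g by fact
  define u where "u j = (\<lambda>k. if k = j then 1 else 0 :: complex)" for j :: nat
  define G where "G = mat N N (\<lambda>(i,j). g (u j) i)"
  have G: "G \<in> carrier_mat N N" unfolding G_def by simp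
  have gv: "g v i = (\<Sum>j<N. v j * g (u j) i)" if "\<And>k. k \<ge> N \<Longrightarrow> v k = 0" for v i
  proof -
    have sumfun: "(\<Sum>j\<in>J. h j) k = (\<Sum>j\<in>J. h j k)" if "finite J" for J and h :: "nat \<Rightarrow> nat \<Rightarrow> complex" and k
      using that by (induction J rule: finite_induct) auto
    have "v = (\<Sum>j<N. ?s (v j) (u j))"
    proof
      fix k
      have "(\<Sum>j<N. v j * u j k) = (\<Sum>j<N. if j = k then v j else 0)"
        by (rule sum.cong) (auto simp: u_def)
      also have "\<dots> = v k" using that by auto
      finally show "v k = (\<Sum>j<N. ?s (v j) (u j)) k" by (simp add: sumfun)
    qed
    then have "g v = g (\<Sum>j<N. ?s (v j) (u j))" by (rule arg_cong)
    also have "\<dots> = (\<Sum>j<N. g (?s (v j) (u j)))" by (rule g.sum)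
    also have "\<dots> = (\<Sum>j<N. ?s (v j) (g (u j)))" by (simp only: g.scale)
    finally show ?thesis by (simp add: sumfun)
  qed
  have "M * G * M = M"
  proof (rule eq_matI)
    fix a b assume "a < dim_row M" "b < dim_col M"
    then have ab: "a < N" "b < N" using M by auto
    have Fu: "F (u b) i = (if i < N then M $$ (i,b) else 0)" for i
      using ab unfolding F_def u_def by (auto simp: if_distrib[of "\<lambda>x. _ * x"] cong: if_cong)
    have "(M * G * M) $$ (a,b) = (M * (G * M)) $$ (a,b)" using M G by simp
    also have "\<dots> = (\<Sum>i<N. M $$ (a,i) * (G * M) $$ (i,b))"
      using mult_mat_index[OF M mult_carrier_mat[OF G M] ab] .
    also have "\<dots> = (\<Sum>i<N. M $$ (a,i) * (\<Sum>j<N. G $$ (i,j) * M $$ (j,b)))"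
      by (intro sum.cong refl) (simp only: lessThan_iff mult_mat_index[OF G M _ ab(2)])
    also have "\<dots> = (\<Sum>i<N. M $$ (a,i) * g (F (u b)) i)"
      by (rule sum.cong) (auto simp: gv Fu G_def mult.commute intro!: arg_cong2[of _ _ _ _ "(*)"] sum.cong)
    also have "\<dots> = F (g (F (u b))) a" unfolding F_def using ab by simp
    also have "\<dots> = M $$ (a,b)" unfolding g Fu using ab by simp
    finally show "(M * G * M) $$ (a,b) = M $$ (a,b)" .
  qed (use M G in auto)
  then show ?thesis using G by blast
qed

section \<open>Matrices as columns\<close>

lemma mat_index_bound: "i < n \<Longrightarrow> j < n \<Longrightarrow> i * n + j < n * (n::nat)"
proof -
  assume "i < n" "j < n"
  then have "i * n + j < Suc i * n" by simp
  also have "\<dots> \<le> n * n" using \<open>i < n\<close> by (intro mult_le_mono1) auto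
  finally show ?thesis .
qed

lemma mat_index_div_mod: "p < n * n \<Longrightarrow> p div n < n \<and> p mod n < (n::nat)"
  by (cases "n = 0") (auto simp: less_mult_imp_div_less)

lemma sum_div_mod:
  fixes f :: "nat \<Rightarrow> nat \<Rightarrow> complex"
  shows "(\<Sum>q<n*n. f (q div n) (q mod n)) = (\<Sum>k<n. \<Sum>l<n. f k l)"
  unfolding sum.cartesian_product
  by (rule sum.reindex_bij_witness[where j = "\<lambda>q. (q div n, q mod n)" and i = "\<lambda>(k,l). k * n + l"])
    (auto simp: mat_index_bound mat_index_div_mod)

text \<open>Row-major vectorization, kept as a one-column matrix so that \<open>polymat\<close>
  applies to it.\<close>

definition colm :: "nat \<Rightarrow> complex mat \<Rightarrow> complex mat" where
  "colm n X = mat (n*n) 1 (\<lambda>(p,_). X $$ (p div n, p mod n))"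

definition uncolm :: "nat \<Rightarrow> complex mat \<Rightarrow> complex mat" where
  "uncolm n c = mat n n (\<lambda>(i,j). c $$ (i * n + j, 0))"

text \<open>The Kronecker product of \<open>A\<close> with the transpose of \<open>B\<close>, that
  is, the matrix of \<open>X \<mapsto> A * X * B\<close> on vectorized matrices.\<close>

definition sandm :: "nat \<Rightarrow> complex mat \<Rightarrow> complex mat \<Rightarrow> complex mat" where
  "sandm n A B = mat (n*n) (n*n) (\<lambda>(p,q). A $$ (p div n, q div n) * B $$ (q mod n, p mod n))"

lemma colm_carrier[simp]: "colm n X \<in> carrier_mat (n*n) 1"
  unfolding colm_def by simp

lemma colm_carrier_Suc[simp]: "colm n X \<in> carrier_mat (n*n) (Suc 0)"
  unfolding colm_def by simp

lemma uncolm_carrier[simp]: "uncolm n c \<in> carrier_mat n n"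
  unfolding uncolm_def by simp

lemma sandm_carrier[simp]: "sandm n A B \<in> carrier_mat (n*n) (n*n)"
  unfolding sandm_def by simp

lemma uncolm_colm: "X \<in> carrier_mat n n \<Longrightarrow> uncolm n (colm n X) = X"
  unfolding uncolm_def colm_def by (intro eq_matI) (auto simp: mat_index_bound)

lemma colm_uncolm: "c \<in> carrier_mat (n*n) 1 \<Longrightarrow> colm n (uncolm n c) = c"
  unfolding uncolm_def colm_def by (intro eq_matI) (auto simp: mat_index_div_mod)

lemma colm_add: "X \<in> carrier_mat n n \<Longrightarrow> Y \<in> carrier_mat n n \<Longrightarrow> colm n (X + Y) = colm n X + colm n Y"
  unfolding colm_def by (intro eq_matI) (auto simp: mat_index_div_mod)

lemma colm_minus: "X \<in> carrier_mat n n \<Longrightarrow> Y \<in> carrier_mat n n \<Longrightarrow> colm n (X - Y) = colm n X - colm n Y"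
  unfolding colm_def by (intro eq_matI) (auto simp: mat_index_div_mod)

lemma colm_smult: "X \<in> carrier_mat n n \<Longrightarrow> colm n (a \<cdot>\<^sub>m X) = a \<cdot>\<^sub>m colm n X"
  unfolding colm_def by (intro eq_matI) (auto simp: mat_index_div_mod)

lemma uncolm_smult: "c \<in> carrier_mat (n*n) 1 \<Longrightarrow> uncolm n (a \<cdot>\<^sub>m c) = a \<cdot>\<^sub>m uncolm n c"
  unfolding uncolm_def by (intro eq_matI) (auto simp: mat_index_bound)

lemma sandm_colm:
  assumes "A \<in> carrier_mat n n" "B \<in> carrier_mat n n" "X \<in> carrier_mat n n"
  shows "sandm n A B * colm n X = colm n (A * X * B)"
proof (rule eq_matI)
  fix p j assume "p < dim_row (colm n (A * X * B))" "j < dim_col (colm n (A * X * B))"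
  then have p: "p < n * n" "j = 0" unfolding colm_def by auto
  note pd = mat_index_div_mod[OF p(1)]
  have "(sandm n A B * colm n X) $$ (p,j) = (\<Sum>q<n*n. sandm n A B $$ (p,q) * colm n X $$ (q,0))"
    using mult_mat_index[OF sandm_carrier colm_carrier] p by simp
  also have "\<dots> = (\<Sum>q<n*n. A $$ (p div n, q div n) * B $$ (q mod n, p mod n) * X $$ (q div n, q mod n))"
    using p by (intro sum.cong) (auto simp: sandm_def colm_def)
  also have "\<dots> = (\<Sum>k<n. \<Sum>l<n. A $$ (p div n, k) * B $$ (l, p mod n) * X $$ (k, l))"
    by (rule sum_div_mod)
  also have "\<dots> = (\<Sum>k<n. A $$ (p div n, k) * (X * B) $$ (k, p mod n))"
    using pd by (intro sum.cong refl) (simp add: mult_mat_index[OF assms(3,2)] sum_distrib_left algebra_simps del: index_mult_mat)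
  also have "\<dots> = (A * (X * B)) $$ (p div n, p mod n)"
    using pd assms by (subst mult_mat_index[of A n n "X * B" n]) auto
  also have "A * (X * B) = A * X * B" using assms by simp
  finally show "(sandm n A B * colm n X) $$ (p,j) = colm n (A * X * B) $$ (p,j)"
    using p unfolding colm_def by simp
qed (auto simp: sandm_def colm_def)

lemma polymat_colm:
  assumes "polymat Cs n n M" shows "polymat Cs (n*n) 1 (\<lambda>y. colm n (M y))"
  unfolding colm_def by (rule polymat_mat) (auto intro: polymat_entry[OF assms] simp: mat_index_div_mod)

lemma polymat_uncolm:
  assumes "polymat Cs (n*n) 1 c" shows "polymat Cs n n (\<lambda>y. uncolm n (c y))"
  unfolding uncolm_def by (rule polymat_mat) (auto intro: polymat_entry[OF assms] simp: mat_index_bound)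

lemma polymat_sandm:
  assumes "polymat Cs n n A" "polymat Cs n n B" shows "polymat Cs (n*n) (n*n) (\<lambda>y. sandm n (A y) (B y))"
  unfolding sandm_def
  by (rule polymat_mat) (auto intro!: pf_mult intro: polymat_entry[OF assms(1)] polymat_entry[OF assms(2)] simp: mat_index_div_mod)

section \<open>Parametrizing pairs with a prescribed nilpotent part\<close>

text \<open>\<open>conjm P B\<close> is \<open>P B P\<^sup>-\<^sup>1\<close> if \<open>det P \<noteq> 0\<close>, and \<open>0\<close> otherwise.\<close>

definition conjm :: "complex mat \<Rightarrow> complex mat \<Rightarrow> complex mat" where
  "conjm P B = (1 / det P) \<cdot>\<^sub>m (P * B * adj_mat P)"

lemma smult_smult_mat: "a \<cdot>\<^sub>m (b \<cdot>\<^sub>m M) = (a * b :: complex) \<cdot>\<^sub>m M"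
  by (intro eq_matI) auto

lemma one_smult_mat: "(1 :: complex) \<cdot>\<^sub>m M = M"
  by (intro eq_matI) auto

lemma adj_mat_inverse:
  fixes P Q :: "complex mat"
  assumes P: "P \<in> carrier_mat n n" and Q: "Q \<in> carrier_mat n n" and PQ: "P * Q = 1\<^sub>m n"
  shows "adj_mat P = det P \<cdot>\<^sub>m Q" "det P \<noteq> 0" "Q * P = 1\<^sub>m n"
proof -
  show QP: "Q * P = 1\<^sub>m n" using mat_mult_left_right_inverse[OF P Q PQ] .
  have "adj_mat P = (adj_mat P * P) * Q" using adj_mat(1)[OF P] P Q PQ by simp
  also have "\<dots> = det P \<cdot>\<^sub>m Q" unfolding adj_mat(3)[OF P] using mult_smult_assoc_mat[OF one_carrier_mat Q] Q by simp
  finally show "adj_mat P = det P \<cdot>\<^sub>m Q" .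
  have "det P * det Q = 1" using det_mult[OF P Q] PQ by simp
  then show "det P \<noteq> 0" by auto
qed

lemma conjm_inverse:
  assumes P: "P \<in> carrier_mat n n" and Q: "Q \<in> carrier_mat n n" and PQ: "P * Q = 1\<^sub>m n"
    and B: "B \<in> carrier_mat n n"
  shows "conjm P B = P * B * Q"
proof -
  have "P * B * (det P \<cdot>\<^sub>m Q) = det P \<cdot>\<^sub>m (P * B * Q)"
    using P Q B by (intro mult_smult_distrib) auto
  then show ?thesis unfolding conjm_def adj_mat_inverse(1)[OF P Q PQ]
    using adj_mat_inverse(2)[OF P Q PQ] by (simp add: smult_smult_mat one_smult_mat)
qed

lemma det_nonzero_inverse:
  assumes P: "P \<in> carrier_mat n n" and "det P \<noteq> (0::complex)"
  obtains Q where "Q \<in> carrier_mat n n" "P * Q = 1\<^sub>m n" "Q * P = 1\<^sub>m n"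
proof -
  define Q where "Q = (1 / det P) \<cdot>\<^sub>m adj_mat P"
  have Q: "Q \<in> carrier_mat n n" unfolding Q_def using adj_mat(1)[OF P] by simp
  have "P * Q = (1 / det P) \<cdot>\<^sub>m (P * adj_mat P)"
    unfolding Q_def using adj_mat(1)[OF P] P by (intro mult_smult_distrib) auto
  then have "P * Q = 1\<^sub>m n" using adj_mat(2)[OF P] assms(2) by (simp add: smult_smult_mat one_smult_mat)
  then show ?thesis using that Q adj_mat_inverse(3)[OF P Q] by blast
qed

lemma pair_coords_cases:
  assumes "f \<in> pair_coords n"
  obtains i j where "i < n" "j < n" "\<And>A B. f (A, B) = A $$ (i,j)"
  | i j where "i < n" "j < n" "\<And>A B. f (A, B) = B $$ (i,j)"
  using assms unfolding pair_coords_def by auto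

text \<open>Multiplying by \<open>det P\<close> turns the conjugate into
  \<open>P * B * adj_mat P\<close>, which has polynomial entries.\<close>

lemma conjm_rational:
  assumes P: "polymat Ds n n P" and B: "polymat Ds n n B" and B': "polymat Ds n n B'"
    and f: "f \<in> pair_coords n"
  shows "\<exists>g\<in>polyfuns Ds. \<forall>y. det (P y) \<noteq> 0 \<longrightarrow>
    det (P y) * f (conjm (P y) (B y), conjm (P y) (B' y)) = g y"
proof -
  have main: "\<exists>g\<in>polyfuns Ds. \<forall>y. det (P y) \<noteq> 0 \<longrightarrow> det (P y) * conjm (P y) (B y) $$ (i,j) = g y"
    if B: "polymat Ds n n B" and ij: "i < n" "j < n" for B i j
  proof (rule bexI)
    have pm: "polymat Ds n n (\<lambda>y. P y * B y * adj_mat (P y))"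
      by (intro polymat_mult[where l = n] polymat_adj P B)
    then show "(\<lambda>y. (P y * B y * adj_mat (P y)) $$ (i,j)) \<in> polyfuns Ds"
      using ij by (rule polymat_entry)
    show "\<forall>y. det (P y) \<noteq> 0 \<longrightarrow> det (P y) * conjm (P y) (B y) $$ (i,j) = (P y * B y * adj_mat (P y)) $$ (i,j)"
    proof (intro allI impI)
      fix y assume "det (P y) \<noteq> 0"
      have "conjm (P y) (B y) $$ (i,j) = (1 / det (P y)) * (P y * B y * adj_mat (P y)) $$ (i,j)"
        unfolding conjm_def using polymat_carrier[OF pm, of y] ij by (intro index_smult_mat(1)) auto
      then show "det (P y) * conjm (P y) (B y) $$ (i,j) = (P y * B y * adj_mat (P y)) $$ (i,j)"
        using \<open>det (P y) \<noteq> 0\<close> by simp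
    qed
  qed
  show ?thesis using f
  proof (cases rule: pair_coords_cases)
    case (1 i j)
    then show ?thesis using main[OF B 1(1,2)] by simp
  next
    case (2 i j)
    then show ?thesis using main[OF B' 2(1,2)] by simp
  qed
qed

locale signed_nilpotent =
  fixes n :: nat and J S :: "complex mat"
  assumes J: "J \<in> carrier_mat n n" and S: "S \<in> carrier_mat n n"
    and SS: "S * S = 1\<^sub>m n" and SJ: "S * J = - (J * S)"
begin

text \<open>The matrix of \<open>X \<mapsto> A * X - X * J\<close>. For \<open>A = J\<close> this is
  the commutator with \<open>J\<close>; for a conjugate \<open>A\<close> of \<open>J\<close> its
  kernel contains the conjugating matrices, and for this reason the left factor is a
  parameter.\<close>

definition adm :: "complex mat \<Rightarrow> complex mat" where
  "adm A = sandm n A (1\<^sub>m n) - sandm n (1\<^sub>m n) J"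

lemma adm_carrier: "adm A \<in> carrier_mat (n*n) (n*n)"
  unfolding adm_def by (rule minus_carrier_mat) simp

lemma adm_colm:
  assumes "A \<in> carrier_mat n n" "X \<in> carrier_mat n n"
  shows "adm A * colm n X = colm n (A * X - X * J)"
proof -
  have "adm A * colm n X = sandm n A (1\<^sub>m n) * colm n X - sandm n (1\<^sub>m n) J * colm n X"
    unfolding adm_def by (rule minus_mult_distrib_mat[OF sandm_carrier sandm_carrier colm_carrier])
  also have "\<dots> = colm n (A * X * 1\<^sub>m n) - colm n (1\<^sub>m n * X * J)"
    using assms J by (simp add: sandm_colm)
  also have "\<dots> = colm n (A * X - X * J)"
    using assms J by (simp add: colm_minus right_mult_one_mat[of _ n n])
  finally show ?thesis .
qed

definition gin :: "complex mat" where
  "gin = (SOME G. G \<in> carrier_mat (n*n) (n*n) \<and> adm J * G * adm J = adm J)"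

lemma gin: "gin \<in> carrier_mat (n*n) (n*n)" "adm J * gin * adm J = adm J"
  using someI_ex[of "\<lambda>G. G \<in> carrier_mat (n*n) (n*n) \<and> adm J * G * adm J = adm J"]
    generalized_inverse[OF adm_carrier[of J]] unfolding gin_def by blast+

text \<open>\<open>prj\<close> is the projection \<open>\<pi>\<close> onto the centralizer of \<open>J\<close>, the kernel of \<open>adm J\<close>; \<open>pim\<close> is its matrix.\<close>

definition pim :: "complex mat" where
  "pim = 1\<^sub>m (n*n) - gin * adm J"

definition prj :: "complex mat \<Rightarrow> complex mat" where
  "prj X = uncolm n (pim * colm n X)"

lemma pim_carrier: "pim \<in> carrier_mat (n*n) (n*n)"
  unfolding pim_def by (rule minus_carrier_mat) (use gin adm_carrier in auto)

lemma prj_carrier[simp]: "prj X \<in> carrier_mat n n"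
  unfolding prj_def by simp

lemma pim_colm: "pim * colm n X = colm n (prj X)"
  unfolding prj_def by (rule colm_uncolm[symmetric], rule mult_carrier_mat[OF pim_carrier]) simp

text \<open>The identity \<open>adm J * gin * adm J = adm J\<close> says that the image of
  \<open>pim\<close> lies in the kernel of \<open>adm J\<close>; on that kernel \<open>pim\<close>
  is the identity (\<open>prj_id\<close>).\<close>

lemma adm_pim: "adm J * pim = 0\<^sub>m (n*n) (n*n)"
proof -
  have "adm J * pim = adm J * 1\<^sub>m (n*n) - adm J * (gin * adm J)"
    unfolding pim_def by (rule mult_minus_distrib_mat[OF adm_carrier one_carrier_mat mult_carrier_mat[OF gin(1) adm_carrier]])
  also have "adm J * (gin * adm J) = adm J"
    using gin adm_carrier[of J] by (metis assoc_mult_mat)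
  finally show ?thesis using adm_carrier[of J] by simp
qed

lemma prj_commute: "J * prj X = prj X * J"
proof -
  have "colm n (J * prj X - prj X * J) = adm J * (pim * colm n X)"
    using J by (simp add: adm_colm pim_colm)
  also have "\<dots> = adm J * pim * colm n X"
    using assoc_mult_mat[OF adm_carrier pim_carrier colm_carrier] by simp
  also have "\<dots> = colm n (0\<^sub>m n n)"
    unfolding adm_pim colm_def by (intro eq_matI) (auto simp: mat_index_div_mod)
  finally have "J * prj X - prj X * J = 0\<^sub>m n n"
    using J by (metis minus_carrier_mat mult_carrier_mat prj_carrier uncolm_colm zero_carrier_mat)
  then have e: "(J * prj X - prj X * J) $$ (i,j) = 0" if "i < n" "j < n" for i j
    using that by simp
  have c: "J * prj X \<in> carrier_mat n n" "prj X * J \<in> carrier_mat n n"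
    using mult_carrier_mat[OF J prj_carrier] mult_carrier_mat[OF prj_carrier J] by auto
  show ?thesis
  proof (rule eq_matI)
    fix i j assume "i < dim_row (prj X * J)" "j < dim_col (prj X * J)"
    then have ij: "i < n" "j < n" using c by auto
    have "(J * prj X - prj X * J) $$ (i,j) = (J * prj X) $$ (i,j) - (prj X * J) $$ (i,j)"
      using c ij by (intro index_minus_mat(1)) auto
    then show "(J * prj X) $$ (i,j) = (prj X * J) $$ (i,j)" using e[OF ij] by simp
  qed (simp_all only: carrier_matD[OF c(1)] carrier_matD[OF c(2)])
qed

lemma prj_id:
  assumes X: "X \<in> carrier_mat n n" and "J * X = X * J"
  shows "prj X = X"
proof -
  have "X * J - X * J = 0\<^sub>m n n" using X J by (auto intro!: eq_matI)
  then have "adm J * colm n X = colm n (0\<^sub>m n n)" using adm_colm[OF J X] assms(2) by simp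
  also have "\<dots> = 0\<^sub>m (n*n) 1" unfolding colm_def by (intro eq_matI) (auto simp: mat_index_div_mod)
  finally have 0: "adm J * colm n X = 0\<^sub>m (n*n) 1" .
  have "pim * colm n X = 1\<^sub>m (n*n) * colm n X - gin * adm J * colm n X"
    unfolding pim_def by (rule minus_mult_distrib_mat[OF one_carrier_mat mult_carrier_mat[OF gin(1) adm_carrier] colm_carrier])
  also have "gin * adm J * colm n X = 0\<^sub>m (n*n) 1"
    using assoc_mult_mat[OF gin(1) adm_carrier colm_carrier] 0 gin(1) by simp
  also have "1\<^sub>m (n*n) * colm n X - 0\<^sub>m (n*n) 1 = colm n X"
    unfolding left_mult_one_mat[OF colm_carrier] by (intro eq_matI) (auto simp: colm_def)
  finally show ?thesis unfolding prj_def using uncolm_colm[OF X] by simp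
qed

lemma prj_prj: "prj (prj X) = prj X"
  by (rule prj_id) (auto simp: prj_commute)

lemma prj_one: "prj (1\<^sub>m n) = 1\<^sub>m n"
  by (rule prj_id) (use J in auto)

lemma prj_add:
  assumes "X \<in> carrier_mat n n" "Y \<in> carrier_mat n n"
  shows "prj (X + Y) = prj X + prj Y"
proof -
  have "colm n (prj (X + Y)) = pim * (colm n X + colm n Y)"
    using assms by (simp add: pim_colm[symmetric] colm_add)
  also have "\<dots> = pim * colm n X + pim * colm n Y"
    by (rule mult_add_distrib_mat[OF pim_carrier colm_carrier colm_carrier])
  also have "\<dots> = colm n (prj X + prj Y)" by (simp add: pim_colm colm_add)
  finally show ?thesis by (metis add_carrier_mat prj_carrier uncolm_colm)
qed

lemma prj_minus:
  assumes "X \<in> carrier_mat n n" "Y \<in> carrier_mat n n"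
  shows "prj (X - Y) = prj X - prj Y"
proof -
  have "colm n (prj (X - Y)) = pim * (colm n X - colm n Y)"
    using assms by (simp add: pim_colm[symmetric] colm_minus)
  also have "\<dots> = pim * colm n X - pim * colm n Y"
    by (rule mult_minus_distrib_mat[OF pim_carrier colm_carrier colm_carrier])
  also have "\<dots> = colm n (prj X - prj Y)" by (simp add: pim_colm colm_minus)
  finally show ?thesis by (metis minus_carrier_mat prj_carrier uncolm_colm)
qed

definition Xm :: "(nat \<Rightarrow> complex) \<Rightarrow> complex mat" where
  "Xm x = mat n n (\<lambda>(i,j). x (i * n + j))"

definition Rm :: "(nat \<Rightarrow> complex) \<Rightarrow> complex mat" where
  "Rm x = 1\<^sub>m n + (Xm x - prj (Xm x))"

definition Bm :: "(nat \<Rightarrow> complex) \<Rightarrow> complex mat" where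
  "Bm x = S * prj (Xm x)"

definition param :: "(nat \<Rightarrow> complex) \<Rightarrow> complex mat \<times> complex mat" where
  "param x = (conjm (Rm x) J, conjm (Rm x) (Bm x))"

text \<open>For \<open>J = Jnil lam\<close> this is \<open>orbits_J n lam\<close>
  (\<open>orbits_J_orb\<close>), with membership in \<open>NN n\<close> reduced to a linear
  condition on \<open>B\<close>.\<close>

definition orb :: "(complex mat \<times> complex mat) set" where
  "orb = {(P * J * Q, P * B * Q) | P Q B. P \<in> carrier_mat n n \<and> Q \<in> carrier_mat n n \<and> P * Q = 1\<^sub>m n
     \<and> B \<in> carrier_mat n n \<and> J * B + B * J = 0\<^sub>m n n}"

lemma carriers[simp]: "Xm x \<in> carrier_mat n n" "Rm x \<in> carrier_mat n n" "Bm x \<in> carrier_mat n n"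
proof -
  show X: "Xm x \<in> carrier_mat n n" unfolding Xm_def by simp
  show "Rm x \<in> carrier_mat n n" unfolding Rm_def by (simp add: minus_carrier_mat)
  show "Bm x \<in> carrier_mat n n" unfolding Bm_def using S prj_carrier by (rule mult_carrier_mat)
qed

lemma polymat_Xm: "polymat (ncoords (n*n)) n n Xm"
  unfolding Xm_def by (rule polymat_mat) (auto intro!: pf_coord simp: ncoords_def mat_index_bound)

lemma polymat_prj: "polymat Cs n n M \<Longrightarrow> polymat Cs n n (\<lambda>y. prj (M y))"
  unfolding prj_def by (intro polymat_uncolm polymat_mult[OF polymat_const[OF pim_carrier]] polymat_colm)

lemma polymat_Rm: "polymat (ncoords (n*n)) n n Rm"
  unfolding Rm_def by (intro polymat_add polymat_minus polymat_prj polymat_Xm polymat_const) simp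

lemma polymat_Bm: "polymat (ncoords (n*n)) n n Bm"
  unfolding Bm_def by (intro polymat_mult[OF polymat_const[OF S]] polymat_prj polymat_Xm)

lemma param_rational:
  "f \<in> pair_coords n \<Longrightarrow> \<exists>g\<in>polyfuns (ncoords (n*n)). \<forall>x. det (Rm x) \<noteq> 0 \<longrightarrow> det (Rm x) * f (param x) = g x"
  unfolding param_def by (rule conjm_rational[OF polymat_Rm polymat_const[OF J] polymat_Bm])

lemma S_S: "B \<in> carrier_mat n n \<Longrightarrow> S * (S * B) = B"
  using assoc_mult_mat[OF S S, of B n] SS by simp

text \<open>Because \<open>S\<close> anticommutes with \<open>J\<close>, the commutator of
  \<open>J\<close> with \<open>S * B\<close> equals \<open>- (S * (J * B + B * J))\<close>, and
  \<open>S\<close> is its own inverse.\<close>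

lemma anticommute_iff:
  assumes B: "B \<in> carrier_mat n n"
  shows "J * (S * B) = (S * B) * J \<longleftrightarrow> J * B + B * J = 0\<^sub>m n n"
proof -
  have c: "J * B \<in> carrier_mat n n" "B * J \<in> carrier_mat n n" "S * B \<in> carrier_mat n n"
    "J * S \<in> carrier_mat n n" "S * J \<in> carrier_mat n n"
    using J B S by auto
  have JS: "J * S = - (S * J)" unfolding SJ using c by (intro eq_matI) auto
  have "J * (S * B) = J * S * B" by (rule assoc_mult_mat[OF J S B, symmetric])
  also have "\<dots> = - (S * J * B)" unfolding JS by (rule uminus_mult_left_mat) (simp only: carrier_matD[OF c(5)] carrier_matD[OF B])
  also have "S * J * B = S * (J * B)" by (rule assoc_mult_mat[OF S J B])
  finally have 1: "J * (S * B) = - (S * (J * B))" .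
  have 2: "(S * B) * J = S * (B * J)" by (rule assoc_mult_mat[OF S B J])
  have 3: "S * (J * B + B * J) = S * (J * B) + S * (B * J)"
    by (rule mult_add_distrib_mat[OF S c(1,2)])
  have c': "S * (J * B) \<in> carrier_mat n n" "S * (B * J) \<in> carrier_mat n n" using c S by auto
  show ?thesis
  proof
    assume "J * (S * B) = (S * B) * J"
    then have "- (S * (J * B)) = S * (B * J)" unfolding 1 2 .
    then have "S * (J * B + B * J) = S * (J * B) + - (S * (J * B))" unfolding 3 by (rule arg_cong[OF sym])
    also have "\<dots> = 0\<^sub>m n n" by (metis c'(1) comm_add_mat uminus_carrier_mat uminus_l_inv_mat)
    finally have "S * (S * (J * B + B * J)) = 0\<^sub>m n n" using right_mult_zero_mat[OF S] by metis
    moreover have "S * (S * (J * B + B * J)) = J * B + B * J"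
      by (rule S_S[OF add_carrier_mat[OF c(2)]])
    ultimately show "J * B + B * J = 0\<^sub>m n n" by metis
  next
    assume "J * B + B * J = 0\<^sub>m n n"
    then have 0: "S * (J * B) + S * (B * J) = 0\<^sub>m n n" using 3 right_mult_zero_mat[OF S] by metis
    have "- (S * (J * B)) = S * (B * J)"
    proof (rule eq_matI)
      fix i j assume "i < dim_row (S * (B * J))" "j < dim_col (S * (B * J))"
      then have ij: "i < n" "j < n" using c' by auto
      have "(S * (J * B) + S * (B * J)) $$ (i,j) = (S * (J * B)) $$ (i,j) + (S * (B * J)) $$ (i,j)"
        using c' ij by (intro index_add_mat(1)) auto
      moreover have "(- (S * (J * B))) $$ (i,j) = - ((S * (J * B)) $$ (i,j))"
        using c' ij by (intro index_uminus_mat(1)) auto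
      moreover have "(S * (J * B) + S * (B * J)) $$ (i,j) = 0" unfolding 0 using ij by simp
      ultimately show "(- (S * (J * B))) $$ (i,j) = (S * (B * J)) $$ (i,j)"
        by (metis minus_unique)
    qed (simp_all only: carrier_matD[OF c'(1)] carrier_matD[OF c'(2)] index_uminus_mat)
    then show "J * (S * B) = (S * B) * J" unfolding 1 2 .
  qed
qed

lemma Bm_anticommute: "J * Bm x + Bm x * J = 0\<^sub>m n n"
  using anticommute_iff[OF carriers(3), of x] prj_commute[of "Xm x"]
  unfolding Bm_def S_S[OF prj_carrier] by blast

lemma param_orb: "det (Rm x) \<noteq> 0 \<Longrightarrow> param x \<in> orb"
proof -
  assume "det (Rm x) \<noteq> 0"
  then obtain Q where Q: "Q \<in> carrier_mat n n" "Rm x * Q = 1\<^sub>m n"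
    using det_nonzero_inverse[of "Rm x" n] by auto
  then have "param x = (Rm x * J * Q, Rm x * Bm x * Q)"
    unfolding param_def using conjm_inverse[of "Rm x" n Q] J by simp
  then show ?thesis unfolding orb_def
    by (intro CollectI exI[of _ "Rm x"] exI[of _ Q] exI[of _ "Bm x"] conjI Bm_anticommute Q carriers)
qed

lemma orb_subset: "orb \<subseteq> pairs_space n"
  unfolding orb_def pairs_space_def using J by auto

lemma Xm_0: "Xm (\<lambda>_. 0) = 0\<^sub>m n n"
  unfolding Xm_def by auto

lemma prj_0: "prj (0\<^sub>m n n) = 0\<^sub>m n n"
  by (rule prj_id) (use J in auto)

lemma Rm_0: "Rm (\<lambda>_. 0) = 1\<^sub>m n"
  unfolding Rm_def Xm_0 prj_0 by auto

lemma Bm_0: "Bm (\<lambda>_. 0) = 0\<^sub>m n n"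
  unfolding Bm_def Xm_0 prj_0 using S by simp

lemma param_0: "param (\<lambda>_. 0) = (J, 0\<^sub>m n n)"
  unfolding param_def Rm_0 Bm_0 using J conjm_inverse[of "1\<^sub>m n" n "1\<^sub>m n"] by simp

end

section \<open>Moving a generic conjugating matrix into the slice\<close>

context signed_nilpotent
begin

text \<open>On the centralizer it is left multiplication by \<open>P\<close> followed by
  \<open>prj\<close>; the second summand is the identity on the kernel of \<open>prj\<close>. This
  makes the system square and, for the right-hand side 1, forces the solution into the
  centralizer.\<close>

definition Km :: "complex mat \<Rightarrow> complex mat" where
  "Km P = pim * sandm n P (1\<^sub>m n) * pim + (1\<^sub>m (n*n) - pim)"

text \<open>Cramer numerator of the solution \<open>Z\<close> of
  \<open>Km P * colm n Z = colm n (1\<^sub>m n)\<close>; the denominator is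
  \<open>det (Km P)\<close>.\<close>

definition Zm :: "complex mat \<Rightarrow> complex mat" where
  "Zm P = uncolm n (adj_mat (Km P) * colm n (1\<^sub>m n))"

lemma pim_compl_carrier: "1\<^sub>m (n*n) - pim \<in> carrier_mat (n*n) (n*n)"
  by (rule minus_carrier_mat[OF pim_carrier])

lemma Km_carrier: "Km P \<in> carrier_mat (n*n) (n*n)"
  unfolding Km_def by (rule add_carrier_mat[OF pim_compl_carrier])

lemma Zm_carrier: "Zm P \<in> carrier_mat n n"
  unfolding Zm_def by simp

lemma Km_colm:
  assumes P: "P \<in> carrier_mat n n" and Z: "Z \<in> carrier_mat n n"
  shows "Km P * colm n Z = colm n (prj (P * prj Z) + (Z - prj Z))"
proof -
  note sp = mult_carrier_mat[OF pim_carrier sandm_carrier[of n P "1\<^sub>m n"]]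
  have "pim * sandm n P (1\<^sub>m n) * pim * colm n Z = pim * sandm n P (1\<^sub>m n) * colm n (prj Z)"
    using assoc_mult_mat[OF sp pim_carrier colm_carrier] by (simp add: pim_colm)
  also have "\<dots> = pim * (sandm n P (1\<^sub>m n) * colm n (prj Z))"
    by (rule assoc_mult_mat[OF pim_carrier sandm_carrier colm_carrier])
  also have "sandm n P (1\<^sub>m n) * colm n (prj Z) = colm n (P * prj Z)"
    unfolding sandm_colm[OF P one_carrier_mat prj_carrier]
    by (simp only: right_mult_one_mat[OF mult_carrier_mat[OF P prj_carrier]])
  finally have 1: "pim * sandm n P (1\<^sub>m n) * pim * colm n Z = colm n (prj (P * prj Z))"
    by (simp only: pim_colm)
  have "(1\<^sub>m (n*n) - pim) * colm n Z = 1\<^sub>m (n*n) * colm n Z - pim * colm n Z"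
    by (rule minus_mult_distrib_mat[OF one_carrier_mat pim_carrier colm_carrier])
  also have "\<dots> = colm n (Z - prj Z)"
    unfolding pim_colm left_mult_one_mat[OF colm_carrier] colm_minus[OF Z prj_carrier] ..
  finally have 2: "(1\<^sub>m (n*n) - pim) * colm n Z = colm n (Z - prj Z)" .
  have "Km P * colm n Z = pim * sandm n P (1\<^sub>m n) * pim * colm n Z + (1\<^sub>m (n*n) - pim) * colm n Z"
    unfolding Km_def
    by (rule add_mult_distrib_mat[OF mult_carrier_mat[OF sp pim_carrier] pim_compl_carrier colm_carrier])
  then show ?thesis unfolding 1 2
    by (simp only: colm_add[OF prj_carrier minus_carrier_mat[OF prj_carrier]])
qed

text \<open>Makes \<open>P = 1\<close> a point where the open conditions of
  \<open>generic_in_param\<close> hold; lines are drawn through this point.\<close>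

lemma Km_one: "Km (1\<^sub>m n) = 1\<^sub>m (n*n)"
proof -
  have eq: "Km (1\<^sub>m n) * c = c" if c: "c \<in> carrier_mat (n*n) 1" for c
  proof -
    define Z where "Z = uncolm n c"
    have Z: "Z \<in> carrier_mat n n" "c = colm n Z" unfolding Z_def using colm_uncolm[OF c] by simp_all
    have "prj (1\<^sub>m n * prj Z) + (Z - prj Z) = Z"
      unfolding left_mult_one_mat[OF prj_carrier] prj_prj
      using Z(1) carrier_matD[OF prj_carrier[of Z]] by (intro eq_matI) auto
    then show ?thesis unfolding Z(2) Km_colm[OF one_carrier_mat Z(1)] by simp
  qed
  show ?thesis
  proof (rule eq_matI)
    fix i j assume "i < dim_row (1\<^sub>m (n*n))" "j < dim_col (1\<^sub>m (n*n))"
    then have ij: "i < n*n" "j < n*n" by auto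
    define c where "c = mat (n*n) 1 (\<lambda>(k,_). if k = j then 1 else 0 :: complex)"
    have c: "c \<in> carrier_mat (n*n) 1" unfolding c_def by simp
    have "(Km (1\<^sub>m n) * c) $$ (i,0) = (\<Sum>k<n*n. Km (1\<^sub>m n) $$ (i,k) * c $$ (k,0))"
      by (rule mult_mat_index[OF Km_carrier c ij(1)]) simp
    also have "\<dots> = (\<Sum>k<n*n. if k = j then Km (1\<^sub>m n) $$ (i,k) else 0)"
      by (rule sum.cong) (auto simp: c_def)
    also have "\<dots> = Km (1\<^sub>m n) $$ (i,j)" using ij by simp
    finally have "Km (1\<^sub>m n) $$ (i,j) = c $$ (i,0)" unfolding eq[OF c] ..
    then show "Km (1\<^sub>m n) $$ (i,j) = 1\<^sub>m (n*n) $$ (i,j)" unfolding c_def using ij by simp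
  qed (use Km_carrier[of "1\<^sub>m n"] in auto)
qed

lemma adj_mat_one: "adj_mat (1\<^sub>m k :: complex mat) = 1\<^sub>m k"
  using adj_mat_inverse(1)[of "1\<^sub>m k" k "1\<^sub>m k"] by (simp add: one_smult_mat)

lemma Zm_one: "Zm (1\<^sub>m n) = 1\<^sub>m n"
  unfolding Zm_def Km_one adj_mat_one by (simp add: left_mult_one_mat[OF colm_carrier] uncolm_colm)

text \<open>\<open>Z\<close> solves \<open>prj (P * prj Z) + (Z - prj Z) = 1\<close>. Applying
  \<open>prj\<close> kills the second summand and gives \<open>prj (P * prj Z) = 1\<close>;
  subtracting this leaves \<open>Z = prj Z\<close>.\<close>

lemma Zm_props:
  assumes P: "P \<in> carrier_mat n n" and K: "det (Km P) \<noteq> 0"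
  defines "Z \<equiv> (1 / det (Km P)) \<cdot>\<^sub>m Zm P"
  shows "J * Z = Z * J" "prj (P * Z) = 1\<^sub>m n"
proof -
  have Z: "Z \<in> carrier_mat n n" unfolding Z_def using Zm_carrier by simp
  have one: "colm n (1\<^sub>m n) \<in> carrier_mat (n*n) 1" by simp
  note adj = adj_mat[OF Km_carrier[of P]]
  have cZ: "colm n Z = (1 / det (Km P)) \<cdot>\<^sub>m (adj_mat (Km P) * colm n (1\<^sub>m n))"
    unfolding Z_def colm_smult[OF Zm_carrier] unfolding Zm_def
    by (simp only: colm_uncolm[OF mult_carrier_mat[OF adj(1) one]])
  have "Km P * colm n Z = (1 / det (Km P)) \<cdot>\<^sub>m (Km P * (adj_mat (Km P) * colm n (1\<^sub>m n)))"
    unfolding cZ by (rule mult_smult_distrib[OF Km_carrier mult_carrier_mat[OF adj(1) one]])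
  also have "Km P * (adj_mat (Km P) * colm n (1\<^sub>m n)) = Km P * adj_mat (Km P) * colm n (1\<^sub>m n)"
    by (rule assoc_mult_mat[OF Km_carrier adj(1) one, symmetric])
  also have "\<dots> = det (Km P) \<cdot>\<^sub>m (1\<^sub>m (n*n) * colm n (1\<^sub>m n))"
    unfolding adj(2) by (rule mult_smult_assoc_mat[OF one_carrier_mat one])
  also have "(1 / det (Km P)) \<cdot>\<^sub>m \<dots> = colm n (1\<^sub>m n)"
    unfolding left_mult_one_mat[OF one] using K by (simp add: smult_smult_mat one_smult_mat)
  finally have "colm n (prj (P * prj Z) + (Z - prj Z)) = colm n (1\<^sub>m n)"
    unfolding Km_colm[OF P Z] .
  then have main: "prj (P * prj Z) + (Z - prj Z) = 1\<^sub>m n"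
    by (metis Z add_carrier_mat minus_carrier_mat one_carrier_mat prj_carrier uncolm_colm)
  have Zp: "Z - prj Z \<in> carrier_mat n n" by (rule minus_carrier_mat[OF prj_carrier])
  have "prj (prj (P * prj Z) + (Z - prj Z)) = prj (P * prj Z) + (prj Z - prj Z)"
    using prj_add[OF prj_carrier Zp] prj_minus[OF Z prj_carrier] prj_prj by simp
  also have "\<dots> = prj (P * prj Z)"
    using carrier_matD[OF prj_carrier[of "P * prj Z"]] carrier_matD[OF prj_carrier[of Z]] by (intro eq_matI) auto
  finally have 1: "prj (P * prj Z) = 1\<^sub>m n" unfolding main prj_one ..
  have "prj Z = Z"
  proof (rule eq_matI)
    fix i j assume "i < dim_row Z" "j < dim_col Z"
    then have ij: "i < n" "j < n" using Z by auto
    have "(1\<^sub>m n + (Z - prj Z)) $$ (i,j) = 1\<^sub>m n $$ (i,j)" using main unfolding 1 by simp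
    then show "prj Z $$ (i,j) = Z $$ (i,j)" using ij Z carrier_matD[OF prj_carrier[of Z]] by auto
  qed (use Z carrier_matD[OF prj_carrier[of Z]] in auto)
  then show "J * Z = Z * J" "prj (P * Z) = 1\<^sub>m n" using prj_commute[of Z] 1 by auto
qed

text \<open>\<open>prj\<close> kills \<open>R - 1\<close> and fixes \<open>S * B\<close>, so their
  sum \<open>X\<close> determines both.\<close>

lemma param_XB:
  assumes R: "R \<in> carrier_mat n n" "det R \<noteq> 0" "prj R = 1\<^sub>m n"
    and B: "B \<in> carrier_mat n n" "J * B + B * J = 0\<^sub>m n n"
  shows "\<exists>x. det (Rm x) \<noteq> 0 \<and> param x = (conjm R J, conjm R B)"
proof -
  define X where "X = (R - 1\<^sub>m n) + S * B"
  define x where "x p = X $$ (p div n, p mod n)" for p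
  have SB: "S * B \<in> carrier_mat n n" using S B by simp
  have R1: "R - 1\<^sub>m n \<in> carrier_mat n n" by (simp add: minus_carrier_mat)
  have X: "X \<in> carrier_mat n n" unfolding X_def by (rule add_carrier_mat[OF SB])
  have "Xm x = X" unfolding Xm_def x_def using X by (intro eq_matI) auto
  moreover have prjX: "prj X = S * B"
  proof -
    have "prj X = (1\<^sub>m n - 1\<^sub>m n) + S * B"
      unfolding X_def prj_add[OF R1 SB] prj_minus[OF R(1) one_carrier_mat] R(3) prj_one
      using prj_id[OF SB] anticommute_iff[OF B(1)] B(2) by simp
    also have "\<dots> = S * B"
    proof -
      have "1\<^sub>m n - 1\<^sub>m n = (0\<^sub>m n n :: complex mat)" by (intro eq_matI) auto
      then show ?thesis using left_add_zero_mat[OF SB] by metis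
    qed
    finally show ?thesis .
  qed
  moreover have "1\<^sub>m n + (X - S * B) = R"
  proof (rule eq_matI)
    fix i j assume "i < dim_row R" "j < dim_col R"
    then have ij: "i < n" "j < n" using R by auto
    have *: "(S * B) \<in> carrier_mat n n" by (rule SB)
    have "(1\<^sub>m n + (X - S * B)) $$ (i,j) = 1\<^sub>m n $$ (i,j) + (X $$ (i,j) - (S * B) $$ (i,j))"
      using ij X carrier_matD[OF SB] by (simp del: index_mult_mat(1))
    moreover have "X $$ (i,j) = R $$ (i,j) - 1\<^sub>m n $$ (i,j) + (S * B) $$ (i,j)"
      unfolding X_def using ij R carrier_matD[OF SB] by (simp del: index_mult_mat(1))
    ultimately show "(1\<^sub>m n + (X - S * B)) $$ (i,j) = R $$ (i,j)" by simp
  qed (use R X carrier_matD[OF SB] in \<open>simp_all del: index_mult_mat(1)\<close>)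
  ultimately have "Rm x = R" "Bm x = B" unfolding Rm_def Bm_def using S_S[OF B(1)] by simp_all
  then show ?thesis using R(2) unfolding param_def by (intro exI[of _ x]) simp
qed

text \<open>With \<open>Z\<close> from \<open>Zm_props\<close>, invertible since
  \<open>det (Zm P)\<close> is nonzero, \<open>R = P * Z\<close> lies in the slice. Conjugating by
  \<open>R\<close> has the same effect on \<open>J\<close> as \<open>P\<close>, because
  \<open>Z\<close> commutes with \<open>J\<close>; on \<open>B\<close> the change is undone by
  replacing \<open>B\<close> with \<open>Z^-1 B Z\<close>.\<close>

lemma generic_in_param:
  assumes P: "P \<in> carrier_mat n n" "det P \<noteq> 0" and K: "det (Km P) \<noteq> 0" and dZ: "det (Zm P) \<noteq> 0"
    and B: "B \<in> carrier_mat n n" "J * B + B * J = 0\<^sub>m n n"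
  shows "\<exists>x. det (Rm x) \<noteq> 0 \<and> param x = (conjm P J, conjm P B)"
proof -
  define Z where "Z = (1 / det (Km P)) \<cdot>\<^sub>m Zm P"
  have Z: "Z \<in> carrier_mat n n" unfolding Z_def using Zm_carrier by simp
  have JZ: "J * Z = Z * J" and pPZ: "prj (P * Z) = 1\<^sub>m n"
    using Zm_props[OF P(1) K] unfolding Z_def by auto
  have "det Z = (1 / det (Km P)) ^ n * det (Zm P)"
    unfolding Z_def using det_smult[of "1 / det (Km P)" "Zm P"] Zm_carrier[of P] by simp
  then have "det Z \<noteq> 0" using dZ K by simp
  then obtain W where W: "W \<in> carrier_mat n n" "Z * W = 1\<^sub>m n" "W * Z = 1\<^sub>m n"
    using det_nonzero_inverse[OF Z] by blast
  obtain Q where Q: "Q \<in> carrier_mat n n" "P * Q = 1\<^sub>m n" "Q * P = 1\<^sub>m n"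
    using det_nonzero_inverse[OF P] by blast
  have assoc: "A * B' * C = A * (B' * C)"
    if "A \<in> carrier_mat n n" "B' \<in> carrier_mat n n" "C \<in> carrier_mat n n" for A B' C :: "complex mat"
    using assoc_mult_mat[OF that] .
  have m: "A * B' \<in> carrier_mat n n"
    if "A \<in> carrier_mat n n" "B' \<in> carrier_mat n n" for A B' :: "complex mat"
    using mult_carrier_mat[OF that] .
  have ZW: "Z * (W * A) = A" if "A \<in> carrier_mat n n" for A
    using assoc[OF Z W(1) that] W(2) that by simp
  define R where "R = P * Z"
  have R: "R \<in> carrier_mat n n" unfolding R_def using P Z by simp
  have WQ: "W * Q \<in> carrier_mat n n" using W Q by simp
  have RWQ: "R * (W * Q) = 1\<^sub>m n"
  proof -
    have "R * (W * Q) = P * (Z * (W * Q))" unfolding R_def by (rule assoc[OF P(1) Z WQ])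
    then show ?thesis using ZW[OF Q(1)] Q by simp
  qed
  have dR: "det R \<noteq> 0" using det_mult[OF R WQ] unfolding RWQ by auto
  define B' where "B' = W * B * Z"
  have WB: "W * B \<in> carrier_mat n n" using W B by simp
  have B': "B' \<in> carrier_mat n n" unfolding B'_def by (rule m[OF WB Z])
  have WJ: "J * W = W * J"
  proof -
    have "J * W = W * (Z * (J * W))"
      using assoc[OF W(1) Z m[OF J W(1)]] unfolding W(3) left_mult_one_mat[OF m[OF J W(1)]] .
    also have "Z * (J * W) = J * Z * W" using assoc[OF Z J W(1)] JZ by simp
    also have "\<dots> = J" using assoc[OF J Z W(1)] W(2) J by simp
    finally show ?thesis .
  qed
  have JB': "J * B' = W * (J * B) * Z"
  proof -
    have "J * B' = J * (W * B) * Z" unfolding B'_def by (rule assoc[OF J WB Z, symmetric])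
    also have "J * (W * B) = J * W * B" by (rule assoc[OF J W(1) B(1), symmetric])
    also have "\<dots> = W * (J * B)" unfolding WJ by (rule assoc[OF W(1) J B(1)])
    finally show ?thesis .
  qed
  have BJ': "B' * J = W * (B * J) * Z"
  proof -
    have "B' * J = W * B * (Z * J)" unfolding B'_def by (rule assoc[OF WB Z J])
    also have "\<dots> = W * B * J * Z" unfolding JZ[symmetric] by (rule assoc[OF WB J Z, symmetric])
    also have "W * B * J = W * (B * J)" by (rule assoc[OF W(1) B(1) J])
    finally show ?thesis .
  qed
  have "J * B' + B' * J = (W * (J * B) + W * (B * J)) * Z"
    unfolding JB' BJ' by (rule add_mult_distrib_mat[symmetric, of _ n n])
      (use W(1) J B(1) Z in auto)
  also have "W * (J * B) + W * (B * J) = W * (J * B + B * J)"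
    by (rule mult_add_distrib_mat[symmetric, OF W(1) m[OF J B(1)] m[OF B(1) J]])
  finally have "J * B' + B' * J = 0\<^sub>m n n" unfolding B(2) using W(1) Z by simp
  from param_XB[OF R dR pPZ[folded R_def] B' this]
  obtain x where x: "det (Rm x) \<noteq> 0" "param x = (conjm R J, conjm R B')" by blast
  \<comment> \<open>Needed twice: with \<open>A = A' = J\<close>, and with \<open>A = B\<close> and
    \<open>A' = B'\<close>.\<close>
  have conj: "conjm R A' = conjm P A" if A: "A \<in> carrier_mat n n" and A': "Z * A' = A * Z" "A' \<in> carrier_mat n n" for A A'
  proof -
    have "conjm R A' = R * A' * (W * Q)" by (rule conjm_inverse[OF R WQ RWQ A'(2)])
    also have "R * A' = P * (Z * A')" unfolding R_def by (rule assoc[OF P(1) Z A'(2)])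
    also have "\<dots> = P * A * Z" unfolding A'(1) by (rule assoc[OF P(1) A Z, symmetric])
    also have "P * A * Z * (W * Q) = P * A * (Z * (W * Q))" by (rule assoc[OF m[OF P(1) A] Z WQ])
    also have "\<dots> = P * A * Q" unfolding ZW[OF Q(1)] ..
    finally show ?thesis using conjm_inverse[OF P(1) Q(1,2) A] by simp
  qed
  have "Z * B' = B * Z"
  proof -
    have "Z * B' = Z * (W * (B * Z))" unfolding B'_def using assoc[OF W(1) B(1) Z] by simp
    then show ?thesis using ZW[OF m[OF B(1) Z]] by simp
  qed
  then have "param x = (conjm P J, conjm P B)" unfolding x(2)
    using conj[OF J JZ[symmetric] J] conj[OF B(1) _ B'] by simp
  then show ?thesis using x(1) by blast
qed

text \<open>A matrix \<open>P\<close> is joined to the identity by a line; all but finitely many points of the line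
  satisfy the open conditions of \<open>generic_in_param\<close>.\<close>

lemma param_dense:
  assumes f: "f \<in> polyfuns (pair_coords n)" and van: "\<And>x. det (Rm x) \<noteq> 0 \<Longrightarrow> f (param x) = 0"
    and y: "y \<in> orb"
  shows "f y = 0"
proof -
  obtain P Q B where P: "P \<in> carrier_mat n n" and Q: "Q \<in> carrier_mat n n" and PQ: "P * Q = 1\<^sub>m n"
    and B: "B \<in> carrier_mat n n" "J * B + B * J = 0\<^sub>m n n" and y: "y = (P * J * Q, P * B * Q)"
    using y unfolding orb_def by blast
  have y': "y = (conjm P J, conjm P B)" unfolding y using conjm_inverse[OF P Q PQ] J B(1) by simp
  have dP: "det P \<noteq> 0" by (rule adj_mat_inverse(2)[OF P Q PQ])
  define L where "L t = 1\<^sub>m n + t \<cdot>\<^sub>m (P - 1\<^sub>m n)" for t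
  have Pm: "P - 1\<^sub>m n \<in> carrier_mat n n" by (simp add: minus_carrier_mat)
  have Lp: "polymat {\<lambda>t. t} n n L" unfolding L_def
    by (intro polymat_add polymat_const polymat_smult pf_coord Pm) auto
  have L0: "L 0 = 1\<^sub>m n" and L1: "L 1 = P" unfolding L_def using P by (auto intro!: eq_matI)
  have Kp: "polymat {\<lambda>t. t} (n*n) (n*n) (\<lambda>t. Km (L t))" unfolding Km_def
    by (intro polymat_add polymat_mult[where l = "n*n"] polymat_const pim_carrier pim_compl_carrier polymat_sandm Lp) auto
  have Zp: "polymat {\<lambda>t. t} n n (\<lambda>t. Zm (L t))" unfolding Zm_def
    by (intro polymat_uncolm polymat_mult[where l = "n*n"] polymat_const polymat_adj Kp) auto
  define s where "s t = det (L t) * (det (Km (L t)) * det (Zm (L t)))" for t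
  have sp: "s \<in> polyfuns {\<lambda>t. t}" unfolding s_def
    by (rule pf_mult[OF polymat_det[OF Lp] pf_mult[OF polymat_det[OF Kp] polymat_det[OF Zp]]])
  have s0: "s 0 \<noteq> 0" unfolding s_def L0 Km_one Zm_one by simp
  have "\<exists>e. \<exists>g\<in>polyfuns {\<lambda>t. t}. \<forall>t. det (L t) \<noteq> 0 \<longrightarrow>
      det (L t) ^ e * f (conjm (L t) J, conjm (L t) B) = g t"
    by (rule rational_pullback[where \<phi> = "\<lambda>t. (conjm (L t) J, conjm (L t) B)", OF f polymat_det[OF Lp]])
      (rule conjm_rational[OF Lp polymat_const[OF J] polymat_const[OF B(1)]])
  then obtain e g where g: "g \<in> polyfuns {\<lambda>t. t}"
    "\<And>t. det (L t) \<noteq> 0 \<Longrightarrow> det (L t) ^ e * f (conjm (L t) J, conjm (L t) B) = g t" by blast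
  \<comment> \<open>Where \<open>s\<close> is nonzero, the conjugated pair is a value of
    \<open>param\<close>, so the numerator \<open>g\<close> vanishes. As \<open>s\<close> is nonzero
    at \<open>t = 0\<close>, this excludes only finitely many \<open>t\<close>, so \<open>g\<close>
    vanishes at \<open>t = 1\<close> as well.\<close>
  have gs: "g t = 0 \<or> s t = 0" for t
  proof (rule disjCI)
    assume "s t \<noteq> 0"
    then have "det (L t) \<noteq> 0" "det (Km (L t)) \<noteq> 0" "det (Zm (L t)) \<noteq> 0" unfolding s_def by auto
    from generic_in_param[OF polymat_carrier[OF Lp] this B] obtain x
      where "det (Rm x) \<noteq> 0" "param x = (conjm (L t) J, conjm (L t) B)" by blast
    then have "f (conjm (L t) J, conjm (L t) B) = 0" using van by metis
    then show "g t = 0" using g(2)[OF \<open>det (L t) \<noteq> 0\<close>] by simp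
  qed
  have "g 1 = 0"
  proof (rule ccontr)
    assume "g 1 \<noteq> 0"
    from common_nonzero[OF polyfuns_id_finite_zeros[OF sp s0] polyfuns_id_finite_zeros[OF g(1) this]]
    show False using gs by blast
  qed
  then show ?thesis using g(2)[of 1] dP unfolding L1 y' by simp
qed

end

text \<open>Agrees with \<open>fst\<close> on \<open>pairs_space n\<close>, but is an
  \<open>n\<close> by \<open>n\<close> matrix at every pair, as \<open>polymat\<close>
  demands.\<close>

definition fstm :: "nat \<Rightarrow> complex mat \<times> complex mat \<Rightarrow> complex mat" where
  "fstm n y = mat n n (\<lambda>(i,j). fst y $$ (i,j))"

definition sndm :: "nat \<Rightarrow> complex mat \<times> complex mat \<Rightarrow> complex mat" where
  "sndm n y = mat n n (\<lambda>(i,j). snd y $$ (i,j))"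

lemma fstm_sndm: "A \<in> carrier_mat n n \<Longrightarrow> fstm n (A, B) = A" "B \<in> carrier_mat n n \<Longrightarrow> sndm n (A, B) = B"
  unfolding fstm_def sndm_def by (auto intro!: eq_matI)

lemma polymat_fstm: "polymat (pair_coords n) n n (fstm n)"
  unfolding fstm_def by (rule polymat_mat, rule pf_coord) (auto simp: pair_coords_def case_prod_unfold)

lemma polymat_sndm: "polymat (pair_coords n) n n (sndm n)"
  unfolding sndm_def by (rule polymat_mat, rule pf_coord) (auto simp: pair_coords_def case_prod_unfold)

section \<open>The rational left inverse of the parametrization\<close>

context signed_nilpotent
begin

text \<open>Combines the equations \<open>A * R = R * J\<close> and \<open>prj R = 1\<close> into
  one square system. At \<open>A = J\<close> the two summands add up to the identity, by the
  definition of \<open>pim\<close>.\<close>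

definition Lm :: "complex mat \<Rightarrow> complex mat" where
  "Lm A = gin * adm A + pim"

definition rho :: "complex mat \<Rightarrow> complex mat" where
  "rho A = uncolm n (adj_mat (Lm A) * colm n (1\<^sub>m n))"

lemma Lm_carrier: "Lm A \<in> carrier_mat (n*n) (n*n)"
  unfolding Lm_def by (rule add_carrier_mat[OF pim_carrier])

lemma Lm_J: "Lm J = 1\<^sub>m (n*n)"
  unfolding Lm_def pim_def using gin(1) carrier_matD[OF adm_carrier[of J]] by (intro eq_matI) auto

lemma rho_J: "rho J = 1\<^sub>m n"
  unfolding rho_def Lm_J adj_mat_one by (simp add: left_mult_one_mat[OF colm_carrier] uncolm_colm)

text \<open>\<open>R = Rm x\<close> is recovered from \<open>A = R J R\<^sup>-\<^sup>1\<close> by the linear system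
  \<open>A R = R J\<close>, \<open>prj R = 1\<close>, which is nonsingular for \<open>A = J\<close>.\<close>

lemma rho_intertwine:
  assumes A: "A \<in> carrier_mat n n" and R: "R \<in> carrier_mat n n" and AR: "A * R = R * J"
    and pR: "prj R = 1\<^sub>m n"
  shows "rho A = det (Lm A) \<cdot>\<^sub>m R"
proof -
  note adj = adj_mat[OF Lm_carrier[of A]]
  have "R * J - R * J = 0\<^sub>m n n" using J R by (intro eq_matI) auto
  then have "adm A * colm n R = colm n (0\<^sub>m n n)" unfolding adm_colm[OF A R] AR by simp
  also have "\<dots> = 0\<^sub>m (n*n) 1" unfolding colm_def by (intro eq_matI) (auto simp: mat_index_div_mod)
  finally have 0: "adm A * colm n R = 0\<^sub>m (n*n) 1" .
  have "Lm A * colm n R = gin * adm A * colm n R + pim * colm n R"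
    unfolding Lm_def
    by (rule add_mult_distrib_mat[OF mult_carrier_mat[OF gin(1) adm_carrier] pim_carrier colm_carrier])
  also have "gin * adm A * colm n R = 0\<^sub>m (n*n) 1"
    unfolding assoc_mult_mat[OF gin(1) adm_carrier colm_carrier] 0 by (rule right_mult_zero_mat[OF gin(1)])
  also have "0\<^sub>m (n*n) 1 + pim * colm n R = colm n (1\<^sub>m n)"
    unfolding pim_colm pR by (rule left_add_zero_mat[OF colm_carrier])
  finally have "adj_mat (Lm A) * colm n (1\<^sub>m n) = adj_mat (Lm A) * (Lm A * colm n R)" by simp
  also have "\<dots> = adj_mat (Lm A) * Lm A * colm n R"
    by (rule assoc_mult_mat[OF adj(1) Lm_carrier colm_carrier, symmetric])
  also have "\<dots> = det (Lm A) \<cdot>\<^sub>m colm n R"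
    unfolding adj(3) mult_smult_assoc_mat[OF one_carrier_mat colm_carrier] left_mult_one_mat[OF colm_carrier] ..
  finally show ?thesis unfolding rho_def uncolm_smult[OF colm_carrier] by (simp add: uncolm_smult uncolm_colm[OF R])
qed

lemma prj_Rm: "prj (Rm x) = 1\<^sub>m n"
proof -
  have "prj (Rm x) = 1\<^sub>m n + (prj (Xm x) - prj (Xm x))"
    unfolding Rm_def
    using prj_add[OF one_carrier_mat minus_carrier_mat[OF prj_carrier], of "Xm x"]
      prj_minus[OF carriers(1) prj_carrier, of x] prj_prj prj_one by metis
  also have "\<dots> = 1\<^sub>m n" using carrier_matD[OF prj_carrier[of "Xm x"]] by (intro eq_matI) auto
  finally show ?thesis .
qed

text \<open>\<open>w\<close> is the common denominator and the \<open>u\<close> are the numerators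
  of a left inverse of \<open>param\<close>. The pair \<open>(J, 0)\<close> is \<open>param\<close>
  at the origin, so \<open>w\<close> does not vanish identically on the image of any coordinate
  subspace.\<close>

lemma param_inverse:
  "\<exists>w\<in>polyfuns (pair_coords n). w (J, 0\<^sub>m n n) \<noteq> 0 \<and>
     (\<forall>p<n*n. \<exists>u\<in>polyfuns (pair_coords n). \<forall>x. det (Rm x) \<noteq> 0 \<longrightarrow> u (param x) = w (param x) * x p)"
proof -
  have Lp: "polymat (pair_coords n) (n*n) (n*n) (\<lambda>y. Lm (fstm n y))"
    unfolding Lm_def adm_def
    by (intro polymat_add polymat_mult[OF polymat_const[OF gin(1)]] polymat_minus polymat_sandm
        polymat_const[OF pim_carrier] polymat_const[OF one_carrier_mat] polymat_const[OF J] polymat_fstm)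
  have rp: "polymat (pair_coords n) n n (\<lambda>y. rho (fstm n y))" unfolding rho_def
    by (intro polymat_uncolm polymat_mult[OF polymat_adj[OF Lp]] polymat_const colm_carrier)
  define d where "d y = det (Lm (fstm n y))" for y
  define r where "r y = rho (fstm n y)" for y
  define w where "w y = det (r y) * d y" for y
  \<comment> \<open>At \<open>param x\<close> one has \<open>r = d R\<close>. The first summand is
    then \<open>w\<close> times \<open>R - 1 = X - prj X\<close>; in the second,
    \<open>adj_mat r\<close> undoes the conjugation up to \<open>det r\<close> and \<open>S\<close>
    turns \<open>B\<close> back into \<open>prj X\<close>. Together they give \<open>w\<close> times
    \<open>X\<close>.\<close>
  define U where "U y = det (r y) \<cdot>\<^sub>m (r y - d y \<cdot>\<^sub>m 1\<^sub>m n) + d y \<cdot>\<^sub>m (S * (adj_mat (r y) * (sndm n y * r y)))" for y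
  have dp: "d \<in> polyfuns (pair_coords n)" unfolding d_def by (rule polymat_det[OF Lp])
  have rp': "polymat (pair_coords n) n n r" unfolding r_def by (rule rp)
  have wp: "w \<in> polyfuns (pair_coords n)" unfolding w_def by (rule pf_mult[OF polymat_det[OF rp'] dp])
  have Up: "polymat (pair_coords n) n n U" unfolding U_def
    by (intro polymat_add polymat_minus polymat_smult polymat_det[OF rp'] dp rp'
        polymat_mult[OF polymat_const[OF S]] polymat_mult[OF polymat_adj[OF rp']]
        polymat_mult[OF polymat_sndm] polymat_const[OF one_carrier_mat])
  have w0: "w (J, 0\<^sub>m n n) = 1"
    unfolding w_def d_def r_def fstm_sndm(1)[OF J] rho_J Lm_J by simp
  have U: "U (param x) = w (param x) \<cdot>\<^sub>m Xm x" if dR: "det (Rm x) \<noteq> 0" for x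
  proof -
    obtain Q where Q: "Q \<in> carrier_mat n n" "Rm x * Q = 1\<^sub>m n" "Q * Rm x = 1\<^sub>m n"
      using det_nonzero_inverse[OF carriers(2) dR] by blast
    define R B A' B' where "R = Rm x" and "B = Bm x" and "A' = R * J * Q" and "B' = R * B * Q"
    have c: "R \<in> carrier_mat n n" "B \<in> carrier_mat n n" unfolding R_def B_def by simp_all
    have c': "A' \<in> carrier_mat n n" "B' \<in> carrier_mat n n" unfolding A'_def B'_def using c J Q by auto
    have QR: "Q * R = 1\<^sub>m n" unfolding R_def by (rule Q(3))
    have par: "param x = (A', B')"
      unfolding param_def A'_def B'_def R_def B_def
      using conjm_inverse[OF carriers(2) Q(1,2)] J by simp
    have int: "M * R = R * N" if M: "M = R * N * Q" and N: "N \<in> carrier_mat n n" for M N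
    proof -
      have "M * R = R * N * (Q * R)" unfolding M
        by (rule assoc_mult_mat[OF mult_carrier_mat[OF c(1) N] Q(1) c(1)])
      then show ?thesis unfolding QR right_mult_one_mat[OF mult_carrier_mat[OF c(1) N]] .
    qed
    define \<delta> \<rho> where "\<delta> = d (A', B')" and "\<rho> = r (A', B')"
    have \<rho>: "\<rho> = \<delta> \<cdot>\<^sub>m R"
      unfolding \<rho>_def \<delta>_def r_def d_def fstm_sndm(1)[OF c'(1)]
      by (rule rho_intertwine[OF c'(1) c(1) int[OF A'_def J]]) (simp add: R_def prj_Rm)
    have \<rho>c: "\<rho> \<in> carrier_mat n n" unfolding \<rho> using c by simp
    note adj = adj_mat[OF \<rho>c]
    have "B' * \<rho> = \<delta> \<cdot>\<^sub>m (B' * R)" unfolding \<rho> by (rule mult_smult_distrib[OF c'(2) c(1)])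
    also have "\<dots> = \<delta> \<cdot>\<^sub>m (R * B)" unfolding int[OF B'_def c(2)] ..
    also have "\<dots> = \<rho> * B" unfolding \<rho> by (rule mult_smult_assoc_mat[OF c, symmetric])
    finally have "adj_mat \<rho> * (B' * \<rho>) = adj_mat \<rho> * \<rho> * B"
      using assoc_mult_mat[OF adj(1) \<rho>c c(2)] by simp
    also have "\<dots> = det \<rho> \<cdot>\<^sub>m B"
      unfolding adj(3) mult_smult_assoc_mat[OF one_carrier_mat c(2)] left_mult_one_mat[OF c(2)] ..
    finally have "S * (adj_mat \<rho> * (B' * \<rho>)) = det \<rho> \<cdot>\<^sub>m (S * B)"
      using mult_smult_distrib[OF S c(2)] by simp
    also have "S * B = prj (Xm x)" unfolding B_def Bm_def by (rule S_S[OF prj_carrier])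
    finally have e: "S * (adj_mat \<rho> * (B' * \<rho>)) = det \<rho> \<cdot>\<^sub>m prj (Xm x)" .
    have "U (param x) = det \<rho> \<cdot>\<^sub>m (\<delta> \<cdot>\<^sub>m R - \<delta> \<cdot>\<^sub>m 1\<^sub>m n) + \<delta> \<cdot>\<^sub>m (det \<rho> \<cdot>\<^sub>m prj (Xm x))"
      unfolding U_def par e[symmetric] fstm_sndm(2)[OF c'(2)] \<rho>_def[symmetric] \<delta>_def[symmetric]
      unfolding \<rho> ..
    also have "\<dots> = (det \<rho> * \<delta>) \<cdot>\<^sub>m Xm x"
      unfolding R_def Rm_def using carrier_matD[OF prj_carrier[of "Xm x"]] carrier_matD[OF carriers(1)[of x]]
      by (intro eq_matI) (auto simp: algebra_simps)
    finally show ?thesis unfolding w_def par \<rho>_def \<delta>_def .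
  qed
  have "\<exists>u\<in>polyfuns (pair_coords n). \<forall>x. det (Rm x) \<noteq> 0 \<longrightarrow> u (param x) = w (param x) * x p" if p: "p < n*n" for p
  proof (intro bexI allI impI)
    show "(\<lambda>y. U y $$ (p div n, p mod n)) \<in> polyfuns (pair_coords n)"
      using mat_index_div_mod[OF p] polymat_entry[OF Up] by blast
    fix x assume "det (Rm x) \<noteq> 0"
    from U[OF this] show "U (param x) $$ (p div n, p mod n) = w (param x) * x p"
      using mat_index_div_mod[OF p] by (simp add: Xm_def)
  qed
  then show ?thesis using wp w0 by (intro bexI[of _ w]) auto
qed

section \<open>Irreducibility and dimension of the orbit closures\<close>

definition orbcl :: "(complex mat \<times> complex mat) set" where
  "orbcl = zclosure (pairs_space n) (pair_coords n) orb"

definition flag :: "nat \<Rightarrow> (complex mat \<times> complex mat) set" where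
  "flag i = zclosure (pairs_space n) (pair_coords n) (param ` {x. (\<forall>p\<ge>i. x p = 0) \<and> det (Rm x) \<noteq> 0})"

lemma det_Rm_0: "det (Rm (\<lambda>_. 0)) \<noteq> 0"
  unfolding Rm_0 by simp

lemma param_in_space: "det (Rm x) \<noteq> 0 \<Longrightarrow> param x \<in> pairs_space n"
  using param_orb orb_subset by blast

lemma zirreducible_flag: "zirreducible (pairs_space n) (pair_coords n) (flag i)"
  unfolding flag_def
  by (rule zirreducible_rational_image[where \<phi> = param and q = "\<lambda>x. det (Rm x)", OF polymat_det[OF polymat_Rm] param_rational param_in_space det_Rm_0])

lemma flag_top: "flag (n*n) = orbcl"
proof
  show "flag (n*n) \<subseteq> orbcl" unfolding flag_def orbcl_def
    by (rule zclosure_mono) (use param_orb in auto)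
  have "orb \<subseteq> flag (n*n)" unfolding flag_def
  proof (rule subset_zclosureI[OF orb_subset])
    fix f y assume f: "f \<in> polyfuns (pair_coords n)" "y \<in> orb"
      and van: "\<And>y. y \<in> param ` {x. (\<forall>p\<ge>n*n. x p = 0) \<and> det (Rm x) \<noteq> 0} \<Longrightarrow> f y = 0"
    show "f y = 0"
    proof (rule param_dense[OF f(1) _ f(2)])
      fix x assume x: "det (Rm x) \<noteq> 0"
      \<comment> \<open>Coordinates from \<open>n*n\<close> on do not enter \<open>Xm\<close>, so
        they may be set to zero without changing the value of \<open>param\<close>.\<close>
      define x' where "x' p = (if p < n*n then x p else 0)" for p
      have "Xm x' = Xm x" unfolding Xm_def x'_def by (intro eq_matI) (auto simp: mat_index_bound)
      then have "Rm x' = Rm x" "param x' = param x" unfolding param_def Rm_def Bm_def by simp_all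
      moreover have "\<forall>p\<ge>n*n. x' p = 0" unfolding x'_def by simp
      ultimately have "param x \<in> param ` {x. (\<forall>p\<ge>n*n. x p = 0) \<and> det (Rm x) \<noteq> 0}"
        using x by (intro image_eqI[of _ _ x']) auto
      then show "f (param x) = 0" by (rule van)
    qed
  qed
  then show "orbcl \<subseteq> flag (n*n)" unfolding orbcl_def flag_def by (intro zclosure_minimal zclosed_zclosure)
qed

text \<open>The numerator \<open>u\<close> of coordinate \<open>i\<close> separates the two sets:
  along \<open>param\<close> it equals \<open>w\<close> times \<open>x i\<close>, which is zero on
  the smaller subspace but not identically zero on the larger one.\<close>

lemma flag_strict:
  assumes "i < n*n"
  shows "flag i \<subset> flag (Suc i)"
proof -
  let ?S = "\<lambda>i. {x. (\<forall>p\<ge>i. x p = 0) \<and> det (Rm x) \<noteq> 0}"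
  have sub: "flag i \<subseteq> flag (Suc i)" unfolding flag_def by (intro zclosure_mono image_mono) auto
  obtain w u where w: "w \<in> polyfuns (pair_coords n)" "w (J, 0\<^sub>m n n) \<noteq> 0"
    and u: "u \<in> polyfuns (pair_coords n)" "\<And>x. det (Rm x) \<noteq> 0 \<Longrightarrow> u (param x) = w (param x) * x i"
    using param_inverse assms by blast
  have inX: "param ` ?S i \<subseteq> pairs_space n" for i using param_in_space by auto
  have "flag i \<noteq> flag (Suc i)"
  proof
    assume eq: "flag i = flag (Suc i)"
    have "u y = 0" if "y \<in> flag i" for y
      by (rule zclosure_vanish[OF inX u(1) _ that[unfolded flag_def]]) (use u(2) in auto)
    then have van: "u (param x) = 0" if "x \<in> ?S (Suc i)" for x
      using that subset_zclosure[OF inX[of "Suc i"], of "pair_coords n"] eq unfolding flag_def by blast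
    obtain e g where g: "g \<in> polyfuns (ncoords (n*n))"
      "\<And>x. det (Rm x) \<noteq> 0 \<Longrightarrow> det (Rm x) ^ e * w (param x) = g x"
      using rational_pullback[where \<phi> = param, OF w(1) polymat_det[OF polymat_Rm] param_rational] by blast
    \<comment> \<open>One factor is nonzero at the origin, the other at the unit vector
      \<open>i\<close>; irreducibility of the coordinate subspace yields a common point.\<close>
    have "\<exists>z. (\<forall>p\<ge>Suc i. z p = 0) \<and> det (Rm z) * g z \<noteq> 0 \<and> z i \<noteq> 0"
    proof (rule ncoords_nonvanishing[where x = "\<lambda>_. 0" and y = "\<lambda>p. if p = i then 1 else 0"])
      show "(\<lambda>z. det (Rm z) * g z) \<in> polyfuns (ncoords (n*n))"
        by (rule pf_mult[OF polymat_det[OF polymat_Rm] g(1)])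
      show "(\<lambda>z. z i) \<in> polyfuns (ncoords (n*n))" by (rule pf_coord) (use assms in \<open>auto simp: ncoords_def\<close>)
      show "det (Rm (\<lambda>_. 0)) * g (\<lambda>_. 0) \<noteq> 0"
        using det_Rm_0 g(2)[OF det_Rm_0] w(2) unfolding param_0 by auto
    qed auto
    then obtain z where z: "\<forall>p\<ge>Suc i. z p = 0" "det (Rm z) \<noteq> 0" "g z \<noteq> 0" "z i \<noteq> 0" by auto
    then have "w (param z) \<noteq> 0" using g(2)[OF z(2)] by auto
    then show False using van[of z] u(2)[OF z(2)] z by auto
  qed
  then show ?thesis using sub by blast
qed

text \<open>A relation that holds on the image of \<open>param\<close> extends to the orbit by
  density and then to its closure. So functions independent on the top of the chain stay independent
  on the image, where at most \<open>n*n\<close> of them fit.\<close>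

lemma orbcl_chain_le:
  assumes Z: "\<And>i. i \<le> k \<Longrightarrow> Z i \<subseteq> orbcl \<and> zclosed (pairs_space n) (pair_coords n) (Z i)
      \<and> zirreducible (pairs_space n) (pair_coords n) (Z i)"
    and "\<And>i. i < k \<Longrightarrow> Z i \<subset> Z (Suc i)"
  shows "k \<le> n*n"
proof -
  obtain f where f: "\<And>i. i < k \<Longrightarrow> f i \<in> polyfuns (pair_coords n)" "alg_indep k f (Z k)"
    using chain_alg_indep[of k "pairs_space n" "pair_coords n" Z] assms by blast
  have "alg_indep k f (param ` {x. det (Rm x) \<noteq> 0})"
    unfolding alg_indep_def
  proof (intro allI impI)
    fix T :: nat and c
    define F where "F y = (\<Sum>a \<in> {..<k} \<rightarrow>\<^sub>E {..T}. c a * (\<Prod>i<k. f i y ^ a i))" for y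
    assume van: "\<forall>y\<in>param ` {x. det (Rm x) \<noteq> 0}. (\<Sum>a \<in> {..<k} \<rightarrow>\<^sub>E {..T}. c a * (\<Prod>i<k. f i y ^ a i)) = 0"
    have F: "F \<in> polyfuns (pair_coords n)"
      unfolding F_def using f(1) by (intro pf_sum pf_mult pf_prod pf_power pf_const finite_PiE) auto
    have "F y = 0" if "y \<in> orb" for y
      by (rule param_dense[OF F _ that]) (use van in \<open>auto simp: F_def\<close>)
    then have "F y = 0" if "y \<in> Z k" for y
      using zclosure_vanish[OF orb_subset F] that Z[of k] unfolding orbcl_def by blast
    then show "\<forall>a\<in>{..<k} \<rightarrow>\<^sub>E {..T}. c a = 0"
      using f(2)[unfolded alg_indep_def, rule_format, where T = T and c = c] unfolding F_def by blast
  qed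
  from alg_indep_rational_image_le[where \<phi> = param and q = "\<lambda>x. det (Rm x)",
      OF polymat_det[OF polymat_Rm] param_rational f(1) this]
  show ?thesis .
qed

lemma zirreducible_orbcl: "zirreducible (pairs_space n) (pair_coords n) orbcl"
  using zirreducible_flag[of "n*n"] unfolding flag_top .

lemma zdim_orbcl: "zdim (pairs_space n) (pair_coords n) orbcl = enat (n*n)"
  unfolding zdim_def
proof (rule antisym[OF Sup_least Sup_upper])
  fix e assume "e \<in> {enat k | k. \<exists>Z :: nat \<Rightarrow> (complex mat \<times> complex mat) set.
      (\<forall>i \<le> k. Z i \<subseteq> orbcl \<and> zclosed (pairs_space n) (pair_coords n) (Z i) \<and> zirreducible (pairs_space n) (pair_coords n) (Z i)) \<and>
      (\<forall>i < k. Z i \<subset> Z (Suc i))}"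
  then obtain k Z where e: "e = enat k"
    and Z: "\<And>i. i \<le> k \<Longrightarrow> Z i \<subseteq> orbcl \<and> zclosed (pairs_space n) (pair_coords n) (Z i) \<and> zirreducible (pairs_space n) (pair_coords n) (Z i)"
      "\<And>i. i < k \<Longrightarrow> Z i \<subset> Z (Suc i)" by blast
  from orbcl_chain_le[of k Z, OF Z] show "e \<le> enat (n*n)" unfolding e by simp
next
  have "flag i \<subseteq> orbcl" if "i \<le> n*n" for i
    unfolding flag_top[symmetric] flag_def using that by (intro zclosure_mono image_mono) auto
  then show "enat (n*n) \<in> {enat k | k. \<exists>Z :: nat \<Rightarrow> (complex mat \<times> complex mat) set.
      (\<forall>i \<le> k. Z i \<subseteq> orbcl \<and> zclosed (pairs_space n) (pair_coords n) (Z i) \<and> zirreducible (pairs_space n) (pair_coords n) (Z i)) \<and>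
      (\<forall>i < k. Z i \<subset> Z (Suc i))}"
    using zirreducible_flag flag_strict zclosed_zclosure
    by (intro CollectI exI[of _ "n*n"] conjI exI[of _ flag] refl) (auto simp: flag_def)
qed

end

section \<open>Nilpotent Jordan matrices\<close>

lemma similar_mat_swap:
  fixes A B :: "complex mat"
  assumes A: "A \<in> carrier_mat n n" and B: "B \<in> carrier_mat m m"
  shows "similar_mat (four_block_mat A (0\<^sub>m n m) (0\<^sub>m m n) B) (four_block_mat B (0\<^sub>m m n) (0\<^sub>m n m) A)"
proof -
  let ?P = "four_block_mat (0\<^sub>m n m) (1\<^sub>m n) (1\<^sub>m m) (0\<^sub>m m n) :: complex mat"
  let ?Q = "four_block_mat (0\<^sub>m m n) (1\<^sub>m m) (1\<^sub>m n) (0\<^sub>m n m) :: complex mat"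
  let ?M = "four_block_mat B (0\<^sub>m m n) (0\<^sub>m n m) A"
  have PQ: "?P * ?Q = 1\<^sub>m (n + m)"
    by (subst mult_four_block_mat[of _ n m _ n _ m _ _ n _ m]) auto
  have QP: "?Q * ?P = 1\<^sub>m (m + n)"
    by (subst mult_four_block_mat[of _ m n _ m _ n _ _ m _ n]) auto
  have PM: "?P * ?M = four_block_mat (0\<^sub>m n m) A B (0\<^sub>m m n)"
    using A B by (subst mult_four_block_mat[of _ n m _ n _ m _ _ m _ n]) auto
  have PMQ: "?P * ?M * ?Q = four_block_mat A (0\<^sub>m n m) (0\<^sub>m m n) B"
    unfolding PM using A B by (subst mult_four_block_mat[of _ n m _ n _ m _ _ n _ m]) auto
  show ?thesis
  proof (rule similar_matI[where P = ?P and Q = ?Q and n = "n + m"])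
    show "{four_block_mat A (0\<^sub>m n m) (0\<^sub>m m n) B, ?M, ?P, ?Q} \<subseteq> carrier_mat (n + m) (n + m)"
      using A B four_block_carrier_mat[OF A B] four_block_carrier_mat[OF B A]
      by (auto simp: add.commute)
  qed (use PQ QP PMQ in \<open>simp_all add: add.commute\<close>)
qed

lemma similar_jordan_matrix_append:
  fixes xs ys us vs :: "(nat \<times> complex) list"
  assumes "similar_mat (jordan_matrix xs) (jordan_matrix us)" "similar_mat (jordan_matrix ys) (jordan_matrix vs)"
  shows "similar_mat (jordan_matrix (xs @ ys)) (jordan_matrix (us @ vs))"
  using similar_diag_mat_block_mat[of "[(jordan_matrix xs, jordan_matrix us), (jordan_matrix ys, jordan_matrix vs)]"]
    assms jordan_matrix_concat_diag_block_mat[of "[xs, ys]"] jordan_matrix_concat_diag_block_mat[of "[us, vs]"]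
  by auto

lemma similar_jordan_matrix_swap:
  fixes xs ys :: "(nat \<times> complex) list"
  shows "similar_mat (jordan_matrix (xs @ ys)) (jordan_matrix (ys @ xs))"
proof -
  have *: "jordan_matrix (xs @ ys) = four_block_mat (jordan_matrix xs)
     (0\<^sub>m (sum_list (map fst xs)) (sum_list (map fst ys))) (0\<^sub>m (sum_list (map fst ys)) (sum_list (map fst xs)))
     (jordan_matrix ys)" for xs ys :: "(nat \<times> complex) list"
    using jordan_matrix_dim[of xs] jordan_matrix_dim[of ys]
    unfolding jordan_matrix_def by (simp add: diag_block_mat_append Let_def)
  show ?thesis unfolding * by (rule similar_mat_swap) auto
qed

lemma similar_jordan_matrix_refl: "similar_mat (jordan_matrix (xs :: (nat \<times> complex) list)) (jordan_matrix xs)"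
  by (rule similar_mat_refl) auto

text \<open>A Jordan normal form comes with its blocks in some order, a partition in decreasing
  order. The similarity is built by moving one block to the front at a time.\<close>

lemma similar_jordan_matrix_mset:
  fixes xs ys :: "(nat \<times> complex) list"
  assumes "mset xs = mset ys"
  shows "similar_mat (jordan_matrix xs) (jordan_matrix ys)"
  using assms
proof (induction xs arbitrary: ys)
  case Nil
  then show ?case by (simp add: similar_jordan_matrix_refl)
next
  case (Cons x xs)
  then have "x \<in> set ys" by (metis list.set_intros(1) set_mset_mset)
  then obtain as bs where ys: "ys = as @ x # bs" by (meson split_list)
  then have "mset xs = mset (as @ bs)" using Cons.prems by simp
  from similar_jordan_matrix_append[OF similar_jordan_matrix_refl Cons.IH[OF this], of "[x]"]
  have 1: "similar_mat (jordan_matrix (x # xs)) (jordan_matrix (([x] @ as) @ bs))" by simp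
  have "similar_mat (jordan_matrix (([x] @ as) @ bs)) (jordan_matrix ((as @ [x]) @ bs))"
    by (rule similar_jordan_matrix_append[OF similar_jordan_matrix_swap similar_jordan_matrix_refl])
  with 1 show ?case unfolding ys using similar_mat_trans by fastforce
qed

lemma Jnil_carrier: "is_partition n lam \<Longrightarrow> Jnil lam \<in> carrier_mat n n"
  unfolding Jnil_def is_partition_def using jordan_matrix_carrier[of "map (\<lambda>k. (k, 0 :: complex)) lam"]
  by (simp add: o_def)

lemma nilpotent_similar_Jnil:
  assumes A: "A \<in> carrier_mat n n" and nil: "nilpotent_mat A"
  shows "\<exists>lam. is_partition n lam \<and> similar_mat A (Jnil lam)"
proof -
  obtain k where k: "A ^\<^sub>m k = 0\<^sub>m n n" using nil A unfolding nilpotent_mat_def by auto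
  obtain as where "char_poly A = (\<Prod>a\<leftarrow>as. [:- a, 1:])" using char_poly_factorized[OF A] by blast
  from jordan_nf_exists[OF A this] obtain ns where ns: "jordan_nf A ns" by blast
  \<comment> \<open>The size of a block is positive, so \<open>a\<close> is an eigenvalue, and an
    eigenvector \<open>v\<close> satisfies \<open>a ^ k\<close> times \<open>v\<close> equal to
    zero.\<close>
  have ev0: "a = 0" if mem: "(m, a) \<in> set ns" for m a
  proof -
    have "m \<noteq> 0" using ns mem unfolding jordan_nf_def by force
    then have "Polynomial.order a (char_poly A) \<noteq> 0" using jordan_nf_block_size_order_bound[OF ns mem] by simp
    then have "poly (char_poly A) a = 0" using order_root by blast
    then have "eigenvalue A a" using eigenvalue_root_char_poly[OF A] by blast
    then obtain v where v: "eigenvector A v a" unfolding eigenvalue_def by blast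
    then have vc: "v \<in> carrier_vec n" "v \<noteq> 0\<^sub>v n" using A unfolding eigenvector_def by auto
    have "a ^ k \<cdot>\<^sub>v v = A ^\<^sub>m k *\<^sub>v v" using eigenvector_pow[OF A v] by simp
    also have "\<dots> = 0\<^sub>v n" unfolding k using vc by (intro eq_vecI) auto
    finally have 0: "a ^ k \<cdot>\<^sub>v v = 0\<^sub>v n" .
    obtain i where i: "i < n" "v $ i \<noteq> 0" using vc by (metis carrier_vecD eq_vecI index_zero_vec)
    have "(a ^ k \<cdot>\<^sub>v v) $ i = a ^ k * v $ i" using vc i by simp
    then have "a ^ k = 0" using 0 i by simp
    then show "a = 0" by simp
  qed
  define ms where "ms = map fst ns"
  have ns_eq: "ns = map (\<lambda>k. (k, 0)) ms"
    unfolding ms_def using ev0 by (induction ns) auto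
  have sim: "similar_mat A (jordan_matrix ns)" and pos: "0 \<notin> set ms"
    using ns unfolding jordan_nf_def ms_def by auto
  define lam where "lam = rev (sort ms)"
  have mset: "mset lam = mset ms" unfolding lam_def by simp
  have "similar_mat (jordan_matrix ns) (Jnil lam)"
    unfolding Jnil_def ns_eq by (rule similar_jordan_matrix_mset) (simp add: mset)
  then have sim2: "similar_mat A (Jnil lam)" using similar_mat_trans sim by blast
  have "sum_list ms = n"
  proof -
    obtain P Q where "similar_mat_wit A (jordan_matrix ns) P Q" using sim unfolding similar_mat_def by blast
    from similar_mat_witD2(5)[OF A this] have "dim_row (jordan_matrix ns) = n" by (rule carrier_matD(1))
    then show ?thesis unfolding ms_def by (simp only: jordan_matrix_dim)
  qed
  then have "sum_list lam = n" using mset by (metis sum_mset_sum_list)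
  moreover have "\<forall>x\<in>set lam. 0 < x" using pos unfolding lam_def by (metis gr0I set_rev set_sort)
  moreover have "sorted_wrt (\<ge>) lam" unfolding lam_def by (simp add: sorted_wrt_rev)
  ultimately have "is_partition n lam" unfolding is_partition_def by blast
  then show ?thesis using sim2 by blast
qed

lemma diag_block_mat_zero: "(\<And>A. A \<in> set As \<Longrightarrow> \<exists>k. A = 0\<^sub>m k k) \<Longrightarrow> \<exists>k. diag_block_mat As = (0\<^sub>m k k :: complex mat)"
proof (induction As)
  case Nil
  then show ?case by (intro exI[of _ 0]) auto
next
  case (Cons A As)
  obtain k where "A = 0\<^sub>m k k" using Cons.prems[of A] by auto
  moreover obtain l where "diag_block_mat As = 0\<^sub>m l l" using Cons by force
  ultimately show ?case by (intro exI[of _ "k + l"]) (auto simp: Let_def intro!: eq_matI)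
qed

lemma Jnil_pow:
  assumes "is_partition n lam"
  shows "Jnil lam ^\<^sub>m n = 0\<^sub>m n n"
proof -
  have "\<exists>k. diag_block_mat (map (\<lambda>(m,a). jordan_block m a ^\<^sub>m n) (map (\<lambda>k. (k, 0 :: complex)) lam)) = 0\<^sub>m k k"
  proof (rule diag_block_mat_zero)
    fix A :: "complex mat"
    assume "A \<in> set (map (\<lambda>(m,a). jordan_block m a ^\<^sub>m n) (map (\<lambda>k. (k, 0)) lam))"
    then have "A \<in> (\<lambda>m. jordan_block m 0 ^\<^sub>m n) ` set lam"
      by (simp only: set_map image_image prod.case)
    then obtain m where m: "m \<in> set lam" "A = jordan_block m 0 ^\<^sub>m n" by (rule imageE) (rule that)
    have "m \<le> n" using member_le_sum_list[OF m(1)] assms unfolding is_partition_def by simp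
    then have "A = 0\<^sub>m m m" unfolding m(2) jordan_block_zero_pow by (intro eq_matI) auto
    then show "\<exists>k. A = 0\<^sub>m k k" by blast
  qed
  then obtain k where k: "Jnil lam ^\<^sub>m n = 0\<^sub>m k k" unfolding Jnil_def jordan_matrix_pow by blast
  have "Jnil lam ^\<^sub>m n \<in> carrier_mat n n" using Jnil_carrier[OF assms] by simp
  then show ?thesis unfolding k by auto
qed

text \<open>Nonzero entries join neighbouring indices only, where the alternating signs of
  \<open>sgnm n\<close> differ; hence \<open>sgnm n\<close> anticommutes with
  \<open>Jnil lam\<close>.\<close>

lemma Jnil_superdiagonal:
  "i < sum_list lam \<Longrightarrow> j < sum_list lam \<Longrightarrow> Jnil lam $$ (i,j) \<noteq> 0 \<Longrightarrow> j = Suc i"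
proof (induction lam arbitrary: i j)
  case Nil
  then show ?case by simp
next
  case (Cons m lam)
  have d: "dim_row (Jnil lam) = sum_list lam" "dim_col (Jnil lam) = sum_list lam"
    unfolding Jnil_def by (simp_all add: o_def)
  have *: "Jnil (m # lam) = four_block_mat (jordan_block m 0) (0\<^sub>m m (sum_list lam)) (0\<^sub>m (sum_list lam) m) (Jnil lam)"
    unfolding Jnil_def by (simp add: jordan_matrix_Cons o_def)
  have e: "Jnil (m # lam) $$ (i,j) = (if i < m then if j < m then jordan_block m 0 $$ (i,j) else 0
      else if j < m then 0 else Jnil lam $$ (i - m, j - m))"
    unfolding * using Cons.prems d by (subst index_mat_four_block) (auto simp: jordan_block_def)
  show ?case
  proof (cases "i < m")
    case True
    then show ?thesis using Cons.prems(3) unfolding e by (auto split: if_splits)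
  next
    case False
    then have "\<not> j < m" "Jnil lam $$ (i - m, j - m) \<noteq> 0" using Cons.prems(3) unfolding e by (auto split: if_splits)
    then have "j - m = Suc (i - m)" using Cons.IH[of "i - m" "j - m"] Cons.prems False by auto
    then show ?thesis using False by auto
  qed
qed

definition sgnm :: "nat \<Rightarrow> complex mat" where
  "sgnm n = mat n n (\<lambda>(i,j). if i = j then (-1) ^ i else 0)"

lemma signed_nilpotent_Jnil:
  assumes "is_partition n lam"
  shows "signed_nilpotent n (Jnil lam) (sgnm n)"
proof
  show J: "Jnil lam \<in> carrier_mat n n" by (rule Jnil_carrier[OF assms])
  show S: "sgnm n \<in> carrier_mat n n" unfolding sgnm_def by simp
  have left: "(sgnm n * M) $$ (i,j) = (-1) ^ i * M $$ (i,j)" if M: "M \<in> carrier_mat n n" and ij: "i < n" "j < n" for M i j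
  proof -
    have "(sgnm n * M) $$ (i,j) = (\<Sum>k<n. if k = i then (-1) ^ i * M $$ (i,j) else 0)"
      unfolding mult_mat_index[OF S M ij] using ij by (intro sum.cong) (auto simp: sgnm_def)
    then show ?thesis using ij by simp
  qed
  have right: "(M * sgnm n) $$ (i,j) = M $$ (i,j) * (-1) ^ j" if M: "M \<in> carrier_mat n n" and ij: "i < n" "j < n" for M i j
  proof -
    have "(M * sgnm n) $$ (i,j) = (\<Sum>k<n. if k = j then M $$ (i,j) * (-1) ^ j else 0)"
      unfolding mult_mat_index[OF M S ij] using ij by (intro sum.cong) (auto simp: sgnm_def)
    then show ?thesis using ij by simp
  qed
  show "sgnm n * sgnm n = 1\<^sub>m n"
  proof (rule eq_matI)
    fix i j assume "i < dim_row (1\<^sub>m n :: complex mat)" "j < dim_col (1\<^sub>m n :: complex mat)"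
    then have ij: "i < n" "j < n" by auto
    show "(sgnm n * sgnm n) $$ (i,j) = 1\<^sub>m n $$ (i,j)"
      unfolding left[OF S ij] using ij by (simp add: sgnm_def flip: power_add)
  qed (auto simp: sgnm_def)
  show "sgnm n * Jnil lam = - (Jnil lam * sgnm n)"
  proof (rule eq_matI)
    have d: "dim_row (Jnil lam * sgnm n) = n" "dim_col (Jnil lam * sgnm n) = n" using J S by auto
    fix i j assume "i < dim_row (- (Jnil lam * sgnm n))" "j < dim_col (- (Jnil lam * sgnm n))"
    then have ij: "i < n" "j < n" using d by auto
    have "(- (Jnil lam * sgnm n)) $$ (i,j) = - (Jnil lam $$ (i,j) * (-1) ^ j)"
      unfolding right[OF J ij, symmetric] using d ij by (intro index_uminus_mat(1)) auto
    moreover have "Jnil lam $$ (i,j) \<noteq> 0 \<Longrightarrow> j = Suc i"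
      using Jnil_superdiagonal[of i lam j] ij assms unfolding is_partition_def by auto
    ultimately show "(sgnm n * Jnil lam) $$ (i,j) = (- (Jnil lam * sgnm n)) $$ (i,j)"
      unfolding left[OF J ij] by (cases "Jnil lam $$ (i,j) = 0") auto
  qed (use J S in auto)
qed

section \<open>Semicontinuity of the kernel dimension\<close>

lemma kernel_dim_mono:
  fixes X Y :: "complex mat"
  assumes X: "X \<in> carrier_mat n n" and Y: "Y \<in> carrier_mat n n" and sub: "mat_kernel X \<subseteq> mat_kernel Y"
  shows "kernel_dim X \<le> kernel_dim Y"
proof -
  interpret X: kernel n n X by unfold_locales (rule X)
  interpret Y: kernel n n Y by unfold_locales (rule Y)
  obtain B where B: "finite B" "X.basis B" using kernel_basis_exists[OF X] by blast
  obtain C where C: "finite C" "Y.basis C" using kernel_basis_exists[OF Y] by blast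
  have BX: "B \<subseteq> mat_kernel X" and li: "X.lin_indpt B" using B(2) unfolding X.Ker.basis_def by auto
  have "Y.lin_indpt B" using X.lindep_same[OF BX] Y.lindep_same[of B] li BX sub by blast
  moreover have "Y.Ker.fin_dim" unfolding Y.Ker.fin_dim_def using C unfolding Y.Ker.basis_def by blast
  ultimately have "card B \<le> Y.dim" using Y.Ker.li_le_dim(2)[of B] BX sub by blast
  moreover have "X.dim = card B" using X.Ker.dim_basis[OF B] .
  ultimately show ?thesis by simp
qed

text \<open>Let \<open>C\<close> be the matrix in the determinant. \<open>M * G * M = M\<close>
  gives \<open>M * C = M * G * A\<close>, so for invertible \<open>C\<close> the kernel of
  \<open>A * C^-1\<close> lies in that of \<open>M\<close>. At \<open>A = M\<close> one has
  \<open>C = 1\<close>, so the condition defines a Zariski neighbourhood of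
  \<open>M\<close>.\<close>

lemma kernel_dim_le_if_det:
  fixes A M :: "complex mat"
  assumes A: "A \<in> carrier_mat n n" and M: "M \<in> carrier_mat n n" and G: "G \<in> carrier_mat n n"
    and MGM: "M * G * M = M" and det: "det (G * A + (1\<^sub>m n - G * M)) \<noteq> 0"
  shows "kernel_dim A \<le> kernel_dim M"
proof -
  define C where "C = G * A + (1\<^sub>m n - G * M)"
  have GM: "G * M \<in> carrier_mat n n" and GA: "G * A \<in> carrier_mat n n" using G M A by auto
  have C: "C \<in> carrier_mat n n" unfolding C_def by (rule add_carrier_mat[OF minus_carrier_mat[OF GM]])
  obtain D where D: "D \<in> carrier_mat n n" "C * D = 1\<^sub>m n" "D * C = 1\<^sub>m n"
    using det_nonzero_inverse[OF C] det unfolding C_def by blast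
  have AD: "A * D \<in> carrier_mat n n" using A D by simp
  have "M * C * D = M * (C * D)" by (rule assoc_mult_mat[OF M C D(1)])
  then have MCD: "M * C * D = M" unfolding D(2) using M by simp
  have MGA: "M * (G * A) = M * G * A" by (rule assoc_mult_mat[OF M G A, symmetric])
  have "M * C = M * (G * A) + M * (1\<^sub>m n - G * M)"
    unfolding C_def by (rule mult_add_distrib_mat[OF M GA minus_carrier_mat[OF GM]])
  also have "M * (1\<^sub>m n - G * M) = M * 1\<^sub>m n - M * (G * M)" by (rule mult_minus_distrib_mat[OF M one_carrier_mat GM])
  also have "\<dots> = 0\<^sub>m n n"
    using assoc_mult_mat[OF M G M] MGM M by (intro eq_matI) auto
  finally have MC: "M * C = M * G * A" unfolding MGA
    using mult_carrier_mat[OF mult_carrier_mat[OF M G] A] by simp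
  have MG: "M * G \<in> carrier_mat n n" using M G by simp
  have "M = M * G * (A * D)" using MCD unfolding MC assoc_mult_mat[OF MG A D(1)] by simp
  then have "mat_kernel (A * D) \<subseteq> mat_kernel M" using mat_kernel_mult_subset[OF AD MG] by simp
  then have "kernel_dim (A * D) \<le> kernel_dim M" by (rule kernel_dim_mono[OF AD M])
  moreover have "kernel_dim (A * D) = kernel_dim A"
    unfolding kernel_dim_def using mat_kernel_dim_mult_eq_right[OF A D(1) C D(3)] A D by simp
  ultimately show ?thesis by simp
qed

lemma dim_gen_eigenspace_0:
  "A \<in> carrier_mat n n \<Longrightarrow> dim_gen_eigenspace (A :: complex mat) 0 k = kernel_dim (A ^\<^sub>m k)"
proof -
  assume A: "A \<in> carrier_mat n n"
  have "char_matrix A 0 = A" unfolding char_matrix_def using A by (intro eq_matI) auto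
  then show ?thesis unfolding dim_gen_eigenspace_def by simp
qed

text \<open>The number of blocks of each size is computed from these dimensions alone, and a
  decreasing list of positive parts is determined by its multiplicities.\<close>

lemma dim_gen_eigenspace_Jnil_inject:
  assumes "is_partition n lam" "is_partition n mu"
    and eq: "\<And>k. dim_gen_eigenspace (Jnil lam) 0 k = dim_gen_eigenspace (Jnil mu) 0 k"
  shows "lam = mu"
proof -
  have nf: "jordan_nf (Jnil l) (map (\<lambda>k. (k, 0)) l)" if "is_partition n l" for l
    using that Jnil_carrier[OF that] unfolding jordan_nf_def Jnil_def is_partition_def
    by (auto intro: similar_mat_refl)
  have cnt: "compute_nr_of_jordan_blocks (Jnil l) 0 k = count (mset l) k" if "is_partition n l" "k \<noteq> 0" for l k
  proof -
    have "length (filter ((=) (k, 0::complex)) (map (\<lambda>k. (k, 0)) l)) = count (mset l) k"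
      by (induction l) auto
    then show ?thesis using compute_nr_of_jordan_blocks[OF nf[OF that(1)] that(2)] by simp
  qed
  have "count (mset lam) k = count (mset mu) k" for k
  proof (cases "k = 0")
    case True
    have "0 \<notin> set lam" "0 \<notin> set mu" using assms(1,2) unfolding is_partition_def by auto
    then show ?thesis using True by (simp add: count_eq_zero_iff[THEN iffD2])
  next
    case False
    have "compute_nr_of_jordan_blocks (Jnil lam) 0 k = compute_nr_of_jordan_blocks (Jnil mu) 0 k"
      unfolding compute_nr_of_jordan_blocks_def eq ..
    then show ?thesis using cnt assms False by simp
  qed
  then have "mset (rev lam) = mset (rev mu)" by (simp add: multiset_eq_iff)
  moreover have "sorted (rev lam)" "sorted (rev mu)"
    using assms(1,2) unfolding is_partition_def by (auto simp: sorted_wrt_rev)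
  ultimately have "rev lam = rev mu" by (metis properties_for_sort sorted_sort_id)
  then show ?thesis by simp
qed

section \<open>The components of the anticommuting variety\<close>

lemma NN_Jnil_iff:
  assumes "is_partition n lam"
  shows "(Jnil lam, B) \<in> NN n \<longleftrightarrow> B \<in> carrier_mat n n \<and> Jnil lam * B + B * Jnil lam = 0\<^sub>m n n"
  using Jnil_carrier[OF assms] Jnil_pow[OF assms] unfolding NN_def pairs_space_def nilpotent_mat_def by auto

lemma orbits_J_orb:
  assumes "is_partition n lam"
  shows "orbits_J n lam = signed_nilpotent.orb n (Jnil lam)"
proof -
  interpret signed_nilpotent n "Jnil lam" "sgnm n" by (rule signed_nilpotent_Jnil[OF assms])
  show ?thesis unfolding orbits_J_def orb_def NN_Jnil_iff[OF assms] ..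
qed

lemma NN_lam_orbcl:
  assumes "is_partition n lam"
  shows "NN_lam n lam = signed_nilpotent.orbcl n (Jnil lam)"
proof -
  interpret signed_nilpotent n "Jnil lam" "sgnm n" by (rule signed_nilpotent_Jnil[OF assms])
  show ?thesis unfolding NN_lam_def orbcl_def orbits_J_orb[OF assms] ..
qed

lemma zirreducible_NN_lam:
  assumes "is_partition n lam"
  shows "zirreducible (pairs_space n) (pair_coords n) (NN_lam n lam)"
proof -
  interpret signed_nilpotent n "Jnil lam" "sgnm n" by (rule signed_nilpotent_Jnil[OF assms])
  show ?thesis unfolding NN_lam_orbcl[OF assms] by (rule zirreducible_orbcl)
qed

lemma zclosed_NN_lam: "zclosed (pairs_space n) (pair_coords n) (NN_lam n lam)"
  unfolding NN_lam_def by (rule zclosed_zclosure)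

lemma zdim_NN_lam:
  assumes "is_partition n lam"
  shows "zdim (pairs_space n) (pair_coords n) (NN_lam n lam) = enat (n*n)"
proof -
  interpret signed_nilpotent n "Jnil lam" "sgnm n" by (rule signed_nilpotent_Jnil[OF assms])
  show ?thesis unfolding NN_lam_orbcl[OF assms] by (rule zdim_orbcl)
qed

lemma NN_lam_chain:
  assumes "is_partition n lam"
  shows "\<exists>Z. Z (n*n) = NN_lam n lam
    \<and> (\<forall>i. zclosed (pairs_space n) (pair_coords n) (Z i) \<and> zirreducible (pairs_space n) (pair_coords n) (Z i))
    \<and> (\<forall>i<n*n. Z i \<subset> Z (Suc i))"
proof -
  interpret signed_nilpotent n "Jnil lam" "sgnm n" by (rule signed_nilpotent_Jnil[OF assms])
  have "zclosed (pairs_space n) (pair_coords n) (flag i)" for i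
    unfolding flag_def by (rule zclosed_zclosure)
  then show ?thesis unfolding NN_lam_orbcl[OF assms]
    using flag_top zirreducible_flag flag_strict by blast
qed

lemma orbits_J_subset: "is_partition n lam \<Longrightarrow> orbits_J n lam \<subseteq> pairs_space n"
  using Jnil_carrier[of n lam] unfolding orbits_J_def NN_def pairs_space_def by auto

lemma conj_anticommutator:
  fixes A B P Q :: "complex mat"
  assumes "A \<in> carrier_mat n n" "B \<in> carrier_mat n n" "P \<in> carrier_mat n n" "Q \<in> carrier_mat n n" "Q * P = 1\<^sub>m n"
  shows "(P * A * Q) * (P * B * Q) + (P * B * Q) * (P * A * Q) = P * (A * B + B * A) * Q"
proof -
  have m: "(P * A * Q) * (P * B * Q) = P * (A * B) * Q"
    if c: "A \<in> carrier_mat n n" "B \<in> carrier_mat n n" for A B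
  proof -
    have PA: "P * A \<in> carrier_mat n n" and BQ: "B * Q \<in> carrier_mat n n" using c assms by auto
    have "P * B * Q = P * (B * Q)" by (rule assoc_mult_mat[OF assms(3) c(2) assms(4)])
    then have "(P * A * Q) * (P * B * Q) = P * A * (Q * (P * (B * Q)))"
      using assoc_mult_mat[OF PA assms(4) mult_carrier_mat[OF assms(3) BQ]] by simp
    also have "Q * (P * (B * Q)) = B * Q"
      using assoc_mult_mat[OF assms(4,3) BQ] unfolding assms(5) left_mult_one_mat[OF BQ] by simp
    also have "P * A * (B * Q) = P * A * B * Q" by (rule assoc_mult_mat[OF PA c(2) assms(4), symmetric])
    also have "P * A * B = P * (A * B)" by (rule assoc_mult_mat[OF assms(3) c])
    finally show ?thesis .
  qed
  have AB: "A * B \<in> carrier_mat n n" "B * A \<in> carrier_mat n n" using assms by auto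
  have "P * (A * B + B * A) * Q = (P * (A * B) + P * (B * A)) * Q"
    unfolding mult_add_distrib_mat[OF assms(3) AB] ..
  also have "\<dots> = P * (A * B) * Q + P * (B * A) * Q"
    by (rule add_mult_distrib_mat[OF mult_carrier_mat[OF assms(3) AB(1)] mult_carrier_mat[OF assms(3) AB(2)] assms(4)])
  finally show ?thesis using m assms by simp
qed

lemma similar_mat_wit_conj:
  fixes A P Q :: "complex mat"
  assumes "A \<in> carrier_mat n n" "P \<in> carrier_mat n n" "Q \<in> carrier_mat n n" "P * Q = 1\<^sub>m n"
  shows "similar_mat_wit (P * A * Q) A P Q"
  by (rule similar_mat_witI[where n = n])
    (use assms mat_mult_left_right_inverse[OF assms(2-4)] in auto)

text \<open>Replaces the unspecified exponent in \<open>nilpotent_mat\<close> by \<open>n\<close>,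
  which turns nilpotency into polynomial equations for \<open>zclosed_NN\<close>.\<close>

lemma NN_pow:
  assumes "(A, B) \<in> NN n"
  shows "A ^\<^sub>m n = 0\<^sub>m n n"
proof -
  have A: "A \<in> carrier_mat n n" "nilpotent_mat A" using assms unfolding NN_def pairs_space_def by auto
  obtain lam where lam: "is_partition n lam" "similar_mat A (Jnil lam)"
    using nilpotent_similar_Jnil[OF A] by blast
  then obtain P Q where w: "similar_mat_wit A (Jnil lam) P Q" unfolding similar_mat_def by blast
  note d = similar_mat_witD2[OF A(1) w]
  have "A ^\<^sub>m n = P * Jnil lam ^\<^sub>m n * Q" by (rule similar_mat_wit_pow_id[OF w])
  also have "\<dots> = 0\<^sub>m n n" unfolding Jnil_pow[OF lam(1)] right_mult_zero_mat[OF d(6)] by (rule left_mult_zero_mat[OF d(7)])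
  finally show ?thesis .
qed

lemma orbits_J_NN:
  assumes part: "is_partition n lam"
  shows "orbits_J n lam \<subseteq> NN n"
proof
  fix y assume "y \<in> orbits_J n lam"
  then obtain P Q B where c: "P \<in> carrier_mat n n" "Q \<in> carrier_mat n n" "P * Q = 1\<^sub>m n"
    and NN: "(Jnil lam, B) \<in> NN n" and y: "y = (P * Jnil lam * Q, P * B * Q)" unfolding orbits_J_def by blast
  note QP = mat_mult_left_right_inverse[OF c]
  note J = Jnil_carrier[OF part]
  have B: "B \<in> carrier_mat n n" "Jnil lam * B + B * Jnil lam = 0\<^sub>m n n" using NN NN_Jnil_iff[OF part] by auto
  have JQ: "P * Jnil lam * Q \<in> carrier_mat n n" using c J by auto
  have "(P * Jnil lam * Q) ^\<^sub>m n = P * Jnil lam ^\<^sub>m n * Q"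
    by (rule similar_mat_wit_pow_id[OF similar_mat_wit_conj[OF J c]])
  also have "\<dots> = 0\<^sub>m n n"
    unfolding Jnil_pow[OF part] right_mult_zero_mat[OF c(1)] by (rule left_mult_zero_mat[OF c(2)])
  finally have "nilpotent_mat (P * Jnil lam * Q)"
    unfolding nilpotent_mat_def carrier_matD[OF JQ] by blast
  moreover have "(P * Jnil lam * Q) * (P * B * Q) + (P * B * Q) * (P * Jnil lam * Q) = 0\<^sub>m n n"
    unfolding conj_anticommutator[OF J B(1) c(1,2) QP] B(2) right_mult_zero_mat[OF c(1)]
    by (rule left_mult_zero_mat[OF c(2)])
  moreover have "P * B * Q \<in> carrier_mat n n" using c B by auto
  ultimately show "y \<in> NN n" unfolding y NN_def pairs_space_def using JQ by blast
qed

lemma zclosed_NN: "zclosed (pairs_space n) (pair_coords n) (NN n)"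
proof -
  define M where "M y = fstm n y * sndm n y + sndm n y * fstm n y" for y
  define W where "W y = fstm n y ^\<^sub>m n" for y
  have Mp: "polymat (pair_coords n) n n M" unfolding M_def
    by (intro polymat_add polymat_mult[where l = n] polymat_fstm polymat_sndm)
  have Wp: "polymat (pair_coords n) n n W" unfolding W_def by (rule polymat_power[OF polymat_fstm])
  define F where "F = (\<lambda>(i,j) y. M y $$ (i,j)) ` ({..<n} \<times> {..<n}) \<union> (\<lambda>(i,j) y. W y $$ (i,j)) ` ({..<n} \<times> {..<n})"
  have Fp: "F \<subseteq> polyfuns (pair_coords n)"
    unfolding F_def using polymat_entry[OF Mp] polymat_entry[OF Wp] by auto
  have "y \<in> NN n \<longleftrightarrow> y \<in> pairs_space n \<and> (\<forall>f\<in>F. f y = 0)" for y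
  proof -
    obtain A B where y: "y = (A, B)" by force
    show ?thesis
    proof (cases "A \<in> carrier_mat n n \<and> B \<in> carrier_mat n n")
      case False
      then show ?thesis unfolding y NN_def pairs_space_def by auto
    next
      case True
      then have A: "A \<in> carrier_mat n n" and B: "B \<in> carrier_mat n n" by auto
      have My: "M y = A * B + B * A" and Wy: "W y = A ^\<^sub>m n"
        unfolding M_def W_def y fstm_sndm(1)[OF A] fstm_sndm(2)[OF B] by simp_all
      have ent: "(\<forall>i<n. \<forall>j<n. C $$ (i,j) = 0) \<longleftrightarrow> C = 0\<^sub>m n n" if "C \<in> carrier_mat n n" for C :: "complex mat"
        using that by (auto intro!: eq_matI)
      have "(\<forall>f\<in>F. f y = 0) \<longleftrightarrow> (\<forall>i<n. \<forall>j<n. M y $$ (i,j) = 0) \<and> (\<forall>i<n. \<forall>j<n. W y $$ (i,j) = 0)"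
        unfolding F_def ball_Un ball_simps(9) by (simp add: Ball_def) blast
      also have "\<dots> \<longleftrightarrow> A * B + B * A = 0\<^sub>m n n \<and> A ^\<^sub>m n = 0\<^sub>m n n"
        using ent[OF polymat_carrier[OF Mp, of y]] ent[OF polymat_carrier[OF Wp, of y]] unfolding My Wy by blast
      finally have 1: "(\<forall>f\<in>F. f y = 0) \<longleftrightarrow> A * B + B * A = 0\<^sub>m n n \<and> A ^\<^sub>m n = 0\<^sub>m n n" .
      show ?thesis
      proof
        assume "y \<in> NN n"
        then show "y \<in> pairs_space n \<and> (\<forall>f\<in>F. f y = 0)"
          using NN_pow[of A B n] unfolding 1 unfolding y NN_def by auto
      next
        assume "y \<in> pairs_space n \<and> (\<forall>f\<in>F. f y = 0)"
        then show "y \<in> NN n" unfolding 1 unfolding y NN_def nilpotent_mat_def using A by auto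
      qed
    qed
  qed
  then have "NN n = {y \<in> pairs_space n. \<forall>f\<in>F. f y = 0}" by blast
  then show ?thesis unfolding zclosed_def using Fp by blast
qed

lemma NN_subset_orbits: "NN n \<subseteq> (\<Union>lam\<in>{lam. is_partition n lam}. orbits_J n lam)"
proof
  fix y assume y: "y \<in> NN n"
  obtain A B where yAB: "y = (A, B)" by force
  have A: "A \<in> carrier_mat n n" "nilpotent_mat A" and B: "B \<in> carrier_mat n n" and AB: "A * B + B * A = 0\<^sub>m n n"
    using y unfolding yAB NN_def pairs_space_def by auto
  obtain lam where lam: "is_partition n lam" "similar_mat A (Jnil lam)"
    using nilpotent_similar_Jnil[OF A] by blast
  then obtain P Q where w: "similar_mat_wit A (Jnil lam) P Q" unfolding similar_mat_def by blast
  note d = similar_mat_witD2[OF A(1) w]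
  note e = similar_mat_witD2(3)[OF d(5) similar_mat_wit_sym[OF w]]
  \<comment> \<open>The matrix \<open>B\<close> in the basis in which \<open>A\<close> becomes
    \<open>Jnil lam\<close>.\<close>
  define B' where "B' = Q * B * P"
  have QB: "Q * B \<in> carrier_mat n n" and PQB: "P * (Q * B) \<in> carrier_mat n n" using d B by auto
  have B': "B' \<in> carrier_mat n n" unfolding B'_def by (rule mult_carrier_mat[OF QB d(6)])
  have "P * B' = P * (Q * B) * P" unfolding B'_def by (rule assoc_mult_mat[OF d(6) QB d(6), symmetric])
  also have "P * (Q * B) = B" using assoc_mult_mat[OF d(6,7) B] d(1) B by simp
  finally have "P * B' * Q = B * (P * Q)" using assoc_mult_mat[OF B d(6,7)] by simp
  then have PB: "P * B' * Q = B" using d(1) B by simp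
  have "Jnil lam * B' + B' * Jnil lam = Q * (A * B + B * A) * P"
    unfolding B'_def using conj_anticommutator[OF A(1) B d(7,6,1)] e by simp
  also have "\<dots> = 0\<^sub>m n n" unfolding AB right_mult_zero_mat[OF d(7)] by (rule left_mult_zero_mat[OF d(6)])
  finally have "(Jnil lam, B') \<in> NN n" using NN_Jnil_iff[OF lam(1)] B' by blast
  then have "y \<in> orbits_J n lam"
    unfolding orbits_J_def yAB using d(1,3,6,7) PB by blast
  then show "y \<in> (\<Union>lam\<in>{lam. is_partition n lam}. orbits_J n lam)" using lam(1) by blast
qed

lemma NN_eq_Union: "NN n = (\<Union>lam\<in>{lam. is_partition n lam}. NN_lam n lam)"
proof
  show "NN n \<subseteq> (\<Union>lam\<in>{lam. is_partition n lam}. NN_lam n lam)"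
    using NN_subset_orbits[of n] subset_zclosure[OF orbits_J_subset[of n], of _ "pair_coords n"]
    unfolding NN_lam_def by blast
  show "(\<Union>lam\<in>{lam. is_partition n lam}. NN_lam n lam) \<subseteq> NN n"
    using zclosure_minimal[OF zclosed_NN orbits_J_NN] unfolding NN_lam_def by blast
qed

lemma finite_partitions: "finite {lam. is_partition n lam}"
proof (rule finite_subset)
  show "{lam. is_partition n lam} \<subseteq> {xs. set xs \<subseteq> {..n} \<and> length xs \<le> n}"
  proof
    fix lam assume "lam \<in> {lam. is_partition n lam}"
    then have p: "\<forall>x\<in>set lam. 0 < x" "sum_list lam = n" unfolding is_partition_def by auto
    have "length lam \<le> sum_list lam" using p(1)
    proof (induction lam)
      case (Cons a lam)
      then have "length lam \<le> sum_list lam" "0 < a" by auto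
      then show ?case by simp
    qed simp
    moreover have "set lam \<subseteq> {..n}" using member_le_sum_list[of _ lam] p by auto
    ultimately show "lam \<in> {xs. set xs \<subseteq> {..n} \<and> length xs \<le> n}" using p by blast
  qed
qed (rule finite_lists_length_le, simp)

text \<open>\<open>(Jnil lam, 0)\<close> lies in the closure of the orbits for \<open>mu\<close>, so
  a polynomial function that is nonzero there is nonzero somewhere on those orbits. The
  semicontinuity criterion, applied to the \<open>k\<close>-th power, gives the inequality at such a
  point.\<close>

lemma dim_gen_eigenspace_NN_lam_le:
  assumes lam: "is_partition n lam" and mu: "is_partition n mu" and eq: "NN_lam n lam = NN_lam n mu"
  shows "dim_gen_eigenspace (Jnil mu) 0 k \<le> dim_gen_eigenspace (Jnil lam) 0 k"
proof -
  note Jl = Jnil_carrier[OF lam] and Jm = Jnil_carrier[OF mu]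
  define M where "M = Jnil lam ^\<^sub>m k"
  have M: "M \<in> carrier_mat n n" unfolding M_def using Jl by simp
  obtain G where G: "G \<in> carrier_mat n n" "M * G * M = M" using generalized_inverse[OF M] by blast
  have GM: "G * M \<in> carrier_mat n n" using G M by simp
  \<comment> \<open>The open condition of \<open>kernel_dim_le_if_det\<close> on the
    \<open>k\<close>-th power of the first component; its value at \<open>Jnil lam\<close> is the
    determinant of the identity.\<close>
  define q where "q y = det (G * (fstm n y ^\<^sub>m k) + (1\<^sub>m n - G * M))" for y
  have q: "q \<in> polyfuns (pair_coords n)" unfolding q_def
    by (rule polymat_det, rule polymat_add[OF polymat_mult[OF polymat_const[OF G(1)] polymat_power[OF polymat_fstm]]
        polymat_const[OF minus_carrier_mat[OF GM]]])
  have "(Jnil lam, 0\<^sub>m n n) \<in> orbits_J n lam"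
  proof -
    have "(Jnil lam, 0\<^sub>m n n) \<in> NN n" unfolding NN_Jnil_iff[OF lam] using Jl by simp
    moreover have "(Jnil lam, 0\<^sub>m n n) = (1\<^sub>m n * Jnil lam * 1\<^sub>m n, 1\<^sub>m n * 0\<^sub>m n n * 1\<^sub>m n)" using Jl by simp
    ultimately show ?thesis unfolding orbits_J_def using one_carrier_mat[of n] left_mult_one_mat[OF one_carrier_mat, of n] by blast
  qed
  then have "(Jnil lam, 0\<^sub>m n n) \<in> NN_lam n mu"
    using subset_zclosure[OF orbits_J_subset[OF lam], of "pair_coords n"] unfolding eq[symmetric] unfolding NN_lam_def by blast
  moreover have "q (Jnil lam, 0\<^sub>m n n) \<noteq> 0"
  proof -
    have "G * M + (1\<^sub>m n - G * M) = 1\<^sub>m n" using carrier_matD[OF GM] by (intro eq_matI) (auto simp del: index_mult_mat(1))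
    then show ?thesis unfolding q_def fstm_sndm(1)[OF Jl] M_def[symmetric] by simp
  qed
  ultimately obtain y where y: "y \<in> orbits_J n mu" "q y \<noteq> 0"
    using zclosure_vanish[OF orbits_J_subset[OF mu] q] unfolding NN_lam_def by blast
  then obtain P Q B where c: "P \<in> carrier_mat n n" "Q \<in> carrier_mat n n" "P * Q = 1\<^sub>m n"
    and yP: "y = (P * Jnil mu * Q, P * B * Q)" unfolding orbits_J_def by blast
  define A where "A = P * Jnil mu * Q"
  have A: "A \<in> carrier_mat n n" unfolding A_def using c Jm by auto
  have "similar_mat A (Jnil mu)" using similar_mat_wit_conj[OF Jm c] unfolding A_def similar_mat_def by blast
  then have "dim_gen_eigenspace (Jnil mu) 0 k = dim_gen_eigenspace A 0 k" by (simp add: dim_gen_eigenspace_similar)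
  also have "\<dots> = kernel_dim (A ^\<^sub>m k)" by (rule dim_gen_eigenspace_0[OF A])
  also have "\<dots> \<le> kernel_dim M"
  proof (rule kernel_dim_le_if_det[OF _ M G])
    show "A ^\<^sub>m k \<in> carrier_mat n n" using A by simp
    show "det (G * (A ^\<^sub>m k) + (1\<^sub>m n - G * M)) \<noteq> 0"
      using y(2) unfolding q_def yP A_def[symmetric] fstm_sndm(1)[OF A] .
  qed
  also have "\<dots> = dim_gen_eigenspace (Jnil lam) 0 k" unfolding M_def by (rule dim_gen_eigenspace_0[OF Jl, symmetric])
  finally show ?thesis .
qed

lemma NN_lam_inject:
  assumes lam: "is_partition n lam" and mu: "is_partition n mu" and eq: "NN_lam n lam = NN_lam n mu"
  shows "lam = mu"
  by (rule dim_gen_eigenspace_Jnil_inject[OF lam mu])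
    (rule antisym[OF dim_gen_eigenspace_NN_lam_le[OF mu lam eq[symmetric]] dim_gen_eigenspace_NN_lam_le[OF lam mu eq]])

text \<open>A proper inclusion would extend a chain of length \<open>n\<^sup>2\<close> in \<open>NN_lam n lam\<close> to a longer one in
  \<open>NN_lam n mu\<close>.\<close>

lemma NN_lam_subset_eq:
  assumes lam: "is_partition n lam" and mu: "is_partition n mu" and sub: "NN_lam n lam \<subseteq> NN_lam n mu"
  shows "NN_lam n lam = NN_lam n mu"
proof (rule ccontr)
  assume ne: "NN_lam n lam \<noteq> NN_lam n mu"
  obtain Z where Z: "Z (n*n) = NN_lam n lam"
    "\<And>i. zclosed (pairs_space n) (pair_coords n) (Z i) \<and> zirreducible (pairs_space n) (pair_coords n) (Z i)"
    "\<And>i. i < n*n \<Longrightarrow> Z i \<subset> Z (Suc i)"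
    using NN_lam_chain[OF lam] by blast
  define Z' where "Z' i = (if i \<le> n*n then Z i else NN_lam n mu)" for i
  have Zsub: "Z i \<subseteq> NN_lam n lam" if "i \<le> n*n" for i
    using that
  proof (induction rule: inc_induct)
    case base
    then show ?case using Z(1) by simp
  next
    case (step i)
    then show ?case using Z(3)[of i] by auto
  qed
  have cl: "zclosed (pairs_space n) (pair_coords n) (Z' i) \<and> zirreducible (pairs_space n) (pair_coords n) (Z' i)" for i
    using Z(2) zclosed_NN_lam zirreducible_NN_lam[OF mu] unfolding Z'_def by auto
  have sub': "Z' i \<subseteq> NN_lam n mu" for i using Zsub sub unfolding Z'_def by auto
  have strict: "Z' i \<subset> Z' (Suc i)" if "i < Suc (n*n)" for i
  proof (cases "i = n*n")
    case True
    then show ?thesis using Z(1) sub ne unfolding Z'_def by auto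
  next
    case False
    then show ?thesis using Z(3)[of i] that unfolding Z'_def by auto
  qed
  have "enat (Suc (n*n)) \<le> zdim (pairs_space n) (pair_coords n) (NN_lam n mu)"
    unfolding zdim_def
    by (rule Sup_upper, rule CollectI, rule exI[of _ "Suc (n*n)"]) (intro conjI exI[of _ Z'] refl allI impI cl[THEN conjunct1] cl[THEN conjunct2] sub' strict)
  then show False unfolding zdim_NN_lam[OF mu] by simp
qed

theorem theorem6p3:
  fixes n :: nat
  assumes "n \<ge> 1"
  shows "zcomponents (pairs_space n) (pair_coords n) (NN n) = NN_lam n ` {lam. is_partition n lam}
       \<and> inj_on (NN_lam n) {lam. is_partition n lam}
       \<and> (\<forall>lam. is_partition n lam \<longrightarrow> zdim (pairs_space n) (pair_coords n) (NN_lam n lam) = enat (n^2))"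
proof (intro conjI allI impI inj_onI)
  \<comment> \<open>There are finitely many partitions, so the finite-union property of irreducible
    sets applies.\<close>
  have inside: "\<exists>mu. is_partition n mu \<and> W \<subseteq> NN_lam n mu"
    if "W \<subseteq> NN n" "zirreducible (pairs_space n) (pair_coords n) W" for W
    using zirreducible_Union[OF finite_partitions[of n] that(2), where C = "NN_lam n"] zclosed_NN_lam that(1)
    unfolding NN_eq_Union by blast
  show "zcomponents (pairs_space n) (pair_coords n) (NN n) = NN_lam n ` {lam. is_partition n lam}"
  proof
    show "zcomponents (pairs_space n) (pair_coords n) (NN n) \<subseteq> NN_lam n ` {lam. is_partition n lam}"
    proof
      fix Z assume "Z \<in> zcomponents (pairs_space n) (pair_coords n) (NN n)"
      then have Z: "Z \<subseteq> NN n" "zirreducible (pairs_space n) (pair_coords n) Z"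
        and max: "\<And>W. W \<subseteq> NN n \<Longrightarrow> zclosed (pairs_space n) (pair_coords n) W \<Longrightarrow>
           zirreducible (pairs_space n) (pair_coords n) W \<Longrightarrow> Z \<subseteq> W \<Longrightarrow> W = Z"
        unfolding zcomponents_def by blast+
      obtain mu where mu: "is_partition n mu" "Z \<subseteq> NN_lam n mu" using inside[OF Z] by blast
      have "NN_lam n mu \<subseteq> NN n" using mu(1) unfolding NN_eq_Union by blast
      then have "NN_lam n mu = Z" by (rule max[OF _ zclosed_NN_lam zirreducible_NN_lam[OF mu(1)] mu(2)])
      then show "Z \<in> NN_lam n ` {lam. is_partition n lam}" using mu(1) by blast
    qed
    show "NN_lam n ` {lam. is_partition n lam} \<subseteq> zcomponents (pairs_space n) (pair_coords n) (NN n)"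
    proof (rule image_subsetI)
      fix lam assume "lam \<in> {lam. is_partition n lam}"
      then have lam: "is_partition n lam" by simp
      have "NN_lam n lam \<subseteq> NN n" using lam unfolding NN_eq_Union by blast
      moreover have "W = NN_lam n lam"
        if W: "W \<subseteq> NN n" "zirreducible (pairs_space n) (pair_coords n) W" "NN_lam n lam \<subseteq> W" for W
      proof -
        \<comment> \<open>\<open>W\<close> is squeezed between the closures for \<open>lam\<close>
          and \<open>mu\<close>, which coincide because neither of two distinct closures contains
          the other.\<close>
        obtain mu where mu: "is_partition n mu" "W \<subseteq> NN_lam n mu" using inside[OF W(1,2)] by blast
        then have "NN_lam n lam = NN_lam n mu" using NN_lam_subset_eq[OF lam mu(1)] W(3) by blast
        then show ?thesis using W(3) mu(2) by blast
      qed
      ultimately show "NN_lam n lam \<in> zcomponents (pairs_space n) (pair_coords n) (NN n)"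
        unfolding zcomponents_def using zclosed_NN_lam zirreducible_NN_lam[OF lam] by blast
    qed
  qed
next
  fix lam mu assume "lam \<in> {lam. is_partition n lam}" "mu \<in> {lam. is_partition n lam}" "NN_lam n lam = NN_lam n mu"
  then show "lam = mu" using NN_lam_inject by blast
next
  fix lam assume "is_partition n lam"
  then show "zdim (pairs_space n) (pair_coords n) (NN_lam n lam) = enat (n^2)"
    using zdim_NN_lam by (simp add: power2_eq_square)
qed

end
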